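(* (i) If $r\in\mathbb{C}\setminus\mathbb{Z}_{\ge2}$, the restriction morphism of sheaves $\rho_r:\mathcal{W}^\omega_r\to\mathcal{V}^\omega_{2-r}$ on $\mathbb{P}^1(\mathbb{R})$ is an isomorphism. (ii) Let $r\in\mathbb{Z}_{\ge1}$ and let $\mathcal{W}^{\omega,\mathrm{hol}}_r$ be the subsheaf of $\mathcal{W}^\omega_r$ given by $\mathcal{W}^{\omega,\mathrm{hol}}_r(I)=\varinjlim_U\mathcal{H}^{\mathrm{hol}}_r(U)$, $U$ running over the open neighbourhoods in $\mathbb{P}^1(\mathbb{C})$ of the open set $I\subset\mathbb{P}^1(\mathbb{R})$. (a) If $r=1$, then $\mathcal{W}^{\omega,\mathrm{hol}}_1=\mathcal{W}^\omega_1$. (b) If $r\in\mathbb{Z}_{\ge2}$, the sequence of sheaves $0\to\mathcal{W}^{\omega,\mathrm{hol}}_r\to\mathcal{W}^\omega_r\xrightarrow{\mathrm{res}_r}\mathcal{D}^{\mathrm{pol}}_{2-r}\to0$ is exact, where $\mathcal{D}^{\mathrm{pol}}_{2-r}$ is the space of polynomials of degree at most $r-2$, viewed as a constant sheaf on $\mathbb{P}^1(\mathbb{R})$.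
   Context: $\mathbb{H}$ upper half-plane, $z=x+iy$. For open $V\subset\mathbb{H}$, $\mathcal{H}_r(V)$ is the space of $C^2$ functions $F$ on $V$ with $-4y^2\partial_z\partial_{\bar z}F+2iry\partial_{\bar z}F=0$ ($r$-harmonic). Put $f_r(z)=\frac{2i}{z-i}\left(\frac{\bar z-i}{\bar z-z}\right)^{r-1}$ on $\mathbb{H}\setminus\{i\}$ (power defined by a continuous branch on $\mathbb{H}$). For open $U\subset\mathbb{P}^1(\mathbb{C})$: $\mathcal{H}^b_r(U)=\{F\in\mathcal{H}_r(U\cap\mathbb{H}):F/f_r$ has a real-analytic continuation to $U\}$; $\mathcal{H}^{\mathrm{hol}}_r(U)=\{F\in\mathcal{H}^b_r(U): F$ holomorphic on $U\cap\mathbb{H}$ with a holomorphic extension to $U\}$. For open $I\subset\mathbb{P}^1(\mathbb{R})$: $\mathcal{W}^\omega_r(I)=\varinjlim_U\mathcal{H}^b_r(U)$ and $\mathcal{V}^\omega_{2-r}(I)=\varinjlim_U\mathcal{O}(U)$ ($\mathcal{O}$ = holomorphic functions), $U$ over open neighbourhoods of $I$ in $\mathbb{P}^1(\mathbb{C})$ (i.e. $\mathcal{V}^\omega_{2-r}$ is the sheaf of real-analytic functions on $\mathbb{P}^1(\mathbb{R})$). The restriction morphism $\rho_r$ sends the germ of $F\in\mathcal{H}^b_r(U)$ to the germ along $I$ of the real-analytic function on $I$ obtained by restricting to $I$ the real-analytic continuation of $F/f_r$. $\mathrm{res}_r f(t)=(i-t)^{r-2}(\rho_rf)(t)$. *)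

theory Defs
  imports "HOL-Analysis.Analysis" "HOL-Computational_Algebra.Polynomial"
begin

section \<open>The Riemann sphere P^1(C) as complex option (None = infinity)\<close>

definition p1_open :: "complex option set \<Rightarrow> bool" where
  "p1_open U \<longleftrightarrow> open {z. Some z \<in> U} \<and>
     (None \<in> U \<longrightarrow> (\<exists>R. \<forall>z. R < norm z \<longrightarrow> Some z \<in> U))"

definition p1R :: "complex option set" where
  "p1R = insert None (Some ` (range complex_of_real))"

definition p1R_open :: "complex option set \<Rightarrow> bool" where
  "p1R_open I \<longleftrightarrow> (\<exists>U. p1_open U \<and> I = U \<inter> p1R)"

definition upper_part :: "complex option set \<Rightarrow> complex set" where
  "upper_part U = {z. Some z \<in> U \<and> 0 < Im z}"

definition real_analytic_at :: "(complex \<Rightarrow> complex) \<Rightarrow> complex \<Rightarrow> bool" where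
  "real_analytic_at g z0 \<longleftrightarrow> (\<exists>(a::nat \<Rightarrow> nat \<Rightarrow> complex) \<epsilon>. 0 < \<epsilon> \<and>
     (\<forall>z\<in>ball z0 \<epsilon>. ((\<lambda>(m,n). a m n * complex_of_real (Re z - Re z0) ^ m
                                     * complex_of_real (Im z - Im z0) ^ n) has_sum g z) UNIV))"

definition at_inf_chart :: "(complex option \<Rightarrow> complex) \<Rightarrow> complex \<Rightarrow> complex" where
  "at_inf_chart G w = (if w = 0 then G None else G (Some (1 / w)))"

definition p1_real_analytic_on :: "(complex option \<Rightarrow> complex) \<Rightarrow> complex option set \<Rightarrow> bool" where
  "p1_real_analytic_on G U \<longleftrightarrow>
     (\<forall>z. Some z \<in> U \<longrightarrow> real_analytic_at (\<lambda>w. G (Some w)) z) \<and>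
     (None \<in> U \<longrightarrow> real_analytic_at (at_inf_chart G) 0)"

definition p1_holomorphic_on :: "(complex option \<Rightarrow> complex) \<Rightarrow> complex option set \<Rightarrow> bool" where
  "p1_holomorphic_on g U \<longleftrightarrow>
     (\<lambda>w. g (Some w)) holomorphic_on {z. Some z \<in> U} \<and>
     (None \<in> U \<longrightarrow> at_inf_chart g analytic_on {0})"

definition dx :: "(complex \<Rightarrow> complex) \<Rightarrow> complex \<Rightarrow> complex" where
  "dx F z = vector_derivative (\<lambda>t::real. F (z + complex_of_real t)) (at 0)"

definition dy :: "(complex \<Rightarrow> complex) \<Rightarrow> complex \<Rightarrow> complex" where
  "dy F z = vector_derivative (\<lambda>t::real. F (z + \<i> * complex_of_real t)) (at 0)"

definition d_z :: "(complex \<Rightarrow> complex) \<Rightarrow> complex \<Rightarrow> complex" where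
  "d_z F z = (dx F z - \<i> * dy F z) / 2"

definition d_zbar :: "(complex \<Rightarrow> complex) \<Rightarrow> complex \<Rightarrow> complex" where
  "d_zbar F z = (dx F z + \<i> * dy F z) / 2"

definition partials_cont :: "complex set \<Rightarrow> (complex \<Rightarrow> complex) \<Rightarrow> bool" where
  "partials_cont V G \<longleftrightarrow> continuous_on V G \<and>
     (\<forall>z\<in>V. (\<lambda>t::real. G (z + complex_of_real t)) differentiable (at 0) \<and>
            (\<lambda>t::real. G (z + \<i> * complex_of_real t)) differentiable (at 0))"

definition C2_on :: "complex set \<Rightarrow> (complex \<Rightarrow> complex) \<Rightarrow> bool" where
  "C2_on V F \<longleftrightarrow> open V \<and> partials_cont V F \<and> partials_cont V (dx F) \<and> partials_cont V (dy F) \<and>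
     continuous_on V (dx (dx F)) \<and> continuous_on V (dy (dx F)) \<and>
     continuous_on V (dx (dy F)) \<and> continuous_on V (dy (dy F))"

definition r_harmonic_on :: "complex \<Rightarrow> complex set \<Rightarrow> (complex \<Rightarrow> complex) \<Rightarrow> bool" where
  "r_harmonic_on r V F \<longleftrightarrow> C2_on V F \<and>
     (\<forall>z\<in>V. - 4 * complex_of_real (Im z) ^ 2 * d_z (d_zbar F) z
              + 2 * \<i> * r * complex_of_real (Im z) * d_zbar F z = 0)"

text \<open>f_r, with the principal branch of the power (the base lies in Re > 0 on H)\<close>
definition f_r :: "complex \<Rightarrow> complex \<Rightarrow> complex" where
  "f_r r z = 2 * \<i> / (z - \<i>) * ((cnj z - \<i>) / (cnj z - z)) powr (r - 1)"

definition rho_cont :: "complex \<Rightarrow> complex option set \<Rightarrow> (complex \<Rightarrow> complex)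
                        \<Rightarrow> (complex option \<Rightarrow> complex) \<Rightarrow> bool" where
  "rho_cont r U F G \<longleftrightarrow> p1_real_analytic_on G U \<and>
     (\<forall>z\<in>upper_part U. z \<noteq> \<i> \<longrightarrow> G (Some z) = F z / f_r r z)"

definition Hb :: "complex \<Rightarrow> complex option set \<Rightarrow> (complex \<Rightarrow> complex) \<Rightarrow> bool" where
  "Hb r U F \<longleftrightarrow> p1_open U \<and> r_harmonic_on r (upper_part U) F \<and> (\<exists>G. rho_cont r U F G)"

definition Hhol :: "complex \<Rightarrow> complex option set \<Rightarrow> (complex \<Rightarrow> complex) \<Rightarrow> bool" where
  "Hhol r U F \<longleftrightarrow> Hb r U F \<and> F holomorphic_on upper_part U \<and>
     (\<exists>g. p1_holomorphic_on g U \<and> (\<forall>z\<in>upper_part U. g (Some z) = F z))"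

definition germ_eq :: "complex option set \<Rightarrow> complex option set \<Rightarrow> (complex \<Rightarrow> complex)
                       \<Rightarrow> complex option set \<Rightarrow> (complex \<Rightarrow> complex) \<Rightarrow> bool" where
  "germ_eq I U1 F1 U2 F2 \<longleftrightarrow> (\<exists>U. p1_open U \<and> I \<subseteq> U \<and> U \<subseteq> U1 \<inter> U2 \<and>
     (\<forall>z\<in>upper_part U. F1 z = F2 z))"

text \<open>V^omega(I): real-analytic functions on I, i.e. restrictions to I of functions
  holomorphic on some neighbourhood of I in P^1(C)\<close>
definition Vomega :: "complex option set \<Rightarrow> (complex option \<Rightarrow> complex) \<Rightarrow> bool" where
  "Vomega I \<phi> \<longleftrightarrow> (\<exists>U g. p1_open U \<and> I \<subseteq> U \<and> p1_holomorphic_on g U \<and> (\<forall>t\<in>I. g t = \<phi> t))"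

end

(*
  Pass to the disc coordinate u(z) = (z - i) / (z + i), which maps P^1(R) to the unit circle, so
  that infinity is no longer special. Near a boundary point, a real-analytic function of z is
  K(u(z), u(cnj z)) for a holomorphic function K(u, p) of two variables. For F = f_r * K the
  harmonicity of F says that

      (1 - p/u) K_p + (r - 1)/p K

  is killed by d/du, first on p = 1 / cnj u, hence everywhere; evaluating at u = p it equals
  (r - 1)/p * K(p, p). For fixed u this is an ordinary differential equation in p with a regular
  singular point at p = u. With T = (p/u)^(r-1) K and the boundary value phi(p) = K(p, p) it reads

      (u - p) T_p + (r - 1) T = (r - 1) (p/u)^(r-2) phi(p),

  so the Taylor coefficients at p = u satisfy (r - 1 - k) T_k = (r - 1) R_k, where R is
  (p/u)^(r-2) phi. If r is not an integer >= 2, phi determines K, and any phi occurs by summing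
  the series. If r = n is an integer >= 2, the coefficient k = n - 1 forces the (n-1)-st derivative
  of p^(n-2) phi(p) to vanish, so this is a polynomial; and for phi = 0 the solution is
  T = c(u) (p - u)^(n-1), which makes F a holomorphic function of u alone.
*)
theory Submission
  imports Defs "HOL-Complex_Analysis.Complex_Analysis"
begin

section \<open>Separately holomorphic functions of two variables\<close>

text \<open>The equation of harmonicity is given for Im z > 0 and degenerates on the real line,
  which is where the boundary value lives. With cnj z replaced by an independent variable, the
  boundary becomes part of the diagonal u = p, an interior set of a bidisc that the identity theorem
  can reach. The bidiscs are centred on the unit circle and have radius at most 1: then u and p lie
  in one half-plane bounded by a line through 0, and the principal branch of the powers of p/u is
  holomorphic. The factor (p/u)^(r-1) replaces the coefficient (r - 1) u/p of the equation by the
  constant r - 1, so that differentiation yields one unknown coefficient at a time. The series for T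
  does not mention the centre of the bidisc, so solutions built at different boundary points agree
  automatically. Only functions of one variable, the boundary value and the holomorphic extension of
  F, have to be glued; for that the balls are halved, since of two half-balls that meet, the larger
  full ball contains the centre of the other.\<close>

text \<open>By Osgood's lemma, \<open>hol2_has_derivative\<close>, this amounts to joint complex differentiability.\<close>

definition hol2 :: "(complex \<Rightarrow> complex \<Rightarrow> complex) \<Rightarrow> (complex \<times> complex) set \<Rightarrow> bool" where
  "hol2 f S \<longleftrightarrow> open S \<and> continuous_on S (\<lambda>p. f (fst p) (snd p)) \<and>
     (\<forall>x y. (x, y) \<in> S \<longrightarrow> (\<lambda>x. f x y) field_differentiable at x \<and> f x field_differentiable at y)"

lemma hol2_open: "hol2 f S \<Longrightarrow> open S"
  and hol2_continuous_on: "hol2 f S \<Longrightarrow> continuous_on S (\<lambda>p. f (fst p) (snd p))"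
  and hol2_fd1: "hol2 f S \<Longrightarrow> (x, y) \<in> S \<Longrightarrow> (\<lambda>x. f x y) field_differentiable at x"
  and hol2_fd2: "hol2 f S \<Longrightarrow> (x, y) \<in> S \<Longrightarrow> f x field_differentiable at y"
  by (auto simp: hol2_def)

lemma hol2_slice1: "hol2 f S \<Longrightarrow> (\<And>x. x \<in> A \<Longrightarrow> (x, y) \<in> S) \<Longrightarrow> (\<lambda>x. f x y) holomorphic_on A"
  and hol2_slice2: "hol2 f S \<Longrightarrow> (\<And>y. y \<in> B \<Longrightarrow> (x, y) \<in> S) \<Longrightarrow> f x holomorphic_on B"
  by (auto simp: holomorphic_on_def intro: field_differentiable_at_within hol2_fd1 hol2_fd2)

lemma hol2_subset: "hol2 f S \<Longrightarrow> open T \<Longrightarrow> T \<subseteq> S \<Longrightarrow> hol2 f T"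
  unfolding hol2_def using continuous_on_subset by blast

lemma hol2_local:
  assumes "\<And>x y. (x, y) \<in> S \<Longrightarrow> \<exists>T. (x, y) \<in> T \<and> hol2 f T" "open S"
  shows "hol2 f S"
  unfolding hol2_def
proof (intro conjI allI impI)
  have "continuous (at p) (\<lambda>p. f (fst p) (snd p))" if "p \<in> S" for p
    using assms(1)[of "fst p" "snd p"] that unfolding hol2_def
    by (auto simp: continuous_on_eq_continuous_at)
  then show "continuous_on S (\<lambda>p. f (fst p) (snd p))"
    using assms(2) by (simp add: continuous_on_eq_continuous_at)
qed (use assms hol2_fd1 hol2_fd2 in blast)+

lemma hol2_swap:
  assumes "hol2 f S"
  shows "hol2 (\<lambda>x y. f y x) (prod.swap -` S)"
proof -
  have "continuous_on (prod.swap -` S) (\<lambda>p. f (fst (prod.swap p)) (snd (prod.swap p)))"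
    by (rule continuous_on_compose2[OF hol2_continuous_on[OF assms]])
      (auto intro: continuous_on_swap)
  moreover have "open (prod.swap -` S)"
    by (rule open_vimage[OF hol2_open[OF assms]]) (auto intro: continuous_on_swap)
  ultimately show ?thesis
    unfolding hol2_def using hol2_fd1[OF assms] hol2_fd2[OF assms] by simp
qed

section \<open>Joint differentiability and partial derivatives\<close>

lemma open_contains_cball_prod:
  fixes x :: "'a::metric_space" and y :: "'b::metric_space"
  assumes "open S" "(x, y) \<in> S"
  obtains e where "e > 0" "cball x e \<times> cball y e \<subseteq> S"
proof -
  obtain A B where AB: "open A" "open B" "(x, y) \<in> A \<times> B" "A \<times> B \<subseteq> S"
    using assms by (elim open_prod_elim) auto
  obtain a where a: "a > 0" "cball x a \<subseteq> A" using AB open_contains_cball by (metis SigmaD1)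
  obtain b where b: "b > 0" "cball y b \<subseteq> B" using AB open_contains_cball by (metis SigmaD2)
  have "cball x (min a b) \<times> cball y (min a b) \<subseteq> S"
    using a b AB(4) by (auto simp: subset_iff)
  then show ?thesis using that a b by (metis min_less_iff_conj)
qed

text \<open>For fixed \<open>x0\<close> the derivative is continuous in \<open>y\<close>. The change
  from \<open>x0\<close> to \<open>x\<close> is controlled by a Cauchy estimate for
  \<open>f x - f x0\<close>, which is uniformly small because \<open>f\<close> is uniformly
  continuous on a compact product.\<close>

lemma hol2_continuous_deriv2:
  assumes "hol2 f S"
  shows "continuous_on S (\<lambda>p. deriv (f (fst p)) (snd p))"
proof -
  have "continuous (at (x0, y0)) (\<lambda>p. deriv (f (fst p)) (snd p))" if xy: "(x0, y0) \<in> S" for x0 y0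
    unfolding continuous_at_eps_delta
  proof (intro allI impI)
    fix \<epsilon> :: real assume "\<epsilon> > 0"
    obtain e where e: "e > 0" "cball x0 e \<times> cball y0 e \<subseteq> S"
      using open_contains_cball_prod hol2_open[OF assms] xy by metis
    have "uniformly_continuous_on (cball x0 e \<times> cball y0 e) (\<lambda>p. f (fst p) (snd p))"
      by (intro compact_uniformly_continuous compact_Times compact_cball
          continuous_on_subset[OF hol2_continuous_on[OF assms] e(2)])
    \<comment> \<open>The tolerance \<open>\<epsilon> * e / 4\<close>, divided by the radius
      \<open>e / 2\<close> of the Cauchy estimate, leaves \<open>\<epsilon> / 2\<close>.\<close>
    then obtain d where d: "d > 0" "\<And>p q. p \<in> cball x0 e \<times> cball y0 e \<Longrightarrow> q \<in> cball x0 e \<times> cball y0 e \<Longrightarrow>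
        dist q p < d \<Longrightarrow> dist (f (fst q) (snd q)) (f (fst p) (snd p)) < \<epsilon> * e / 4"
      unfolding uniformly_continuous_on_def using \<open>\<epsilon> > 0\<close> e(1)
      by (metis divide_pos_pos mult_pos_pos zero_less_numeral)
    have hol0: "f x holomorphic_on ball y0 e" if "x \<in> cball x0 e" for x
      by (rule hol2_slice2[OF assms]) (use that e in auto)
    have "continuous_on (ball y0 e) (deriv (f x0))"
      using hol0[of x0] e(1) by (intro holomorphic_on_imp_continuous_on holomorphic_deriv) auto
    then have "continuous (at y0) (deriv (f x0))"
      using e(1) by (simp add: continuous_on_eq_continuous_at)
    then obtain d2 where d2: "d2 > 0" "\<And>y. dist y y0 < d2 \<Longrightarrow> dist (deriv (f x0) y) (deriv (f x0) y0) < \<epsilon> / 2"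
      unfolding continuous_at_eps_delta using \<open>\<epsilon> > 0\<close> by (metis half_gt_zero)
    show "\<exists>\<delta>>0. \<forall>p. dist p (x0, y0) < \<delta> \<longrightarrow>
      dist (deriv (f (fst p)) (snd p)) (deriv (f (fst (x0, y0))) (snd (x0, y0))) < \<epsilon>"
    proof (intro exI[of _ "Min {d, d2, e/2}"] conjI allI impI)
      show "0 < Min {d, d2, e/2}" using d d2 e by auto
      fix p assume p: "dist p (x0, y0) < Min {d, d2, e/2}"
      obtain x y where [simp]: "p = (x, y)" by (cases p)
      have dx: "dist x x0 < Min {d, d2, e/2}"
        using dist_fst_le[of p "(x0,y0)"] p by simp
      have dy: "dist y y0 < Min {d, d2, e/2}"
        using dist_snd_le[of p "(x0,y0)"] p by simp
      have xin: "x \<in> cball x0 e" "x0 \<in> cball x0 e" using dx e by (auto simp: dist_commute)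
      have yin: "cball y (e/2) \<subseteq> ball y0 e"
      proof
        fix z assume "z \<in> cball y (e/2)"
        then show "z \<in> ball y0 e" using dy dist_triangle[of y0 z y] by (auto simp: dist_commute)
      qed
      have y: "y \<in> ball y0 e" using dy e(1) by (auto simp: dist_commute)
      let ?g = "\<lambda>z. f x z - f x0 z"
      have holg: "?g holomorphic_on ball y0 e"
        by (intro holomorphic_intros hol0 xin)
      have "norm ((deriv ^^ 1) ?g y) \<le> fact 1 * (\<epsilon> * e / 4) / (e/2) ^ 1"
      proof (rule Cauchy_inequality)
        show "?g holomorphic_on ball y (e/2)"
          using holg yin ball_subset_cball holomorphic_on_subset by blast
        show "continuous_on (cball y (e/2)) ?g"
          using holg yin holomorphic_on_imp_continuous_on holomorphic_on_subset by blast
        show "0 < e/2" using e by simp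
        fix z assume "norm (y - z) = e/2"
        then have z: "z \<in> ball y0 e" using yin by (auto simp: dist_norm)
        have "dist (x, z) (x0, z) < d" using dx by (simp add: dist_Pair_Pair)
        then have "dist (f x z) (f x0 z) < \<epsilon> * e / 4"
          using d(2)[of "(x0,z)" "(x,z)"] xin z by auto
        then show "norm (?g z) \<le> \<epsilon> * e / 4" by (simp add: dist_norm)
      qed
      also have "deriv ^^ 1 = deriv" by simp
      finally have "norm (deriv ?g y) \<le> \<epsilon> / 2" using e(1) by (simp add: field_simps)
      moreover have "deriv ?g y = deriv (f x) y - deriv (f x0) y"
        by (rule deriv_diff) (use hol0 xin y holomorphic_on_imp_differentiable_at open_ball in blast)+
      moreover have "dist (deriv (f x0) y) (deriv (f x0) y0) < \<epsilon> / 2"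
        using d2 dy by simp
      ultimately show "dist (deriv (f (fst p)) (snd p)) (deriv (f (fst (x0, y0))) (snd (x0, y0))) < \<epsilon>"
        using dist_triangle[of "deriv (f x) y" "deriv (f x0) y0" "deriv (f x0) y"]
        by (simp add: dist_norm)
    qed
  qed
  then show ?thesis
    using hol2_open[OF assms] by (auto simp: continuous_on_eq_continuous_at)
qed

text \<open>The difference quotients in \<open>y\<close> converge uniformly in \<open>x\<close>,
  since the derivative is jointly continuous and hence uniformly continuous on compact products. A
  uniform limit of functions holomorphic in \<open>x\<close> is holomorphic in
  \<open>x\<close>.\<close>

lemma hol2_deriv2:
  assumes "hol2 f S"
  shows "hol2 (\<lambda>x y. deriv (f x) y) S"
  unfolding hol2_def
proof (intro conjI allI impI)
  show "open S" using assms by (rule hol2_open)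
  show "continuous_on S (\<lambda>p. deriv (f (fst p)) (snd p))" using assms by (rule hol2_continuous_deriv2)
next
  fix x0 y0 assume "(x0, y0) \<in> S"
  then obtain e where e: "e > 0" "cball x0 e \<times> cball y0 e \<subseteq> S"
    using open_contains_cball_prod hol2_open[OF assms] by metis
  have hol2: "f x holomorphic_on ball y0 e" if "x \<in> cball x0 e" for x
    by (rule hol2_slice2[OF assms]) (use that e in auto)
  have fd: "f x field_differentiable at y" if "x \<in> cball x0 e" "y \<in> ball y0 e" for x y
    using that e hol2_fd2[OF assms] by (auto simp: subset_iff)
  have "deriv (f x0) holomorphic_on ball y0 e"
    using hol2[of x0] e(1) by (intro holomorphic_deriv) auto
  then show "deriv (f x0) field_differentiable at y0"
    using e(1) holomorphic_on_imp_differentiable_at by (metis centre_in_ball open_ball)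
  let ?q = "\<lambda>h x. (f x (y0 + h) - f x y0) / h"
  have ul: "uniform_limit (cball x0 e) ?q (\<lambda>x. deriv (f x) y0) (at (0::complex))"
  proof (rule uniform_limitI)
    fix \<epsilon> :: real assume "\<epsilon> > 0"
    have "uniformly_continuous_on (cball x0 e \<times> cball y0 e) (\<lambda>p. deriv (f (fst p)) (snd p))"
      by (intro compact_uniformly_continuous compact_Times compact_cball
          continuous_on_subset[OF hol2_continuous_deriv2[OF assms] e(2)])
    then obtain d where d: "d > 0" "\<And>p q. p \<in> cball x0 e \<times> cball y0 e \<Longrightarrow> q \<in> cball x0 e \<times> cball y0 e \<Longrightarrow>
        dist q p < d \<Longrightarrow> dist (deriv (f (fst q)) (snd q)) (deriv (f (fst p)) (snd p)) < \<epsilon> / 2"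
      unfolding uniformly_continuous_on_def using \<open>\<epsilon> > 0\<close> by (metis half_gt_zero)
    show "\<forall>\<^sub>F h in at (0::complex). \<forall>x\<in>cball x0 e. dist (?q h x) (deriv (f x) y0) < \<epsilon>"
      unfolding eventually_at
    proof (intro exI[of _ "min d e"] conjI ballI impI)
      show "0 < min d e" using d e by auto
      fix h x :: complex assume h: "h \<noteq> 0 \<and> dist h 0 < min d e" and x: "x \<in> cball x0 e"
      \<comment> \<open>Subtracting the linear part makes the derivative small near
        \<open>y0\<close>, so the mean value inequality bounds the error of the difference
        quotient.\<close>
      let ?k = "\<lambda>y::complex. f x y - deriv (f x) y0 * y"
      have "norm (?k (y0 + h) - ?k y0) \<le> (\<epsilon>/2) * norm ((y0 + h) - y0)"
      proof (rule field_differentiable_bound[of "ball y0 (min d e)" ?k "\<lambda>y. deriv (f x) y - deriv (f x) y0"])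
        fix y assume y: "y \<in> ball y0 (min d e)"
        have "(f x has_field_derivative deriv (f x) y) (at y)"
          by (rule field_differentiable_derivI[OF fd[OF x]]) (use y in auto)
        from DERIV_diff[OF this DERIV_cmult[OF DERIV_ident, of "deriv (f x) y0"]]
        show "(?k has_field_derivative deriv (f x) y - deriv (f x) y0) (at y within ball y0 (min d e))"
          by (simp add: has_field_derivative_at_within)
        have "dist (x, y) (x, y0) = dist y0 y" by (simp add: dist_Pair_Pair dist_commute)
        moreover have "(x, y0) \<in> cball x0 e \<times> cball y0 e" "(x, y) \<in> cball x0 e \<times> cball y0 e"
          using x y e(1) by auto
        ultimately have "dist (deriv (f x) y) (deriv (f x) y0) < \<epsilon> / 2"
          using d(2)[of "(x,y0)" "(x,y)"] y by simp
        then show "norm (deriv (f x) y - deriv (f x) y0) \<le> \<epsilon>/2" by (simp add: dist_norm)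
      qed (use h d e in \<open>auto simp: dist_norm\<close>)
      moreover have "?q h x - deriv (f x) y0 = (?k (y0 + h) - ?k y0) / h"
        using h by (simp add: divide_simps) (simp add: algebra_simps)
      ultimately have "norm (?q h x - deriv (f x) y0) \<le> \<epsilon> / 2"
        using h by (simp only: norm_divide) (simp add: divide_le_eq)
      then show "dist (?q h x) (deriv (f x) y0) < \<epsilon>" using \<open>\<epsilon> > 0\<close> by (simp add: dist_norm)
    qed
  qed
  have "\<forall>\<^sub>F h in at (0::complex). continuous_on (cball x0 e) (?q h) \<and> ?q h holomorphic_on ball x0 e"
    unfolding eventually_at
  proof (intro exI[of _ e] conjI ballI impI)
    fix h :: complex assume h: "h \<noteq> 0 \<and> dist h 0 < e"
    have *: "(\<lambda>x. f x y) holomorphic_on cball x0 e" if "y \<in> cball y0 e" for y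
      by (rule hol2_slice1[OF assms]) (use that e in auto)
    have "?q h holomorphic_on cball x0 e"
      by (intro holomorphic_intros *) (use h e in \<open>auto simp: dist_norm\<close>)
    then show "continuous_on (cball x0 e) (?q h)" "?q h holomorphic_on ball x0 e"
      using holomorphic_on_imp_continuous_on holomorphic_on_subset ball_subset_cball by blast+
  qed (use e in auto)
  from holomorphic_uniform_limit[OF this ul] have "(\<lambda>x. deriv (f x) y0) holomorphic_on ball x0 e" by auto
  then show "(\<lambda>x. deriv (f x) y0) field_differentiable at x0"
    using e(1) holomorphic_on_imp_differentiable_at by (metis centre_in_ball open_ball)
qed

lemma hol2_deriv1:
  assumes "hol2 f S"
  shows "hol2 (\<lambda>x y. deriv (\<lambda>x. f x y) x) S"
proof -
  have "prod.swap -` prod.swap -` S = S" by auto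
  then show ?thesis using hol2_swap[OF hol2_deriv2[OF hol2_swap[OF assms]]] by simp
qed

text \<open>Both partial derivatives exist and the one in \<open>y\<close> is jointly continuous,
  which gives total differentiability. The chain rules below rest on this.\<close>

lemma hol2_has_derivative:
  assumes "hol2 f S" "(x, y) \<in> S"
  shows "((\<lambda>p. f (fst p) (snd p)) has_derivative
     (\<lambda>p. deriv (\<lambda>x. f x y) x * fst p + deriv (f x) y * snd p)) (at (x, y))"
proof -
  obtain e where e: "e > 0" "cball x e \<times> cball y e \<subseteq> S"
    using open_contains_cball_prod hol2_open[OF assms(1)] assms(2) by metis
  let ?A = "ball x e" and ?B = "ball y e"
  let ?fy = "\<lambda>x y. blinfun_mult_right (deriv (f x) y)"
  have "((\<lambda>(x, y). f x y) has_derivative (\<lambda>(tx, ty). deriv (\<lambda>x. f x y) x * tx + ?fy x y ty)) (at (x, y) within ?A \<times> ?B)"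
  proof (rule has_derivative_partialsI)
    show "((\<lambda>x. f x y) has_derivative (*) (deriv (\<lambda>x. f x y) x)) (at x within ball x e)"
      using hol2_fd1[OF assms] by (simp add: field_differentiable_derivI has_derivative_at_withinI
          has_field_derivative_imp_has_derivative)
    fix x' y' assume "x' \<in> ball x e" "y' \<in> ball y e"
    then have "f x' field_differentiable at y'" using e hol2_fd2[OF assms(1)] by (auto simp: subset_iff)
    then show "(f x' has_derivative ?fy x' y') (at y' within ball y e)"
      by (simp add: field_differentiable_derivI has_derivative_at_withinI
          has_field_derivative_imp_has_derivative)
  next
    have "continuous_on S (\<lambda>p. ?fy (fst p) (snd p))"
      by (intro bounded_linear.continuous_on[OF bounded_linear_blinfun_mult_right]
          hol2_continuous_deriv2 assms)
    then have "continuous (at (x, y)) (\<lambda>p. ?fy (fst p) (snd p))"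
      using assms(2) hol2_open[OF assms(1)] continuous_on_eq_continuous_at by blast
    then show "continuous (at (x, y) within ball x e \<times> ball y e) (\<lambda>(x, y). ?fy x y)"
      unfolding case_prod_beta by (rule continuous_at_imp_continuous_at_within)
  qed (use e in auto)
  moreover have "at (x, y) within ?A \<times> ?B = at (x, y)"
    using e by (intro at_within_open open_Times) auto
  ultimately show ?thesis by (simp add: case_prod_unfold)
qed

lemma hol2_chain:
  assumes "hol2 f S" "(a t, b t) \<in> S"
    and "(a has_field_derivative a') (at t)" "(b has_field_derivative b') (at t)"
  shows "((\<lambda>t. f (a t) (b t)) has_field_derivative
     (deriv (\<lambda>x. f x (b t)) (a t) * a' + deriv (f (a t)) (b t) * b')) (at t)"
proof -
  have "((\<lambda>t. (a t, b t)) has_derivative (\<lambda>h. (a' * h, b' * h))) (at t)"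
    using assms by (intro has_derivative_Pair) (auto dest: has_field_derivative_imp_has_derivative)
  from has_derivative_compose[OF this hol2_has_derivative[OF assms(1,2)], unfolded fst_conv snd_conv]
  show ?thesis
    unfolding has_field_derivative_def
    by (rule has_derivative_eq_rhs) (auto simp: algebra_simps)
qed

text \<open>The real parameter matches \<open>dx\<close> and \<open>dy\<close>, which differentiate
  along real lines, while the two arguments may move in different complex directions, as
  \<open>z\<close> and its conjugate do.\<close>

lemma hol2_chain_real:
  assumes "hol2 f S" "(a t, b t) \<in> S"
    and "(a has_vector_derivative a') (at t)" "(b has_vector_derivative b') (at t)"
  shows "((\<lambda>t. f (a t) (b t)) has_vector_derivative
     (deriv (\<lambda>x. f x (b t)) (a t) * a' + deriv (f (a t)) (b t) * b')) (at t)"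
proof -
  have "((\<lambda>t. (a t, b t)) has_derivative (\<lambda>h. (h *\<^sub>R a', h *\<^sub>R b'))) (at t)"
    using assms by (intro has_derivative_Pair) (auto simp: has_vector_derivative_def)
  from has_derivative_compose[OF this hol2_has_derivative[OF assms(1,2)], unfolded fst_conv snd_conv]
  show ?thesis
    unfolding has_vector_derivative_def
    by (rule has_derivative_eq_rhs) (auto simp: algebra_simps scaleR_conv_of_real)
qed

section \<open>Closure properties\<close>

lemma hol2_compose:
  assumes "hol2 f S" "hol2 a T" "hol2 b T" "\<And>x y. (x, y) \<in> T \<Longrightarrow> (a x y, b x y) \<in> S"
  shows "hol2 (\<lambda>x y. f (a x y) (b x y)) T"
  unfolding hol2_def
proof (intro conjI allI impI)
  show "open T" using assms hol2_open by auto
  show "continuous_on T (\<lambda>p. f (a (fst p) (snd p)) (b (fst p) (snd p)))"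
  proof -
    have "continuous_on T (\<lambda>p. (a (fst p) (snd p), b (fst p) (snd p)))"
      by (intro continuous_on_Pair hol2_continuous_on assms)
    moreover have "(\<lambda>p. (a (fst p) (snd p), b (fst p) (snd p))) ` T \<subseteq> S"
      using assms(4) by auto
    ultimately show ?thesis
      using continuous_on_compose2[OF hol2_continuous_on[OF assms(1)]] by fastforce
  qed
  fix x y assume xy: "(x, y) \<in> T"
  show "(\<lambda>x. f (a x y) (b x y)) field_differentiable at x"
    using hol2_chain[OF assms(1), of "\<lambda>x. a x y" x "\<lambda>x. b x y", OF assms(4)[OF xy]
        hol2_fd1[OF assms(2) xy, THEN field_differentiable_derivI] hol2_fd1[OF assms(3) xy, THEN field_differentiable_derivI]]
    unfolding field_differentiable_def by blast
  show "(\<lambda>y. f (a x y) (b x y)) field_differentiable at y"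
    using hol2_chain[OF assms(1), of "a x" y "b x", OF assms(4)[OF xy]
        hol2_fd2[OF assms(2) xy, THEN field_differentiable_derivI] hol2_fd2[OF assms(3) xy, THEN field_differentiable_derivI]]
    unfolding field_differentiable_def by blast
qed

lemma hol2_const: "open S \<Longrightarrow> hol2 (\<lambda>x y. c) S"
  by (auto simp: hol2_def)

lemma hol2_of_fst:
  assumes "open S" "\<And>x y. (x, y) \<in> S \<Longrightarrow> g field_differentiable at x"
  shows "hol2 (\<lambda>x y. g x) S"
proof -
  have "g holomorphic_on fst ` S"
    using assms(2) by (auto simp: holomorphic_on_def intro: field_differentiable_at_within)
  then have "continuous_on S (\<lambda>p. g (fst p))"
    by (intro continuous_on_compose2[OF holomorphic_on_imp_continuous_on[of g "fst ` S"]] continuous_intros) auto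
  then show ?thesis using assms by (auto simp: hol2_def)
qed

lemma hol2_of_snd:
  assumes "open S" "\<And>x y. (x, y) \<in> S \<Longrightarrow> g field_differentiable at y"
  shows "hol2 (\<lambda>x y. g y) S"
proof -
  have "g holomorphic_on snd ` S"
    using assms(2) by (auto simp: holomorphic_on_def intro: field_differentiable_at_within)
  then have "continuous_on S (\<lambda>p. g (snd p))"
    by (intro continuous_on_compose2[OF holomorphic_on_imp_continuous_on[of g "snd ` S"]] continuous_intros) auto
  then show ?thesis using assms by (auto simp: hol2_def)
qed

lemma hol2_fst: "open S \<Longrightarrow> hol2 (\<lambda>x y. x) S"
  and hol2_snd: "open S \<Longrightarrow> hol2 (\<lambda>x y. y) S"
  by (auto intro: hol2_of_fst hol2_of_snd)

lemma hol2_add: "hol2 f S \<Longrightarrow> hol2 g S \<Longrightarrow> hol2 (\<lambda>x y. f x y + g x y) S"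
  and hol2_diff: "hol2 f S \<Longrightarrow> hol2 g S \<Longrightarrow> hol2 (\<lambda>x y. f x y - g x y) S"
  and hol2_mult: "hol2 f S \<Longrightarrow> hol2 g S \<Longrightarrow> hol2 (\<lambda>x y. f x y * g x y) S"
  and hol2_divide: "hol2 f S \<Longrightarrow> hol2 g S \<Longrightarrow> (\<And>x y. (x, y) \<in> S \<Longrightarrow> g x y \<noteq> 0) \<Longrightarrow>
    hol2 (\<lambda>x y. f x y / g x y) S"
  and hol2_power: "hol2 f S \<Longrightarrow> hol2 (\<lambda>x y. f x y ^ n) S"
  unfolding hol2_def
  by (auto intro!: continuous_intros field_differentiable_add field_differentiable_diff
      field_differentiable_mult field_differentiable_divide field_differentiable_power)

lemma hol2_powr:
  assumes "hol2 f S" "\<And>x y. (x, y) \<in> S \<Longrightarrow> f x y \<notin> \<real>\<^sub>\<le>\<^sub>0"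
  shows "hol2 (\<lambda>x y. f x y powr s) S"
proof (rule hol2_compose[of "\<lambda>x y. x powr s", OF _ assms(1) assms(1)])
  show "hol2 (\<lambda>x y. x powr s) ((- \<real>\<^sub>\<le>\<^sub>0) \<times> UNIV)"
    unfolding field_differentiable_def
    by (rule hol2_of_fst)
      (use has_field_derivative_powr in \<open>auto simp: field_differentiable_def intro!: open_Times open_Compl\<close>)
qed (use assms in auto)

lemma hol2_sum: "open S \<Longrightarrow> (\<And>i. i \<in> I \<Longrightarrow> hol2 (f i) S) \<Longrightarrow> hol2 (\<lambda>x y. \<Sum>i\<in>I. f i x y) S"
  by (induction I rule: infinite_finite_induct) (auto intro: hol2_const hol2_add)

text \<open>Weierstrass' theorem is applied on each slice. The filter is general because the lemma
  serves both unordered sums over finite index sets and sequences of partial sums.\<close>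

lemma hol2_uniform_limit:
  assumes "open S" "\<forall>\<^sub>F n in F. hol2 (f n) S" "F \<noteq> bot"
    and ul: "uniform_limit S (\<lambda>n p. f n (fst p) (snd p)) (\<lambda>p. g (fst p) (snd p)) F"
  shows "hol2 g S"
  unfolding hol2_def
proof (intro conjI allI impI)
  show "open S" by fact
  show "continuous_on S (\<lambda>p. g (fst p) (snd p))"
    by (rule uniform_limit_theorem[OF _ ul assms(3)])
      (use assms(2) in \<open>auto elim!: eventually_mono dest: hol2_continuous_on\<close>)
  fix x y assume xy: "(x, y) \<in> S"
  obtain e where e: "e > 0" "cball x e \<times> cball y e \<subseteq> S"
    using open_contains_cball_prod \<open>open S\<close> xy by metis
  have ul2: "uniform_limit A (\<lambda>n z. f n (a z) (b z)) (\<lambda>z. g (a z) (b z)) F"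
    if "\<And>z. z \<in> A \<Longrightarrow> (a z, b z) \<in> S" for a b and A :: "complex set"
    unfolding uniform_limit_iff
  proof (intro allI impI)
    fix e :: real assume "e > 0"
    then have "\<forall>\<^sub>F n in F. \<forall>p\<in>S. dist (f n (fst p) (snd p)) (g (fst p) (snd p)) < e"
      using ul by (simp add: uniform_limit_iff)
    then show "\<forall>\<^sub>F n in F. \<forall>z\<in>A. dist (f n (a z) (b z)) (g (a z) (b z)) < e"
    proof eventually_elim
      case (elim n)
      show ?case using elim[rule_format, OF that] by simp
    qed
  qed
  have "\<forall>\<^sub>F n in F. continuous_on (cball x e) (\<lambda>x. f n x y) \<and> (\<lambda>x. f n x y) holomorphic_on ball x e"
    using assms(2)
  proof eventually_elim
    case (elim n)
    have "(\<lambda>x. f n x y) holomorphic_on cball x e" by (rule hol2_slice1[OF elim]) (use e in auto)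
    then show ?case
      using holomorphic_on_imp_continuous_on holomorphic_on_subset ball_subset_cball by blast
  qed
  from holomorphic_uniform_limit[OF this ul2[of _ "\<lambda>x. x" "\<lambda>_. y"] assms(3)]
  have "(\<lambda>x. g x y) holomorphic_on ball x e" using e by (auto simp: subset_iff)
  then show "(\<lambda>x. g x y) field_differentiable at x"
    using e(1) holomorphic_on_imp_differentiable_at by (metis centre_in_ball open_ball)
  have "\<forall>\<^sub>F n in F. continuous_on (cball y e) (f n x) \<and> (f n x) holomorphic_on ball y e"
    using assms(2)
  proof eventually_elim
    case (elim n)
    have "f n x holomorphic_on cball y e" by (rule hol2_slice2[OF elim]) (use e in auto)
    then show ?case
      using holomorphic_on_imp_continuous_on holomorphic_on_subset ball_subset_cball by blast
  qed
  from holomorphic_uniform_limit[OF this ul2[of _ "\<lambda>_. x" "\<lambda>y. y"] assms(3)]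
  have "g x holomorphic_on ball y e" using e by (auto simp: subset_iff)
  then show "g x field_differentiable at y"
    using e(1) holomorphic_on_imp_differentiable_at by (metis centre_in_ball open_ball)
qed

text \<open>The two Cayley coordinates of a boundary point coincide, so boundary values arise as
  restrictions to the diagonal.\<close>

lemma hol2_diagonal:
  assumes "hol2 f S" "\<And>x. x \<in> A \<Longrightarrow> (x, x) \<in> S"
  shows "(\<lambda>x. f x x) holomorphic_on A"
  unfolding holomorphic_on_def field_differentiable_def
  using hol2_chain[OF assms(1) assms(2) DERIV_ident DERIV_ident] has_field_derivative_at_within by blast

section \<open>Real-analytic functions as restrictions to the antidiagonal\<close>

lemma real_analytic_at_cong:
  assumes "real_analytic_at f z0" "open V" "z0 \<in> V" "\<And>z. z \<in> V \<Longrightarrow> g z = f z"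
  shows "real_analytic_at g z0"
proof -
  obtain d where d: "d > 0" "ball z0 d \<subseteq> V" using assms(2,3) open_contains_ball by blast
  obtain a \<epsilon> where a: "0 < \<epsilon>"
     "\<forall>z\<in>ball z0 \<epsilon>. ((\<lambda>(m,n). a m n * complex_of_real (Re z - Re z0) ^ m
          * complex_of_real (Im z - Im z0) ^ n) has_sum f z) UNIV"
    using assms(1) unfolding real_analytic_at_def by (elim exE conjE) (rule that)
  show ?thesis unfolding real_analytic_at_def
  proof (intro exI[of _ a] exI[of _ "min d \<epsilon>"] conjI ballI)
    fix z assume z: "z \<in> ball z0 (min d \<epsilon>)"
    then have "g z = f z" using d assms(4) by auto
    then show "((\<lambda>(m,n). a m n * complex_of_real (Re z - Re z0) ^ m
          * complex_of_real (Im z - Im z0) ^ n) has_sum g z) UNIV" using a(2) z by simp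
  qed (use a d in auto)
qed

section \<open>Double power series\<close>

lemma geometric_double_summable:
  fixes x :: real
  assumes "0 \<le> x" "x < 1" "0 \<le> M"
  shows "(\<lambda>(m, n). M * x ^ m * x ^ n) summable_on (UNIV :: (nat \<times> nat) set)"
proof -
  have geo: "((\<lambda>n. c * x ^ n) has_sum (c * (1 / (1 - x)))) (UNIV :: nat set)" for c :: real
    by (intro has_sum_cmult_right norm_summable_imp_has_sum)
      (use assms geometric_sums[of x] in \<open>auto intro: summable_geometric simp: norm_power\<close>)
  have "(\<lambda>m. (M * (1 / (1 - x))) * x ^ m) summable_on (UNIV :: nat set)"
    using geo has_sum_imp_summable by blast
  then have "(\<lambda>m. M * x ^ m * (1 / (1 - x))) summable_on (UNIV :: nat set)"
    by (simp add: mult_ac)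
  then have "(\<lambda>(m, n). M * x ^ m * x ^ n) summable_on (SIGMA m:(UNIV::nat set). (UNIV::nat set))"
    by (intro summable_on_SigmaI) (use assms geo in auto)
  then show ?thesis by simp
qed

lemma hol2_higher_deriv2: "hol2 f S \<Longrightarrow> hol2 (\<lambda>x y. (deriv ^^ n) (f x) y) S"
proof (induction n)
  case (Suc n)
  then show ?case using hol2_deriv2[OF Suc.IH] by simp
qed simp

lemma hol2_slice1_cball:
  assumes "hol2 f S" "cball x0 e \<times> cball y0 e \<subseteq> S" "y \<in> cball y0 e"
  shows "(\<lambda>x. f x y) holomorphic_on ball x0 e" "continuous_on (cball x0 e) (\<lambda>x. f x y)"
proof -
  have "(\<lambda>x. f x y) holomorphic_on cball x0 e"
    by (rule hol2_slice1[OF assms(1)]) (use assms in auto)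
  then show "(\<lambda>x. f x y) holomorphic_on ball x0 e" "continuous_on (cball x0 e) (\<lambda>x. f x y)"
    using holomorphic_on_imp_continuous_on holomorphic_on_subset ball_subset_cball by blast+
qed

lemma hol2_slice2_cball:
  assumes "hol2 f S" "cball x0 e \<times> cball y0 e \<subseteq> S" "x \<in> cball x0 e"
  shows "f x holomorphic_on ball y0 e" "continuous_on (cball y0 e) (f x)"
proof -
  have "f x holomorphic_on cball y0 e"
    by (rule hol2_slice2[OF assms(1)]) (use assms in auto)
  then show "f x holomorphic_on ball y0 e" "continuous_on (cball y0 e) (f x)"
    using holomorphic_on_imp_continuous_on holomorphic_on_subset ball_subset_cball by blast+
qed

text \<open>The expansion in \<open>y\<close> has coefficients holomorphic in \<open>x\<close>,
  which are expanded in turn. Two Cauchy estimates bound \<open>a m n\<close> by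
  \<open>M / e ^ n / e ^ m\<close>, so at half the radius a double geometric series dominates and
  the iterated sum is an unordered one.\<close>

lemma hol2_double_power_series:
  assumes f: "hol2 f S" and xy: "(x0, y0) \<in> S"
  obtains a e where "e > 0" "\<And>x y. x \<in> ball x0 e \<Longrightarrow> y \<in> ball y0 e \<Longrightarrow>
    ((\<lambda>(m, n). a m n * (x - x0) ^ m * (y - y0) ^ n) has_sum f x y) UNIV"
proof -
  obtain e where e: "e > 0" "cball x0 e \<times> cball y0 e \<subseteq> S"
    using open_contains_cball_prod hol2_open[OF f] xy by metis
  have "compact ((\<lambda>p. f (fst p) (snd p)) ` (cball x0 e \<times> cball y0 e))"
    by (intro compact_continuous_image compact_Times compact_cball
        continuous_on_subset[OF hol2_continuous_on[OF f] e(2)])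
  from compact_imp_bounded[OF this] obtain M where
    M: "M > 0" "\<And>p. p \<in> cball x0 e \<times> cball y0 e \<Longrightarrow> norm (f (fst p) (snd p)) \<le> M"
    unfolding bounded_pos by blast
  define c where "c n x = (deriv ^^ n) (f x) y0 / fact n" for n x
  have c_bound: "norm (c n x) \<le> M / e ^ n" if x: "x \<in> cball x0 e" for n x
  proof -
    have "norm ((deriv ^^ n) (f x) y0) \<le> fact n * M / e ^ n"
      by (rule Cauchy_inequality)
        (use hol2_slice2_cball[OF f e(2) x] e(1) M(2)[of "(x, _)"] x in \<open>auto simp: dist_norm\<close>)
    then show ?thesis by (simp add: c_def norm_divide field_simps)
  qed
  have c_hol: "c n holomorphic_on ball x0 e" "continuous_on (cball x0 e) (c n)" for n
    unfolding c_def using hol2_slice1_cball[OF hol2_higher_deriv2[OF f] e(2), of y0] e(1)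
    by (auto intro!: holomorphic_intros continuous_intros)
  define a where "a m n = (deriv ^^ m) (c n) x0 / fact m" for m n
  have a_bound: "norm (a m n) \<le> M / e ^ n / e ^ m" for m n
  proof -
    have "norm ((deriv ^^ m) (c n) x0) \<le> fact m * (M / e ^ n) / e ^ m"
      by (rule Cauchy_inequality) (use c_hol e(1) c_bound in \<open>auto simp: dist_norm\<close>)
    then show ?thesis by (simp add: a_def norm_divide field_simps)
  qed
  show thesis
  proof (rule that)
    show "e / 2 > 0" using e by simp
    fix x y assume x: "x \<in> ball x0 (e/2)" and y: "y \<in> ball y0 (e/2)"
    have xe: "x \<in> ball x0 e" "y \<in> ball y0 e" using x y e(1) by auto
    have half: "(norm (x - x0)) ^ m \<le> (1/2) ^ m * e ^ m" "(norm (y - y0)) ^ m \<le> (1/2) ^ m * e ^ m" for m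
      using x y e(1) power_mono[of "norm (x - x0)" "e/2" m] power_mono[of "norm (y - y0)" "e/2" m]
      by (auto simp: dist_norm norm_minus_commute power_divide field_simps)
    have bound: "norm (a m n * (x - x0) ^ m * (y - y0) ^ n) \<le> M * (1/2) ^ n * (1/2) ^ m" for m n
    proof -
      have "norm (a m n * (x - x0) ^ m * (y - y0) ^ n)
        \<le> (M / e ^ n / e ^ m) * ((1/2) ^ m * e ^ m) * ((1/2) ^ n * e ^ n)"
        unfolding norm_mult norm_power
        by (intro mult_mono a_bound half) (use M e in auto)
      then show ?thesis using e(1) by (simp add: mult_ac)
    qed
    \<comment> \<open>The index \<open>n\<close> of the outer sum comes first, so that Fubini sums
      over \<open>m\<close> inside; the order is swapped back at the end.\<close>
    let ?t = "\<lambda>(n, m). a m n * (x - x0) ^ m * (y - y0) ^ n"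
    have summable: "?t summable_on (UNIV \<times> UNIV)"
      using summable_on_comparison_test[OF geometric_double_summable[of "1/2" M], of "\<lambda>p. norm (?t p)"] bound M(1)
      by (simp add: summable_on_iff_abs_summable_on_complex case_prod_unfold)
    have geo: "summable (\<lambda>n. C * (1/2::real) ^ n)" for C
      by (intro summable_mult summable_geometric) auto
    have "(?t has_sum f x y) (UNIV \<times> UNIV)"
    proof (rule has_sum_SigmaI)
      show "?t summable_on UNIV \<times> UNIV" by (rule summable)
      have "(\<lambda>n. c n x * (y - y0) ^ n) sums f x y"
        unfolding c_def
        by (rule holomorphic_power_series[where r = e]) (use hol2_slice2_cball[OF f e(2), of x] xe in auto)
      moreover have "summable (\<lambda>n. norm (c n x * (y - y0) ^ n))"
      proof (rule summable_comparison_test'[OF geo])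
        fix n
        have "norm (c n x) * norm (y - y0) ^ n \<le> (M / e ^ n) * ((1/2) ^ n * e ^ n)"
          by (intro mult_mono c_bound half) (use M e xe in auto)
        then show "norm (norm (c n x * (y - y0) ^ n)) \<le> M * (1/2) ^ n"
          using e(1) by (simp add: norm_mult norm_power)
      qed
      ultimately show "((\<lambda>n. c n x * (y - y0) ^ n) has_sum f x y) UNIV"
        by (intro norm_summable_imp_has_sum)
    next
      fix n :: nat
      have "(\<lambda>m. a m n * (x - x0) ^ m) sums c n x"
        unfolding a_def by (rule holomorphic_power_series[OF c_hol(1) xe(1)])
      then have "(\<lambda>m. a m n * (x - x0) ^ m * (y - y0) ^ n) sums (c n x * (y - y0) ^ n)"
        by (rule sums_mult2)
      moreover have "summable (\<lambda>m. norm (a m n * (x - x0) ^ m * (y - y0) ^ n))"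
        by (rule summable_comparison_test'[OF geo[of "M * (1/2) ^ n"]]) (use bound in auto)
      ultimately show "((\<lambda>m. ?t (n, m)) has_sum (c n x * (y - y0) ^ n)) UNIV"
        by (auto intro!: norm_summable_imp_has_sum)
    qed
    then show "((\<lambda>(m, n). a m n * (x - x0) ^ m * (y - y0) ^ n) has_sum f x y) UNIV"
      by (subst (asm) has_sum_swap) simp
  qed
qed

lemma hol2_linear_coordinates:
  assumes "hol2 f S"
  shows "hol2 (\<lambda>x y. f (a * x + b * y + c) (a' * x + b' * y + c'))
    ((\<lambda>p. (a * fst p + b * snd p + c, a' * fst p + b' * snd p + c')) -` S)"
proof -
  have "open ((\<lambda>p. (a * fst p + b * snd p + c, a' * fst p + b' * snd p + c')) -` S)"
    by (intro open_vimage hol2_open[OF assms] continuous_intros)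
  then show ?thesis
    by (intro hol2_compose[OF assms] hol2_add hol2_mult hol2_const hol2_fst hol2_snd) auto
qed

text \<open>With \<open>x\<close> and \<open>y\<close> as independent complex variables,
  \<open>f (x + \<i> * y) (x - \<i> * y)\<close> is holomorphic in two variables; its double power
  series, read at real arguments, is the required expansion.\<close>

lemma hol2_imp_real_analytic_at:
  assumes "hol2 f S" "(z0, cnj z0) \<in> S"
  shows "real_analytic_at (\<lambda>z. f z (cnj z)) z0"
proof -
  let ?Q = "\<lambda>x y. f (1 * x + \<i> * y + 0) (1 * x + (- \<i>) * y + 0)"
  have z: "of_real (Re z) + \<i> * of_real (Im z) = z" "of_real (Re z) - \<i> * of_real (Im z) = cnj z" for z
    by (auto simp: complex_eq_iff)
  obtain a e where ae: "e > 0" "\<And>x y. x \<in> ball (of_real (Re z0)) e \<Longrightarrow> y \<in> ball (of_real (Im z0)) e \<Longrightarrow>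
    ((\<lambda>(m, n). a m n * (x - of_real (Re z0)) ^ m * (y - of_real (Im z0)) ^ n) has_sum ?Q x y) UNIV"
    by (rule hol2_double_power_series[OF hol2_linear_coordinates[OF assms(1), of 1 \<i> 0 1 "- \<i>" 0],
          of "of_real (Re z0)" "of_real (Im z0)"])
       (use assms(2) z in auto)
  show ?thesis unfolding real_analytic_at_def
  proof (intro exI[of _ a] exI[of _ e] conjI ballI ae(1))
    fix w assume w: "w \<in> ball z0 e"
    have "complex_of_real (Re w) \<in> ball (of_real (Re z0)) e" "complex_of_real (Im w) \<in> ball (of_real (Im z0)) e"
      using w abs_Re_le_cmod[of "z0 - w"] abs_Im_le_cmod[of "z0 - w"]
      by (auto simp: dist_norm simp flip: of_real_diff)
    from ae(2)[OF this] show "((\<lambda>(m, n). a m n * complex_of_real (Re w - Re z0) ^ m *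
      complex_of_real (Im w - Im z0) ^ n) has_sum f w (cnj w)) UNIV"
      using z by simp
  qed
qed

text \<open>Summability at the single real point \<open>z0 + Complex \<rho> \<rho>\<close> dominates
  the double series on a complex bidisc of radius \<open>\<rho>\<close>, where it defines a
  holomorphic function \<open>Q\<close>. Replacing the real and imaginary parts by (z + w)/2 and (z
  - w)/(2 \<i>), measured from the base point, gives \<open>f\<close>.\<close>

lemma real_analytic_at_imp_hol2:
  assumes "real_analytic_at g z0"
  obtains f e where "e > 0" "hol2 f (ball z0 e \<times> ball (cnj z0) e)"
    "\<And>z. z \<in> ball z0 e \<Longrightarrow> g z = f z (cnj z)"
proof -
  obtain a \<epsilon> where a: "0 < \<epsilon>"
     "\<forall>z\<in>ball z0 \<epsilon>. ((\<lambda>(m,n). a m n * complex_of_real (Re z - Re z0) ^ m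
          * complex_of_real (Im z - Im z0) ^ n) has_sum g z) UNIV"
    using assms(1) unfolding real_analytic_at_def by (elim exE conjE) (rule that)
  \<comment> \<open>Half of \<open>\<epsilon>\<close> keeps the corner of the square of side
    \<open>\<rho>\<close>, at distance \<open>\<rho>\<close> times the square root of 2, inside the
    ball of convergence.\<close>
  define \<rho> where "\<rho> = \<epsilon> / 2"
  have \<rho>: "\<rho> > 0" using a by (simp add: \<rho>_def)
  have "norm (Complex \<rho> \<rho>) < \<epsilon>"
    using a(1) by (simp add: \<rho>_def cmod_def power2_eq_square real_less_lsqrt)
  then have "z0 + Complex \<rho> \<rho> \<in> ball z0 \<epsilon>" by (simp add: dist_norm)
  from bspec[OF a(2) this] have "(\<lambda>(m,n). a m n * complex_of_real \<rho> ^ m * complex_of_real \<rho> ^ n) summable_on UNIV"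
    by (auto dest: has_sum_imp_summable)
  then have summ: "(\<lambda>(m,n). norm (a m n * complex_of_real \<rho> ^ m * complex_of_real \<rho> ^ n)) summable_on UNIV"
    by (simp add: summable_on_iff_abs_summable_on_complex case_prod_unfold)
  define Q where "Q x y = (\<Sum>\<^sub>\<infinity>(m,n). a m n * x ^ m * y ^ n)" for x y
  let ?S = "ball (0::complex) \<rho> \<times> ball (0::complex) \<rho>"
  let ?q = "\<lambda>(m, n) p. a m n * fst p ^ m * snd p ^ n"
  have "uniform_limit ?S (\<lambda>X p. \<Sum>i\<in>X. ?q i p) (\<lambda>p. \<Sum>\<^sub>\<infinity>i. ?q i p) (finite_subsets_at_top UNIV)"
  proof (rule Weierstrass_m_test_general[OF _ summ])
    fix i :: "nat \<times> nat" and p assume p: "p \<in> ?S"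
    obtain m n where [simp]: "i = (m, n)" by (cases i)
    show "norm (?q i p) \<le> (case i of (m,n) \<Rightarrow> norm (a m n * complex_of_real \<rho> ^ m * complex_of_real \<rho> ^ n))"
      using p \<rho> by (auto simp: norm_mult norm_power mem_Times_iff intro!: mult_mono power_mono)
  qed
  then have ul: "uniform_limit ?S (\<lambda>X p. \<Sum>(m,n)\<in>X. a m n * fst p ^ m * snd p ^ n)
      (\<lambda>p. Q (fst p) (snd p)) (finite_subsets_at_top UNIV)"
    by (simp add: Q_def case_prod_unfold)
  have "hol2 Q ?S"
    by (rule hol2_uniform_limit[OF _ _ _ ul])
      (auto simp: case_prod_unfold intro!: always_eventually hol2_sum hol2_mult hol2_const
        hol2_power hol2_fst hol2_snd open_Times)
  let ?a = "1/2 :: complex" and ?b = "1/(2*\<i>) :: complex"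
  define c c' where "c = - (z0 + cnj z0) / 2" and "c' = - (z0 - cnj z0) / (2 * \<i>)"
  let ?f = "\<lambda>z w. Q (?a * z + ?a * w + c) (?b * z + (- ?b) * w + c')"
  have eqs: "?a * z + ?a * w + c = ((z - z0) + (w - cnj z0)) / 2"
    "?b * z + (- ?b) * w + c' = ((z - z0) - (w - cnj z0)) / (2 * \<i>)" for z w
    by (simp_all add: c_def c'_def field_simps)
  show thesis
  proof (rule that[of \<rho> ?f])
    show "hol2 ?f (ball z0 \<rho> \<times> ball (cnj z0) \<rho>)"
    proof (rule hol2_subset[OF hol2_linear_coordinates[OF \<open>hol2 Q ?S\<close>]])
      show "ball z0 \<rho> \<times> ball (cnj z0) \<rho> \<subseteq>
        (\<lambda>p. (?a * fst p + ?a * snd p + c, ?b * fst p + (- ?b) * snd p + c')) -` ?S"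
      proof
        fix p assume "p \<in> ball z0 \<rho> \<times> ball (cnj z0) \<rho>"
        then have "norm (fst p - z0) < \<rho>" "norm (snd p - cnj z0) < \<rho>"
          by (auto simp: dist_norm norm_minus_commute)
        then have "norm (((fst p - z0) + (snd p - cnj z0)) / 2) < \<rho>"
          "norm (((fst p - z0) - (snd p - cnj z0)) / (2 * \<i>)) < \<rho>"
          using norm_triangle_ineq[of "fst p - z0" "snd p - cnj z0"] norm_triangle_ineq4[of "fst p - z0" "snd p - cnj z0"]
          by (auto simp: norm_divide norm_mult)
        then show "p \<in> (\<lambda>p. (?a * fst p + ?a * snd p + c, ?b * fst p + (- ?b) * snd p + c')) -` ?S"
          unfolding vimage_eq mem_Times_iff fst_conv snd_conv eqs by (simp add: dist_norm)
      qed
    qed (auto intro: open_Times)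
    fix z assume "z \<in> ball z0 \<rho>"
    then have "z \<in> ball z0 \<epsilon>" using a(1) by (auto simp: \<rho>_def)
    have 1: "((z - z0) + (cnj z - cnj z0)) / 2 = complex_of_real (Re z - Re z0)"
      by (simp add: complex_eq_iff)
    have 2: "((z - z0) - (cnj z - cnj z0)) / (2 * \<i>) = complex_of_real (Im z - Im z0)"
      by (simp add: complex_eq_iff field_simps Re_divide Im_divide power2_eq_square)
    show "g z = ?f z (cnj z)"
      unfolding eqs 1 2 Q_def using infsumI[OF bspec[OF a(2) \<open>z \<in> ball z0 \<epsilon>\<close>]] by simp
  qed (use \<rho> in auto)
qed

lemma hol2_continuous_on_cnj:
  assumes "hol2 f S" "\<And>z. z \<in> V \<Longrightarrow> (z, cnj z) \<in> S"
  shows "continuous_on V (\<lambda>z. f z (cnj z))"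
proof -
  have "continuous_on V (\<lambda>z. f (fst (z, cnj z)) (snd (z, cnj z)))"
    by (rule continuous_on_compose2[OF hol2_continuous_on[OF assms(1)]])
      (use assms(2) in \<open>auto intro!: continuous_intros\<close>)
  then show ?thesis by simp
qed

lemma real_analytic_at_continuous:
  assumes "real_analytic_at g z0"
  shows "isCont g z0"
proof -
  obtain f e where fe: "e > 0" "hol2 f (ball z0 e \<times> ball (cnj z0) e)"
    "\<And>z. z \<in> ball z0 e \<Longrightarrow> g z = f z (cnj z)" using real_analytic_at_imp_hol2[OF assms] by metis
  have "dist (cnj z) (cnj w) = dist z w" for z w
    unfolding dist_norm complex_cnj_diff[symmetric] complex_mod_cnj by simp
  then have "continuous_on (ball z0 e) (\<lambda>z. f z (cnj z))"
    using hol2_continuous_on_cnj[OF fe(2), of "ball z0 e"] by auto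
  then have "continuous_on (ball z0 e) g" by (rule continuous_on_eq) (use fe in auto)
  then show ?thesis using fe(1) by (simp add: continuous_on_eq_continuous_at)
qed

lemma islimpt_of_real_ball:
  assumes "e > 0"
  shows "complex_of_real t islimpt {complex_of_real s | s. \<bar>s - t\<bar> < e}"
  unfolding islimpt_approachable
proof (intro allI impI)
  fix d :: real assume "d > 0"
  then show "\<exists>x'\<in>{complex_of_real s | s. \<bar>s - t\<bar> < e}. x' \<noteq> of_real t \<and> dist x' (of_real t) < d"
    using assms by (intro bexI[of _ "of_real (t + min d e / 2)"])
      (auto simp: dist_norm simp flip: of_real_add of_real_diff intro!: exI[of _ "t + min d e / 2"])
qed

lemma holomorphic_zero_on_reals:
  assumes "f holomorphic_on ball (of_real t) e" "\<And>s::real. \<bar>s - t\<bar> < e \<Longrightarrow> f (of_real s) = 0"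
    and w: "w \<in> ball (of_real t) e"
  shows "f w = 0"
proof (rule analytic_continuation[OF assms(1), of "{complex_of_real s | s. \<bar>s - t\<bar> < e}" "of_real t"])
  have "e > 0" using w le_less_trans[OF zero_le_dist] unfolding mem_ball by blast
  then show "complex_of_real t islimpt {complex_of_real s | s. \<bar>s - t\<bar> < e}" "of_real t \<in> ball (complex_of_real t) e"
    by (auto intro: islimpt_of_real_ball)
qed (use assms in \<open>auto simp: dist_norm simp flip: of_real_diff\<close>)

text \<open>In the coordinates \<open>(z + w) / 2\<close> and \<open>(z - w) / (2 \<i>)\<close> the antidiagonal \<open>w = cnj z\<close> becomes the
  real plane, and the identity theorem applies in one coordinate after the other.\<close>

lemma hol2_zero_on_antidiagonal:
  assumes f: "hol2 f S" and z0: "(z0, cnj z0) \<in> S" and "\<epsilon> > 0"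
    and zero: "\<And>z. z \<in> ball z0 \<epsilon> \<Longrightarrow> f z (cnj z) = 0"
  obtains e where "e > 0" "\<And>z w. z \<in> ball z0 e \<Longrightarrow> w \<in> ball (cnj z0) e \<Longrightarrow> f z w = 0"
proof -
  let ?Q = "\<lambda>x y. f (1 * x + \<i> * y + 0) (1 * x + (- \<i>) * y + 0)"
  let ?T = "(\<lambda>p. (1 * fst p + \<i> * snd p + 0, 1 * fst p + (- \<i>) * snd p + 0)) -` S"
  have Q: "hol2 ?Q ?T" by (rule hol2_linear_coordinates[OF f])
  have z: "of_real (Re z) + \<i> * of_real (Im z) = z" "of_real (Re z) - \<i> * of_real (Im z) = cnj z" for z
    by (auto simp: complex_eq_iff)
  let ?x = "of_real (Re z0) :: complex" and ?y = "of_real (Im z0) :: complex"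
  have "(?x, ?y) \<in> ?T" using z0 z by simp
  then obtain d where d: "d > 0" "cball ?x d \<times> cball ?y d \<subseteq> ?T"
    by (rule open_contains_cball_prod[OF hol2_open[OF Q]])
  \<comment> \<open>The square of half-side \<open>e\<close> about \<open>z0\<close> has to fit into
    \<open>ball z0 \<epsilon>\<close>, hence half of \<open>\<epsilon>\<close>.\<close>
  define e where "e = min d (\<epsilon> / 2)"
  have e: "e > 0" "e \<le> d" "e \<le> \<epsilon> / 2" using d assms(3) by (auto simp: e_def)
  have sub: "(x, y) \<in> ?T" if "x \<in> ball ?x e" "y \<in> ball ?y e" for x y
    using that e(2) d(2) by (force simp: subset_iff)
  have real: "?Q (of_real s) y = 0" if s: "\<bar>s - Re z0\<bar> < e" and y: "y \<in> ball ?y e" for s y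
  proof (rule holomorphic_zero_on_reals[OF hol2_slice2[OF Q] _ y])
    fix y assume "y \<in> ball ?y e"
    then show "(of_real s, y) \<in> ?T" by (intro sub) (use s in \<open>auto simp: dist_norm simp flip: of_real_diff\<close>)
  next
    fix t :: real assume t: "\<bar>t - Im z0\<bar> < e"
    have "norm (Complex s t - z0) \<le> \<bar>s - Re z0\<bar> + \<bar>t - Im z0\<bar>"
      using cmod_le[of "Complex s t - z0"] by simp
    then have "Complex s t \<in> ball z0 \<epsilon>" using s t e by (simp add: dist_norm norm_minus_commute)
    from zero[OF this] show "?Q (of_real s) (of_real t) = 0"
      using z[of "Complex s t"] by simp
  qed
  have Q0: "?Q x y = 0" if x: "x \<in> ball ?x e" and y: "y \<in> ball ?y e" for x y
    by (rule holomorphic_zero_on_reals[OF hol2_slice1[OF Q] real[OF _ y] x]) (use sub y in auto)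
  show thesis
  proof (rule that[OF e(1)])
    fix z w assume zw: "z \<in> ball z0 e" "w \<in> ball (cnj z0) e"
    have eqs: "(z + w) / 2 - ?x = ((z - z0) + (w - cnj z0)) / 2"
      "(z - w) / (2 * \<i>) - ?y = ((z - z0) - (w - cnj z0)) / (2 * \<i>)"
      using z[of z0] by (simp_all add: complex_eq_iff field_simps Re_divide Im_divide power2_eq_square)
    have "norm ((z + w) / 2 - ?x) < e" "norm ((z - w) / (2 * \<i>) - ?y) < e"
      unfolding eqs using zw norm_triangle_ineq[of "z - z0" "w - cnj z0"] norm_triangle_ineq4[of "z - z0" "w - cnj z0"]
      by (auto simp: norm_divide norm_mult dist_norm norm_minus_commute)
    then have "?Q ((z + w) / 2) ((z - w) / (2 * \<i>)) = 0"
      by (intro Q0) (auto simp: dist_norm norm_minus_commute)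
    then show "f z w = 0" by (simp add: field_simps)
  qed
qed

section \<open>Wirtinger derivatives on the antidiagonal\<close>

text \<open>Along \<open>z + c * t\<close> the conjugate moves in direction \<open>cnj c\<close>, so
  the chain rule weights the two partial derivatives with \<open>c\<close> and \<open>cnj c\<close>;
  the cases are \<open>c = 1\<close> and \<open>c = \<i>\<close>.\<close>

lemma hol2_vector_derivatives:
  assumes f: "hol2 f S" and V: "open V" "\<And>z. z \<in> V \<Longrightarrow> (z, cnj z) \<in> S \<and> F z = f z (cnj z)" and z: "z \<in> V"
  shows "((\<lambda>t::real. F (z + complex_of_real t)) has_vector_derivative
      (deriv (\<lambda>z'. f z' (cnj z)) z + deriv (f z) (cnj z))) (at 0)" (is ?x)
    and "((\<lambda>t::real. F (z + \<i> * complex_of_real t)) has_vector_derivative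
      \<i> * (deriv (\<lambda>z'. f z' (cnj z)) z - deriv (f z) (cnj z))) (at 0)" (is ?y)
proof -
  let ?line = "\<lambda>c t. z + c * complex_of_real t"
  have lines: "open ((\<lambda>t::real. ?line c t) -` V)" for c
    by (intro open_vimage V continuous_intros)
  have line: "((\<lambda>t::real. a + c * complex_of_real t) has_vector_derivative c) (at 0)" for a c
    by (auto intro!: derivative_eq_intros simp: has_vector_derivative_def scaleR_conv_of_real)
  have "((\<lambda>t::real. f (z + c * complex_of_real t) (cnj z + cnj c * complex_of_real t)) has_vector_derivative
      (deriv (\<lambda>z'. f z' (cnj z)) z * c + deriv (f z) (cnj z) * cnj c)) (at 0)" for c
    using hol2_chain_real[OF f _ line line, of z c "cnj z" "cnj c"] V z by simp
  then have "((\<lambda>t::real. F (?line c t)) has_vector_derivative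
      (deriv (\<lambda>z'. f z' (cnj z)) z * c + deriv (f z) (cnj z) * cnj c)) (at 0)" for c
    by (rule has_vector_derivative_transform_within_open[OF _ lines[of c]]) (use V z in auto)
  from this[of 1] this[of \<i>] show ?x ?y by (simp_all add: algebra_simps)
qed

text \<open>The Wirtinger combinations separate the two complex partial derivatives again.
  Harmonicity thereby becomes a statement about a function of two independent variables.\<close>

lemma hol2_partials:
  assumes f: "hol2 f S" and V: "open V" "\<And>z. z \<in> V \<Longrightarrow> (z, cnj z) \<in> S \<and> F z = f z (cnj z)" and z: "z \<in> V"
  shows "dx F z = deriv (\<lambda>z'. f z' (cnj z)) z + deriv (f z) (cnj z)"
    and "dy F z = \<i> * (deriv (\<lambda>z'. f z' (cnj z)) z - deriv (f z) (cnj z))"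
    and "d_z F z = deriv (\<lambda>z'. f z' (cnj z)) z"
    and "d_zbar F z = deriv (f z) (cnj z)"
proof -
  show *: "dx F z = deriv (\<lambda>z'. f z' (cnj z)) z + deriv (f z) (cnj z)"
    "dy F z = \<i> * (deriv (\<lambda>z'. f z' (cnj z)) z - deriv (f z) (cnj z))"
    unfolding dx_def dy_def using hol2_vector_derivatives[OF f V z] by (auto intro: vector_derivative_at)
  show "d_z F z = deriv (\<lambda>z'. f z' (cnj z)) z" "d_zbar F z = deriv (f z) (cnj z)"
    unfolding d_z_def d_zbar_def * by (simp_all add: algebra_simps)
qed

text \<open>Restrictions of \<open>hol2\<close> functions to the antidiagonal form a class closed
  under \<open>dx\<close> and \<open>dy\<close>, so one argument for continuity and one for
  differentiability cover every order that occurs.\<close>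

lemma hol2_C2_on:
  assumes f: "hol2 f S" and V: "open V" "\<And>z. z \<in> V \<Longrightarrow> (z, cnj z) \<in> S \<and> F z = f z (cnj z)"
  shows "C2_on V F"
proof -
  define R where "R F \<longleftrightarrow> (\<exists>f. hol2 f S \<and> (\<forall>z\<in>V. (z, cnj z) \<in> S \<and> F z = f z (cnj z)))" for F
  have step: "R (dx F) \<and> R (dy F)" if RF: "R F" for F
  proof -
    obtain f where f: "hol2 f S" "\<And>z. z \<in> V \<Longrightarrow> (z, cnj z) \<in> S \<and> F z = f z (cnj z)"
      using RF unfolding R_def by blast
    note p = hol2_partials(1,2)[OF f(1) V(1) f(2)]
    have h: "hol2 (\<lambda>x y. deriv (\<lambda>x. f x y) x + deriv (f x) y) S"
      "hol2 (\<lambda>x y. \<i> * (deriv (\<lambda>x. f x y) x - deriv (f x) y)) S"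
      by (intro hol2_add hol2_diff hol2_mult hol2_const hol2_deriv1 hol2_deriv2 hol2_open[OF f(1)] f)+
    have "R (dx F)"
      unfolding R_def by (rule exI[of _ "\<lambda>x y. deriv (\<lambda>x. f x y) x + deriv (f x) y"]) (use h p f(2) in auto)
    moreover have "R (dy F)"
      unfolding R_def by (rule exI[of _ "\<lambda>x y. \<i> * (deriv (\<lambda>x. f x y) x - deriv (f x) y)"]) (use h p f(2) in auto)
    ultimately show ?thesis ..
  qed
  have cont: "continuous_on V F" if RF: "R F" for F
  proof -
    obtain f where f: "hol2 f S" "\<And>z. z \<in> V \<Longrightarrow> (z, cnj z) \<in> S \<and> F z = f z (cnj z)"
      using RF unfolding R_def by blast
    have "continuous_on V (\<lambda>z. f z (cnj z))"
      by (rule hol2_continuous_on_cnj[OF f(1)]) (use f in auto)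
    then show ?thesis by (rule continuous_on_eq) (use f in auto)
  qed
  have pc: "partials_cont V F" if RF: "R F" for F
  proof -
    obtain f where f: "hol2 f S" "\<And>z. z \<in> V \<Longrightarrow> (z, cnj z) \<in> S \<and> F z = f z (cnj z)"
      using RF unfolding R_def by blast
    show ?thesis
      unfolding partials_cont_def
      using cont[OF RF] hol2_vector_derivatives[OF f(1) V(1) f(2), THEN differentiableI_vector] by simp
  qed
  have "R F" using f V by (auto simp: R_def)
  then show ?thesis unfolding C2_on_def
    using V(1) by (intro conjI pc cont step[THEN conjunct1] step[THEN conjunct2])
qed

section \<open>The Cayley transform of the Riemann sphere\<close>

text \<open>At the pole the division convention gives \<open>cay (-\<i>) = 0\<close>, which is also
  the value at \<open>\<i>\<close>. The coordinate is therefore faithful only where it is nonzero,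
  and the neighbourhoods used below avoid the value 0.\<close>

definition cay :: "complex \<Rightarrow> complex" where
  "cay z = (z - \<i>) / (z + \<i>)"

definition icay :: "complex \<Rightarrow> complex" where
  "icay s = \<i> * (1 + s) / (1 - s)"

definition cayley :: "complex option \<Rightarrow> complex" where
  "cayley x = (case x of None \<Rightarrow> 1 | Some z \<Rightarrow> cay z)"

definition inv_cayley :: "complex \<Rightarrow> complex option" where
  "inv_cayley s = (if s = 1 then None else Some (icay s))"

text \<open>A ball in the Cayley coordinate is not stable under reflection in the circle. Imposing
  the condition on the point and on its conjugate puts the pair of coordinates into the bidisc on
  which complexifications live.\<close>

definition sym_nbhd :: "complex \<Rightarrow> real \<Rightarrow> complex option set" where
  "sym_nbhd c d = {x. cayley x \<in> ball c d \<and> cayley (map_option cnj x) \<in> ball c d}"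

lemma cayley_simps [simp]: "cayley None = 1" "cayley (Some z) = cay z"
  by (simp_all add: cayley_def)

lemma cay_neq_1: "cay z \<noteq> 1"
  unfolding cay_def divide_eq_1_iff by (simp add: complex_eq_iff)

lemma cay_icay: "s \<noteq> 1 \<Longrightarrow> cay (icay s) = s"
proof -
  assume s: "s \<noteq> 1"
  then have "icay s - \<i> = 2 * \<i> * s / (1 - s)" "icay s + \<i> = 2 * \<i> / (1 - s)"
    by (simp_all add: icay_def field_simps)
  then show ?thesis using s by (simp add: cay_def)
qed

lemma icay_cay: "z \<noteq> -\<i> \<Longrightarrow> icay (cay z) = z"
proof -
  assume "z \<noteq> -\<i>"
  then have z: "z + \<i> \<noteq> 0" by (simp add: eq_neg_iff_add_eq_0)
  then have "1 + cay z = 2 * z / (z + \<i>)" "1 - cay z = 2 * \<i> / (z + \<i>)"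
    by (simp_all add: cay_def field_simps)
  then show ?thesis using z by (simp add: icay_def)
qed

lemma cay_eq_0: "cay z = 0 \<longleftrightarrow> z = \<i> \<or> z = -\<i>"
  by (auto simp: cay_def eq_neg_iff_add_eq_0)

lemma inv_cayley_cayley: "cayley x \<noteq> 0 \<Longrightarrow> inv_cayley (cayley x) = x"
  by (cases x) (auto simp: inv_cayley_def cay_neq_1 cay_eq_0 icay_cay)

lemma cayley_inv_cayley: "cayley (inv_cayley s) = s"
  by (simp add: inv_cayley_def cay_icay)

lemma norm_cay: 
  assumes "z \<noteq> -\<i>"
  shows "norm (cay z) < 1 \<longleftrightarrow> Im z > 0" "norm (cay z) = 1 \<longleftrightarrow> Im z = 0"
proof -
  have pos: "norm (z + \<i>) > 0" using assms by (simp add: eq_neg_iff_add_eq_0)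
  have sq: "(norm (z - \<i>))\<^sup>2 = (norm (z + \<i>))\<^sup>2 - 4 * Im z"
    unfolding cmod_power2 by (simp add: power2_eq_square algebra_simps)
  have "norm (cay z) < 1 \<longleftrightarrow> norm (z - \<i>) < norm (z + \<i>)"
    using pos by (simp add: cay_def norm_divide)
  also have "\<dots> \<longleftrightarrow> (norm (z - \<i>))\<^sup>2 < (norm (z + \<i>))\<^sup>2"
    by (metis norm_ge_zero power2_less_imp_less power_strict_mono zero_less_numeral)
  finally show "norm (cay z) < 1 \<longleftrightarrow> Im z > 0" using sq by simp
  have "norm (cay z) = 1 \<longleftrightarrow> norm (z - \<i>) = norm (z + \<i>)"
    using pos by (auto simp: cay_def norm_divide)
  also have "\<dots> \<longleftrightarrow> (norm (z - \<i>))\<^sup>2 = (norm (z + \<i>))\<^sup>2" by simp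
  finally show "norm (cay z) = 1 \<longleftrightarrow> Im z = 0" using sq by simp
qed

lemma p1R_cases: "x \<in> p1R \<Longrightarrow> x = None \<or> (\<exists>t::real. x = Some (of_real t))"
  by (auto simp: p1R_def)

lemma p1R_iff_cayley: "x \<in> p1R \<longleftrightarrow> norm (cayley x) = 1"
proof (cases x)
  case (Some z)
  show ?thesis
  proof (cases "z = -\<i>")
    case True
    have "cay (-\<i>) = 0" by (simp add: cay_def)
    moreover have "x \<notin> p1R" using Some True by (auto simp: p1R_def complex_eq_iff)
    ultimately show ?thesis using Some True by simp
  next
    case False
    then show ?thesis using Some norm_cay[of z] by (auto simp: p1R_def complex_eq_iff)
  qed
qed (simp add: p1R_def)

lemma cnj_p1R: "x \<in> p1R \<Longrightarrow> map_option cnj x = x"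
  by (auto simp: p1R_def)

text \<open>Complex conjugation corresponds to reflection in the unit circle, which sends
  \<open>s\<close> to \<open>1 / cnj s\<close>.\<close>

lemma cay_cnj:
  assumes "z \<noteq> \<i>" "z \<noteq> -\<i>"
  shows "cay (cnj z) = 1 / cnj (cay z)"
proof -
  have "cnj z + \<i> = cnj (z - \<i>)" "cnj z - \<i> = cnj (z + \<i>)" by simp_all
  then show ?thesis by (simp only: cay_def complex_cnj_divide) (simp add: field_simps)
qed

lemma cay_has_derivative: "z \<noteq> -\<i> \<Longrightarrow> (cay has_field_derivative 2 * \<i> / (z + \<i>)\<^sup>2) (at z)"
proof -
  assume "z \<noteq> -\<i>"
  then have z: "z + \<i> \<noteq> 0" by (simp add: eq_neg_iff_add_eq_0)
  have "((\<lambda>z. (z - \<i>) / (z + \<i>)) has_field_derivative ((1 - 0) * (z + \<i>) - (z - \<i>) * (1 + 0)) / ((z + \<i>) * (z + \<i>))) (at z)"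
    by (intro DERIV_divide DERIV_diff DERIV_add DERIV_ident DERIV_const z)
  then show ?thesis unfolding cay_def[abs_def] by (simp add: power2_eq_square)
qed

lemma icay_holomorphic: "1 \<notin> A \<Longrightarrow> icay holomorphic_on A"
  unfolding icay_def[abs_def] by (auto intro!: holomorphic_intros)

lemma cay_holomorphic: "-\<i> \<notin> A \<Longrightarrow> cay holomorphic_on A"
  unfolding cay_def[abs_def] by (intro holomorphic_intros) (metis add_eq_0_iff2)

section \<open>Open sets of the sphere in the Cayley coordinate\<close>

lemma p1_open_Int: "p1_open U \<Longrightarrow> p1_open V \<Longrightarrow> p1_open (U \<inter> V)"
proof -
  assume UV: "p1_open U" "p1_open V"
  have "{z. Some z \<in> U \<inter> V} = {z. Some z \<in> U} \<inter> {z. Some z \<in> V}" by auto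
  then have "open {z. Some z \<in> U \<inter> V}" using UV by (auto simp: p1_open_def)
  moreover have "\<exists>R. \<forall>z. R < norm z \<longrightarrow> Some z \<in> U \<inter> V" if N: "None \<in> U \<inter> V"
  proof -
    obtain R1 R2 where "\<forall>z. R1 < norm z \<longrightarrow> Some z \<in> U" "\<forall>z. R2 < norm z \<longrightarrow> Some z \<in> V"
      using UV N unfolding p1_open_def by blast
    then show ?thesis by (intro exI[of _ "max R1 R2"]) auto
  qed
  ultimately show ?thesis unfolding p1_open_def by blast
qed

lemma p1_open_Union: "(\<And>i. i \<in> A \<Longrightarrow> p1_open (U i)) \<Longrightarrow> p1_open (\<Union>i\<in>A. U i)"
proof -
  assume U: "\<And>i. i \<in> A \<Longrightarrow> p1_open (U i)"
  have "{z. Some z \<in> (\<Union>i\<in>A. U i)} = (\<Union>i\<in>A. {z. Some z \<in> U i})" by auto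
  then have "open {z. Some z \<in> (\<Union>i\<in>A. U i)}" using U by (auto simp: p1_open_def)
  moreover have "\<exists>R. \<forall>z. R < norm z \<longrightarrow> Some z \<in> (\<Union>i\<in>A. U i)" if N: "None \<in> (\<Union>i\<in>A. U i)"
  proof -
    obtain i R where "i \<in> A" "\<forall>z. R < norm z \<longrightarrow> Some z \<in> U i"
      using U N unfolding p1_open_def by blast
    then show ?thesis by blast
  qed
  ultimately show ?thesis unfolding p1_open_def by blast
qed

lemma norm_cay_minus_1: "z \<noteq> -\<i> \<Longrightarrow> norm (cay z - 1) = 2 / norm (z + \<i>)"
proof -
  assume "z \<noteq> -\<i>"
  then have z: "z + \<i> \<noteq> 0" by (simp add: eq_neg_iff_add_eq_0)
  have "cay z - 1 = - (2 * \<i>) / (z + \<i>)" using z by (simp add: cay_def field_simps)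
  then show ?thesis by (simp add: norm_divide norm_mult)
qed

lemma cay_near_1: "e > 0 \<Longrightarrow> norm z > 1 + 2 / e \<Longrightarrow> cay z \<in> ball 1 e"
proof -
  assume e: "e > 0" and z: "norm z > 1 + 2 / e"
  have "2 / e > 0" using e by simp
  then have n: "z \<noteq> -\<i>" using z by auto
  have "norm (z + \<i>) > 2 / e" using z norm_triangle_ineq4[of "z + \<i>" \<i>] by simp
  then have "2 / norm (z + \<i>) < e"
    using e less_trans[OF \<open>2 / e > 0\<close>, of "norm (z + \<i>)"] by (simp add: field_simps)
  then show ?thesis using norm_cay_minus_1[OF n] by (simp add: dist_norm norm_minus_commute)
qed

text \<open>The assumption \<open>0 \<notin> V\<close> keeps the pole \<open>-\<i>\<close>, where
  \<open>cay\<close> takes the default value 0, out of the preimage. If 1 lies in \<open>V\<close>,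
  a ball about 1 corresponds to a neighbourhood of infinity.\<close>

lemma p1_open_cayley_vimage:
  assumes "open V" "0 \<notin> V"
  shows "p1_open {x. cayley x \<in> V}" "p1_open {x. cayley (map_option cnj x) \<in> V}"
proof -
  have "continuous_on (- {-\<i>}) cay"
    by (intro holomorphic_on_imp_continuous_on cay_holomorphic) auto
  then have "open (cay -` V \<inter> (- {-\<i>}))"
    using assms(1) by (simp add: continuous_on_open_vimage open_Compl)
  moreover have "cay -` V \<inter> (- {-\<i>}) = {z. cay z \<in> V}"
    using assms(2) by (auto simp: cay_def)
  ultimately have 1: "open {z. cay z \<in> V}" by simp
  have "open (cnj -` {z. cay z \<in> V})" by (intro open_vimage 1 continuous_intros)
  then have 2: "open {z. cay (cnj z) \<in> V}" by (simp add: vimage_def)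
  have 3: "\<exists>R. \<forall>z. R < norm z \<longrightarrow> cay z \<in> V" if "1 \<in> V"
  proof -
    obtain e where "e > 0" "ball 1 e \<subseteq> V" using assms(1) \<open>1 \<in> V\<close> open_contains_ball by blast
    then show ?thesis using cay_near_1 by (intro exI[of _ "1 + 2 / e"]) auto
  qed
  then have 4: "\<exists>R. \<forall>z. R < norm z \<longrightarrow> cay (cnj z) \<in> V" if "1 \<in> V"
    using that complex_mod_cnj by metis
  show "p1_open {x. cayley x \<in> V}" "p1_open {x. cayley (map_option cnj x) \<in> V}"
    unfolding p1_open_def using 1 2 3 4 by auto
qed

lemma sphere_ball_nonzero: "norm (c::complex) = 1 \<Longrightarrow> d \<le> 1 \<Longrightarrow> 0 \<notin> ball c d"
  by (simp add: dist_norm)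

lemma p1_open_sym_nbhd: "norm c = 1 \<Longrightarrow> d \<le> 1 \<Longrightarrow> p1_open (sym_nbhd c d)"
  unfolding sym_nbhd_def Collect_conj_eq
  by (intro p1_open_Int p1_open_cayley_vimage sphere_ball_nonzero open_ball)

lemma mem_sym_nbhd: "x \<in> p1R \<Longrightarrow> d > 0 \<Longrightarrow> x \<in> sym_nbhd (cayley x) d"
  by (simp add: sym_nbhd_def cnj_p1R)

lemma p1_open_contains_cayley_ball:
  assumes "p1_open U" "x \<in> U" "x \<in> p1R"
  obtains d where "0 < d" "d \<le> 1" "\<And>y. cayley y \<in> ball (cayley x) d \<Longrightarrow> y \<in> U"
proof (cases x)
  case None
  then obtain R where R: "\<And>z. R < norm z \<Longrightarrow> Some z \<in> U" using assms by (auto simp: p1_open_def)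
  \<comment> \<open>\<open>2 / norm (z + \<i>) < d\<close> then means that
    \<open>norm (z + \<i>)\<close> exceeds \<open>\<bar>R\<bar> + 2\<close>; removing the shift by
    \<open>\<i>\<close> costs 1. The added 2 also gives \<open>d \<le> 1\<close> for every
    \<open>R\<close>.\<close>
  define d where "d = 2 / (\<bar>R\<bar> + 2)"
  show thesis
  proof (rule that[of d])
    show "0 < d" "d \<le> 1" by (auto simp: d_def)
    fix y assume y: "cayley y \<in> ball (cayley x) d"
    show "y \<in> U"
    proof (cases y)
      case None then show ?thesis using \<open>x = None\<close> assms by simp
    next
      case (Some z)
      have "z \<noteq> -\<i>" using y Some None by (auto simp: cay_def d_def)
      then have "2 / norm (z + \<i>) < d" "norm (z + \<i>) > 0"
        using y Some None norm_cay_minus_1 by (auto simp: dist_norm norm_minus_commute eq_neg_iff_add_eq_0)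
      then have "norm (z + \<i>) > \<bar>R\<bar> + 2"
        unfolding d_def by (simp add: field_simps add_nonneg_pos)
      then have "norm z > R" using norm_triangle_ineq[of z \<i>] by simp
      then show ?thesis using R Some by simp
    qed
  qed
next
  case (Some t)
  let ?O = "icay -` {z. Some z \<in> U} \<inter> (- {1})"
  have cont: "continuous_on (- {1}) icay" by (intro holomorphic_on_imp_continuous_on icay_holomorphic) auto
  have "open {z. Some z \<in> U}" using assms(1) by (simp add: p1_open_def)
  with cont have "open ?O"
    using continuous_on_open_vimage[of "- {1}" icay] open_Compl[OF closed_singleton] by blast
  moreover have "t \<noteq> -\<i>" using Some assms(3) by (auto simp: p1R_def complex_eq_iff)
  then have "cay t \<in> ?O" using Some assms(2) by (simp add: icay_cay cay_neq_1)
  ultimately obtain d where d: "d > 0" "ball (cay t) d \<subseteq> ?O" using open_contains_ball by blast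
  show thesis
  proof (rule that[of "min d 1"])
    show "0 < min d 1" "min d 1 \<le> 1" using d by auto
    fix y assume y: "cayley y \<in> ball (cayley x) (min d 1)"
    have "0 \<notin> ball (cayley x) (min d 1)"
      using assms(3) p1R_iff_cayley by (intro sphere_ball_nonzero) auto
    then have "cayley y \<noteq> 0" using y by metis
    from inv_cayley_cayley[OF this] have "inv_cayley (cayley y) = y" .
    moreover have "cayley y \<in> ?O" using y d Some by auto
    ultimately show "y \<in> U" by (auto simp: inv_cayley_def)
  qed
qed

section \<open>Analytic functions on the sphere in the Cayley coordinate\<close>

text \<open>This is the coordinate \<open>1 / z\<close> at infinity expressed through
  \<open>s = cay z\<close>; it is regular at \<open>s = 1\<close>.\<close>

definition inf_chart :: "complex \<Rightarrow> complex" where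
  "inf_chart s = (1 - s) / (\<i> * (1 + s))"

lemma inf_chart_holomorphic: "-1 \<notin> A \<Longrightarrow> inf_chart holomorphic_on A"
  unfolding inf_chart_def[abs_def]
  by (intro holomorphic_intros) (metis add_eq_0_iff mult_eq_0_iff complex_i_not_zero)

lemma inf_chart_cay: "z \<noteq> 0 \<Longrightarrow> z \<noteq> -\<i> \<Longrightarrow> inf_chart (cay z) = 1 / z"
proof -
  assume z: "z \<noteq> 0" "z \<noteq> -\<i>"
  have "inf_chart s = 1 / icay s" for s by (simp add: inf_chart_def icay_def)
  then show ?thesis using icay_cay[OF z(2)] by simp
qed

lemma at_inf_chart_inf_chart:
  assumes "s \<noteq> -1"
  shows "at_inf_chart g (inf_chart s) = g (inv_cayley s)"
proof (cases "s = 1")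
  case False
  have "1 + s \<noteq> 0" using assms by (metis add.inverse_unique)
  then have "inf_chart s \<noteq> 0" "1 / inf_chart s = icay s"
    using False by (auto simp: inf_chart_def icay_def)
  then show ?thesis using False by (simp add: at_inf_chart_def inv_cayley_def)
qed (simp add: at_inf_chart_def inv_cayley_def inf_chart_def)

text \<open>Real points and infinity are treated alike: \<open>\<psi>\<close> leads from the Cayley
  coordinate to the chart in which analyticity at \<open>x\<close> is defined. By the last
  conclusion the ball about a finite point misses 1, the coordinate of infinity.\<close>

lemma cayley_chart:
  assumes "x \<in> p1R" "e > 0"
  obtains \<psi> d where "0 < d" "d \<le> 1" "\<psi> holomorphic_on ball (cayley x) d"
    "\<And>s. s \<in> ball (cayley x) d \<Longrightarrow> \<psi> s \<in> ball (case x of None \<Rightarrow> 0 | Some t \<Rightarrow> t) e"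
    "\<And>s. s \<in> ball (cayley x) d \<Longrightarrow> \<psi> s = (case x of None \<Rightarrow> inf_chart s | Some t \<Rightarrow> icay s)"
    "1 \<in> ball (cayley x) d \<Longrightarrow> x = None"
proof -
  define \<psi> where "\<psi> = (case x of None \<Rightarrow> inf_chart | Some t \<Rightarrow> icay)"
  define A where "A = (case x of None \<Rightarrow> - {-1} | Some t \<Rightarrow> - {1 :: complex})"
  define b where "b = (case x of None \<Rightarrow> 0 | Some t \<Rightarrow> t)"
  have A: "open A" by (auto simp: A_def split: option.split)
  have hol: "\<psi> holomorphic_on A"
    by (auto simp: A_def \<psi>_def split: option.split intro!: icay_holomorphic inf_chart_holomorphic)
  have "open (\<psi> -` ball b e \<inter> A)"
    using holomorphic_on_imp_continuous_on[OF hol] A by (simp add: continuous_on_open_vimage)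
  moreover have "x \<noteq> Some (-\<i>)" using assms(1) by (auto simp: p1R_def complex_eq_iff)
  then have "cayley x \<in> \<psi> -` ball b e \<inter> A"
    using assms(2) by (cases x) (auto simp: \<psi>_def A_def b_def inf_chart_def icay_cay cay_neq_1)
  ultimately obtain d where d: "d > 0" "ball (cayley x) d \<subseteq> \<psi> -` ball b e \<inter> A" using open_contains_ball by blast
  show thesis
  proof (rule that[of "min d 1" \<psi>])
    have sub: "ball (cayley x) (min d 1) \<subseteq> \<psi> -` ball b e \<inter> A" using d by auto
    show "\<psi> holomorphic_on ball (cayley x) (min d 1)" using hol sub holomorphic_on_subset by blast
    show "\<psi> s \<in> ball (case x of None \<Rightarrow> 0 | Some t \<Rightarrow> t) e" if "s \<in> ball (cayley x) (min d 1)" for s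
      using that sub by (auto simp: b_def)
    show "1 \<in> ball (cayley x) (min d 1) \<Longrightarrow> x = None"
      using sub by (cases x) (auto simp: A_def)
  qed (use d in \<open>auto simp: \<psi>_def split: option.split\<close>)
qed

lemma p1_holomorphic_on_local:
  assumes "p1_open U" "p1_holomorphic_on g U" "x \<in> U" "x \<in> p1R"
  obtains d h where "0 < d" "d \<le> 1" "h holomorphic_on ball (cayley x) d"
    "\<And>y. cayley y \<in> ball (cayley x) d \<Longrightarrow> y \<in> U \<and> g y = h (cayley y)"
proof -
  obtain d0 where d0: "0 < d0" "d0 \<le> 1" "\<And>y. cayley y \<in> ball (cayley x) d0 \<Longrightarrow> y \<in> U"
    using p1_open_contains_cayley_ball assms by metis
  obtain k b e where k: "k holomorphic_on ball b e" "e > 0" "b = (case x of None \<Rightarrow> 0 | Some t \<Rightarrow> t)"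
    "k = (case x of None \<Rightarrow> at_inf_chart g | Some t \<Rightarrow> (\<lambda>w. g (Some w)))"
  proof (cases x)
    case None
    then obtain e where "e > 0" "at_inf_chart g holomorphic_on ball 0 e"
      using assms(2,3) by (auto simp: p1_holomorphic_on_def analytic_on_def)
    then show thesis by (intro that[of "at_inf_chart g" 0 e]) (simp_all add: None)
  next
    case (Some t)
    then obtain e where "e > 0" "ball t e \<subseteq> {z. Some z \<in> U}"
      using assms(1,3) by (auto simp: p1_open_def open_contains_ball)
    moreover have "(\<lambda>w. g (Some w)) holomorphic_on {z. Some z \<in> U}"
      using assms(2) by (auto simp: p1_holomorphic_on_def)
    ultimately have "(\<lambda>w. g (Some w)) holomorphic_on ball t e" using holomorphic_on_subset by blast
    then show thesis by (rule that[OF _ \<open>e > 0\<close>]) (simp_all add: Some)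
  qed
  obtain \<psi> d where \<psi>: "0 < d" "d \<le> 1" "\<psi> holomorphic_on ball (cayley x) d"
    "\<And>s. s \<in> ball (cayley x) d \<Longrightarrow> \<psi> s \<in> ball b e"
    "\<And>s. s \<in> ball (cayley x) d \<Longrightarrow> \<psi> s = (case x of None \<Rightarrow> inf_chart s | Some t \<Rightarrow> icay s)"
    "1 \<in> ball (cayley x) d \<Longrightarrow> x = None"
    using cayley_chart[OF assms(4) k(2), folded k(3)] by metis
  have kg: "k (\<psi> s) = g (inv_cayley s)" if "s \<in> ball (cayley x) d" for s
  proof (cases x)
    case None
    then have "s \<noteq> -1" using that \<psi>(2) by (auto simp: dist_norm)
    then show ?thesis using None \<psi>(5)[OF that] k(4) at_inf_chart_inf_chart by simp
  next
    case (Some t)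
    then have "s \<noteq> 1" using that \<psi>(6) by auto
    then show ?thesis using Some \<psi>(5)[OF that] k(4) by (simp add: inv_cayley_def)
  qed
  show thesis
  proof (rule that[of "min d d0" "\<lambda>s. k (\<psi> s)"])
    have "(k \<circ> \<psi>) holomorphic_on ball (cayley x) d"
      by (rule holomorphic_on_compose_gen[OF \<psi>(3) k(1)]) (use \<psi>(4) in auto)
    then show "(\<lambda>s. k (\<psi> s)) holomorphic_on ball (cayley x) (min d d0)"
      unfolding o_def by (rule holomorphic_on_subset) auto
    fix y assume y: "cayley y \<in> ball (cayley x) (min d d0)"
    have "0 \<notin> ball (cayley x) d"
      using assms(4) p1R_iff_cayley \<psi> by (intro sphere_ball_nonzero) auto
    then have "cayley y \<noteq> 0" using y by auto
    from inv_cayley_cayley[OF this] show "y \<in> U \<and> g y = k (\<psi> (cayley y))"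
      using kg[of "cayley y"] d0(3)[of y] y by auto
  qed (use \<psi> d0 in auto)
qed

text \<open>The transition map \<open>\<psi>\<close> carries reflection in the circle to complex
  conjugation of the chart. An expression \<open>f z (cnj z)\<close> in the chart therefore becomes
  \<open>f (\<psi> u) (\<psi> p)\<close>, which is holomorphic in both Cayley coordinates.\<close>

lemma p1_real_analytic_on_local:
  assumes "p1_open U" "p1_real_analytic_on G U" "x \<in> U" "x \<in> p1R"
  obtains d K where "0 < d" "d \<le> 1" "hol2 K (ball (cayley x) d \<times> ball (cayley x) d)"
    "\<And>y. y \<in> sym_nbhd (cayley x) d \<Longrightarrow> y \<in> U \<and> G y = K (cayley y) (cayley (map_option cnj y))"
proof -
  obtain d0 where d0: "0 < d0" "d0 \<le> 1" "\<And>y. cayley y \<in> ball (cayley x) d0 \<Longrightarrow> y \<in> U"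
    using p1_open_contains_cayley_ball assms by metis
  define b where "b = (case x of None \<Rightarrow> 0 | Some t \<Rightarrow> t)"
  define k where "k = (case x of None \<Rightarrow> at_inf_chart G | Some t \<Rightarrow> (\<lambda>w. G (Some w)))"
  have "cnj b = b" using assms(4) by (auto simp: b_def p1R_def)
  have "real_analytic_at k b"
    using assms(2,3) by (cases x) (auto simp: p1_real_analytic_on_def k_def b_def)
  then obtain f e where f: "e > 0" "hol2 f (ball b e \<times> ball b e)"
    "\<And>z. z \<in> ball b e \<Longrightarrow> k z = f z (cnj z)"
    using real_analytic_at_imp_hol2 \<open>cnj b = b\<close> by metis
  obtain \<psi> d where \<psi>: "0 < d" "d \<le> 1" "\<psi> holomorphic_on ball (cayley x) d"
    "\<And>s. s \<in> ball (cayley x) d \<Longrightarrow> \<psi> s \<in> ball b e"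
    "\<And>s. s \<in> ball (cayley x) d \<Longrightarrow> \<psi> s = (case x of None \<Rightarrow> inf_chart s | Some t \<Rightarrow> icay s)"
    "1 \<in> ball (cayley x) d \<Longrightarrow> x = None"
    using cayley_chart[OF assms(4) f(1), folded b_def] by metis
  have kG: "k (\<psi> s) = G (inv_cayley s)" if "s \<in> ball (cayley x) d" for s
  proof (cases x)
    case None
    then have "s \<noteq> -1" using that \<psi>(2) by (auto simp: dist_norm)
    then show ?thesis using None \<psi>(5)[OF that] at_inf_chart_inf_chart by (simp add: k_def)
  next
    case (Some t)
    then have "s \<noteq> 1" using that \<psi>(6) by auto
    then show ?thesis using Some \<psi>(5)[OF that] by (simp add: inv_cayley_def k_def)
  qed
  show thesis
  proof (rule that[of "min d d0" "\<lambda>s p. f (\<psi> s) (\<psi> p)"])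
    let ?B = "ball (cayley x) (min d d0)"
    have fd: "\<psi> field_differentiable at s" if "s \<in> ?B" for s
      by (rule holomorphic_on_imp_differentiable_at[OF \<psi>(3)]) (use that in auto)
    show "hol2 (\<lambda>s p. f (\<psi> s) (\<psi> p)) (?B \<times> ?B)"
      by (rule hol2_compose[OF f(2) hol2_of_fst hol2_of_snd]) (use fd \<psi>(4) in \<open>auto intro: open_Times\<close>)
    fix y assume y: "y \<in> sym_nbhd (cayley x) (min d d0)"
    have yd: "cayley y \<in> ball (cayley x) d" "cayley (map_option cnj y) \<in> ball (cayley x) d"
      using y by (auto simp: sym_nbhd_def)
    have nz: "0 \<notin> ball (cayley x) d"
      using assms(4) p1R_iff_cayley \<psi> by (intro sphere_ball_nonzero) auto
    then have "cayley y \<noteq> 0" using yd by auto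
    from inv_cayley_cayley[OF this] have 1: "G y = k (\<psi> (cayley y))"
      using kG[OF yd(1)] by simp
    have "\<psi> (cayley (map_option cnj y)) = cnj (\<psi> (cayley y))"
    proof (cases y)
      case None
      then have "x = None" using yd \<psi>(6) by simp
      then show ?thesis using None \<psi>(5)[of 1] yd by (simp add: inf_chart_def)
    next
      case (Some z)
      have z: "z \<noteq> -\<i>" "cnj z \<noteq> -\<i>"
        using nz yd Some cay_eq_0[of z] cay_eq_0[of "cnj z"] by auto
      show ?thesis
      proof (cases x)
        case None
        have "z \<noteq> 0" using yd Some None \<psi>(2) by (auto simp: cay_def dist_norm)
        then show ?thesis using \<psi>(5)[OF yd(1)] \<psi>(5)[OF yd(2)] None Some z inf_chart_cay by simp
      next
        case x: (Some t)
        then show ?thesis using \<psi>(5)[OF yd(1)] \<psi>(5)[OF yd(2)] Some z icay_cay by simp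
      qed
    qed
    then have "G y = f (\<psi> (cayley y)) (\<psi> (cayley (map_option cnj y)))"
      using 1 f(3)[OF \<psi>(4)[OF yd(1)]] by simp
    then show "y \<in> U \<and> G y = f (\<psi> (cayley y)) (\<psi> (cayley (map_option cnj y)))"
      using y d0(3) by (auto simp: sym_nbhd_def)
  qed (use \<psi> d0 in auto)
qed

text \<open>The fraction is \<open>cay (1 / w)\<close> with denominators cleared, and its value 1 at
  \<open>w = 0\<close> is the coordinate of infinity.\<close>

lemma at_inf_chart_cayley: "w \<noteq> \<i> \<Longrightarrow> at_inf_chart (\<lambda>x. h (cayley x)) w = h ((1 - \<i> * w) / (1 + \<i> * w))"
proof (cases "w = 0")
  case False
  have "(1 / w - \<i>) = (1 - \<i> * w) / w" "(1 / w + \<i>) = (1 + \<i> * w) / w"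
    using False by (simp_all add: field_simps)
  then show ?thesis using False by (simp add: at_inf_chart_def cay_def)
qed (simp add: at_inf_chart_def)

lemma near_inf_chart:
  obtains e where "e > 0" "\<And>w. w \<in> ball 0 e \<Longrightarrow> 1 + \<i> * w \<noteq> 0 \<and> w \<noteq> \<i>"
proof (rule that[of 1])
  fix w :: complex assume w: "w \<in> ball 0 1"
  then show "1 + \<i> * w \<noteq> 0 \<and> w \<noteq> \<i>"
    by (auto simp: add_eq_0_iff dest: arg_cong[of _ _ norm] simp: norm_mult)
qed simp

lemma p1_holomorphic_on_cayley:
  assumes "open V" "0 \<notin> V" "h holomorphic_on V"
  shows "p1_holomorphic_on (\<lambda>x. h (cayley x)) {x. cayley x \<in> V}"
  unfolding p1_holomorphic_on_def
proof (intro conjI impI)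
  have "-\<i> \<notin> {z. cay z \<in> V}" using assms(2) by (simp add: cay_def)
  then have "(h \<circ> cay) holomorphic_on {z. cay z \<in> V}"
    by (intro holomorphic_on_compose_gen[OF cay_holomorphic assms(3)]) auto
  then show "(\<lambda>w. h (cayley (Some w))) holomorphic_on {z. Some z \<in> {x. cayley x \<in> V}}"
    by (simp add: o_def)
  assume "None \<in> {x. cayley x \<in> V}"
  then have 1: "1 \<in> V" by simp
  let ?m = "\<lambda>w. (1 - \<i> * w) / (1 + \<i> * w)"
  obtain e where e: "e > 0" "\<And>w. w \<in> ball 0 e \<Longrightarrow> 1 + \<i> * w \<noteq> 0 \<and> w \<noteq> \<i>"
    using near_inf_chart by blast
  have m: "?m holomorphic_on ball 0 e" using e by (auto intro!: holomorphic_intros)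
  let ?O = "?m -` V \<inter> ball 0 e"
  have "open ?O"
    using holomorphic_on_imp_continuous_on[OF m] assms(1) by (simp add: continuous_on_open_vimage)
  moreover have "0 \<in> ?O" using 1 e by simp
  moreover have "(h \<circ> ?m) holomorphic_on ?O"
    by (rule holomorphic_on_compose_gen[OF holomorphic_on_subset[OF m] assms(3)]) auto
  then have "at_inf_chart (\<lambda>x. h (cayley x)) holomorphic_on ?O"
    by (rule holomorphic_transform) (use e at_inf_chart_cayley[of _ h] in auto)
  ultimately show "at_inf_chart (\<lambda>x. h (cayley x)) analytic_on {0}"
    using analytic_at by blast
qed

text \<open>Composing \<open>K\<close> with \<open>cay\<close> in each variable separately gives a
  \<open>hol2\<close> function, whose antidiagonal restriction is real-analytic. At infinity the
  Moebius map \<open>?m\<close> takes the place of \<open>cay\<close>; conjugating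
  \<open>1 / w\<close> amounts to conjugating \<open>w\<close>.\<close>

lemma p1_real_analytic_on_cayley:
  assumes "hol2 K S" "p1_open U"
    "\<And>x. x \<in> U \<Longrightarrow> (cayley x, cayley (map_option cnj x)) \<in> S \<and> cayley x \<noteq> 0"
  shows "p1_real_analytic_on (\<lambda>x. K (cayley x) (cayley (map_option cnj x))) U"
  unfolding p1_real_analytic_on_def
proof (intro conjI impI allI)
  fix z assume z: "Some z \<in> U"
  let ?A = "{w. Some w \<in> U}"
  have A: "w \<noteq> -\<i>" "cnj w \<noteq> -\<i>" if "Some w \<in> U" for w
  proof -
    have "w \<noteq> \<i>" "w \<noteq> -\<i>" using assms(3)[OF that] cay_eq_0[of w] by auto
    then show "w \<noteq> -\<i>" "cnj w \<noteq> -\<i>" by (auto simp: complex_eq_iff)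
  qed
  let ?T = "(\<lambda>p. (cay (fst p), cay (snd p))) -` S \<inter> ((- {-\<i>}) \<times> (- {-\<i>}))"
  have "continuous_on ((- {-\<i>}) \<times> (- {-\<i>})) (\<lambda>p. (cay (fst p), cay (snd p)))"
    by (intro continuous_on_Pair continuous_on_compose2[OF holomorphic_on_imp_continuous_on[OF cay_holomorphic[of "- {-\<i>}"]]]
        continuous_intros) auto
  then have T: "open ?T"
    using hol2_open[OF assms(1)] by (simp add: continuous_on_open_vimage open_Times open_Compl)
  have "hol2 (\<lambda>z w. K (cay z) (cay w)) ?T"
    by (rule hol2_compose[OF assms(1) hol2_of_fst[OF T] hol2_of_snd[OF T]])
      (use cay_has_derivative in \<open>auto simp: field_differentiable_def\<close>)
  from hol2_imp_real_analytic_at[OF this, of z] A[OF z] assms(3)[OF z]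
  show "real_analytic_at (\<lambda>w. K (cayley (Some w)) (cayley (map_option cnj (Some w)))) z" by simp
next
  assume N: "None \<in> U"
  let ?m = "\<lambda>w. (1 - \<i> * w) / (1 + \<i> * w)"
  obtain e where e: "e > 0" "\<And>w. w \<in> ball 0 e \<Longrightarrow> 1 + \<i> * w \<noteq> 0 \<and> w \<noteq> \<i>"
    using near_inf_chart by blast
  have m: "?m holomorphic_on ball 0 e" using e by (auto intro!: holomorphic_intros)
  let ?B = "ball (0::complex) e"
  let ?T = "(\<lambda>p. (?m (fst p), ?m (snd p))) -` S \<inter> (?B \<times> ?B)"
  have "continuous_on (?B \<times> ?B) (\<lambda>p. (?m (fst p), ?m (snd p)))"
    by (intro continuous_on_Pair continuous_on_compose2[OF holomorphic_on_imp_continuous_on[OF m]]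
        continuous_intros) auto
  then have T: "open ?T"
    using hol2_open[OF assms(1)] by (simp add: continuous_on_open_vimage open_Times)
  have "hol2 (\<lambda>z w. K (?m z) (?m w)) ?T"
    by (rule hol2_compose[OF assms(1) hol2_of_fst[OF T] hol2_of_snd[OF T]])
      (use holomorphic_on_imp_differentiable_at[OF m] in auto)
  moreover have "(0, cnj 0) \<in> ?T" using assms(3)[OF N] e(1) by simp
  ultimately have "real_analytic_at (\<lambda>w. K (?m w) (?m (cnj w))) 0"
    by (rule hol2_imp_real_analytic_at)
  then show "real_analytic_at (at_inf_chart (\<lambda>x. K (cayley x) (cayley (map_option cnj x)))) 0"
  proof (rule real_analytic_at_cong)
    show "open ?B" "0 \<in> ?B" using e by auto
    fix w assume w: "w \<in> ?B"
    then have w': "cnj w \<in> ?B" by (simp add: dist_norm)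
    have "at_inf_chart (\<lambda>x. K (cayley x) c) w = K (?m w) c" for c
      using at_inf_chart_cayley[of w "\<lambda>s. K s c"] e(2)[OF w] by simp
    moreover have "at_inf_chart (\<lambda>x. cayley (map_option cnj x)) w = at_inf_chart cayley (cnj w)"
      by (simp add: at_inf_chart_def)
    then have "at_inf_chart (\<lambda>x. cayley (map_option cnj x)) w = ?m (cnj w)"
      using at_inf_chart_cayley[of "cnj w" "\<lambda>s. s"] e(2)[OF w'] by simp
    ultimately show "at_inf_chart (\<lambda>x. K (cayley x) (cayley (map_option cnj x))) w = K (?m w) (?m (cnj w))"
      by (simp add: at_inf_chart_def split: if_splits)
  qed
qed

section \<open>The differential equation in Cayley coordinates\<close>

text \<open>Writing \<open>F = f_r * K(u, p)\<close> with \<open>u = cay z\<close> and \<open>p = cay (cnj z)\<close>, the function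
  \<open>F\<close> is \<open>r\<close>-harmonic iff \<open>ode_op r K\<close> does not depend on \<open>u\<close>.\<close>

definition ode_op :: "complex \<Rightarrow> (complex \<Rightarrow> complex \<Rightarrow> complex) \<Rightarrow> complex \<Rightarrow> complex \<Rightarrow> complex" where
  "ode_op r K u p = (1 - p / u) * deriv (K u) p + (r - 1) / p * K u p"

lemma cay_differentiable: "z \<noteq> -\<i> \<Longrightarrow> cay field_differentiable at z"
  using cay_has_derivative field_differentiable_def by blast

lemma hol2_ode_op:
  assumes "hol2 K S" "\<And>u p. (u, p) \<in> S \<Longrightarrow> u \<noteq> 0 \<and> p \<noteq> 0"
  shows "hol2 (ode_op r K) S"
proof -
  have "hol2 (\<lambda>u p. (1 - p / u) * deriv (K u) p + (r - 1) / p * K u p) S"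
    using assms(2) by (intro hol2_add hol2_mult hol2_diff hol2_divide hol2_const hol2_fst hol2_snd
        hol2_deriv2 assms(1) hol2_open[OF assms(1)]) auto
  then show ?thesis by (simp add: ode_op_def[abs_def])
qed

lemma has_field_derivative_powr_chain:
  fixes b :: "complex \<Rightarrow> complex"
  assumes "(b has_field_derivative b') (at x)" "b x \<notin> \<real>\<^sub>\<le>\<^sub>0"
  shows "((\<lambda>x. b x powr s) has_field_derivative s * b' / b x * b x powr s) (at x)"
proof -
  have "b x \<noteq> 0" using assms(2) by auto
  have "((\<lambda>x. b x powr s) has_field_derivative s * b x powr (s - 1) * b') (at x)"
    by (rule DERIV_chain2[OF has_field_derivative_powr[OF assms(2)] assms(1)])
  also have "s * b x powr (s - 1) * b' = s * b' / b x * b x powr s"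
    using \<open>b x \<noteq> 0\<close> by (simp add: powr_diff)
  finally show ?thesis .
qed

text \<open>If the quotient were a real \<open>l \<le> 0\<close>, comparing imaginary parts would
  make the negative number \<open>Im w - 1\<close> equal to
  \<open>l * (Im w - Im z) \<ge> 0\<close>. Hence the principal power in \<open>f_r\<close> extends
  holomorphically when the conjugate is replaced by any \<open>w\<close> in the lower
  half-plane.\<close>

lemma kernel_base:
  assumes "Im z > 0" "Im w < 0"
  shows "(w - \<i>) / (w - z) \<notin> \<real>\<^sub>\<le>\<^sub>0" "w \<noteq> z" "w \<noteq> \<i>"
proof -
  show wz: "w \<noteq> z" and "w \<noteq> \<i>" using assms by auto
  show "(w - \<i>) / (w - z) \<notin> \<real>\<^sub>\<le>\<^sub>0"
  proof
    assume "(w - \<i>) / (w - z) \<in> \<real>\<^sub>\<le>\<^sub>0"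
    then obtain l where l: "l \<le> 0" "(w - \<i>) / (w - z) = of_real l"
      by (elim nonpos_Reals_cases) auto
    then have "w - \<i> = of_real l * (w - z)" using wz by (simp add: field_simps)
    then have "Im w - 1 = l * (Im w - Im z)" by (simp add: complex_eq_iff)
    moreover have "l * (Im w - Im z) \<ge> 0"
      using l(1) assms by (intro mult_nonpos_nonpos) auto
    ultimately show False using assms by simp
  qed
qed

text \<open>The derivative in \<open>w\<close> of the complexified \<open>F\<close> is an elementary
  factor times \<open>ode_op r K\<close>. In the second-order equation the terms without a
  derivative of \<open>ode_op r K\<close> cancel, and what remains is its derivative in
  \<open>u\<close> times a factor without zeros.\<close>

lemma r_harmonic_operator:
  assumes K: "hol2 K S" and V: "open V" "\<And>z. z \<in> V \<Longrightarrow> 0 < Im z \<and> z \<noteq> \<i> \<and> (cay z, cay (cnj z)) \<in> S"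
    and F: "\<And>z. z \<in> V \<Longrightarrow> F z = f_r r z * K (cay z) (cay (cnj z))"
  shows "C2_on V F"
    and "z \<in> V \<Longrightarrow> - 4 * complex_of_real (Im z) ^ 2 * d_z (d_zbar F) z
           + 2 * \<i> * r * complex_of_real (Im z) * d_zbar F z = 0 \<longleftrightarrow>
         deriv (\<lambda>u. ode_op r K u (cay (cnj z))) (cay z) = 0"
proof -
  let ?A = "{z. Im z > 0} \<inter> (- {\<i>})" and ?B = "{w. Im w < 0} \<inter> (- {-\<i>})"
  \<comment> \<open>\<open>ode_op\<close> divides by both coordinates, so the two axes are
    removed.\<close>
  let ?S = "S \<inter> ((- {0}) \<times> (- {0}))"
  define T where "T = (\<lambda>p. (cay (fst p), cay (snd p))) -` S \<inter> (?A \<times> ?B)"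
  have AB: "open (?A \<times> ?B)"
    by (intro open_Times open_Int open_halfspace_Im_gt open_halfspace_Im_lt open_Compl closed_singleton)
  have ni: "-\<i> \<notin> ?A" by simp
  have "continuous_on (?A \<times> ?B) (\<lambda>p. (cay (fst p), cay (snd p)))"
    by (intro continuous_on_Pair continuous_on_compose2[OF holomorphic_on_imp_continuous_on[OF cay_holomorphic[of ?A]]]
       continuous_on_compose2[OF holomorphic_on_imp_continuous_on[OF cay_holomorphic[of ?B]]]
        continuous_intros) auto
  then have T: "open T"
    unfolding T_def using hol2_open[OF K] continuous_on_open_vimage[OF AB] by blast
  have Tz: "Im z > 0" "z \<noteq> \<i>" "z \<noteq> -\<i>" "Im w < 0" "w \<noteq> \<i>" "w \<noteq> -\<i>" "z \<noteq> w" "(cay z, cay w) \<in> ?S"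
     "(w - \<i>) / (w - z) \<notin> \<real>\<^sub>\<le>\<^sub>0"
    if zw: "(z, w) \<in> T" for z w
  proof -
    show *: "Im z > 0" "z \<noteq> \<i>" "Im w < 0" "w \<noteq> -\<i>" using zw by (auto simp: T_def)
    show "z \<noteq> -\<i>" "w \<noteq> \<i>" "z \<noteq> w" using *(1,3) by auto
    then show "(cay z, cay w) \<in> ?S" using zw * by (auto simp: T_def cay_eq_0)
    show "(w - \<i>) / (w - z) \<notin> \<real>\<^sub>\<le>\<^sub>0" using kernel_base * by blast
  qed
  have nd: "(z, z) \<notin> T" for z using Tz(7) by blast
  have VT: "(z, cnj z) \<in> T" if "z \<in> V" for z
    using V(2)[OF that] by (auto simp: T_def complex_eq_iff)
  have cay1: "hol2 (\<lambda>z w. cay z) T" and cay2: "hol2 (\<lambda>z w. cay w) T"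
    by (rule hol2_of_fst[OF T cay_differentiable[OF Tz(3)]], assumption,
        rule hol2_of_snd[OF T cay_differentiable[OF Tz(6)]], assumption)
  define \<phi> where "\<phi> z w = ((w - \<i>) / (w - z)) powr (r - 1)" for z w
  have \<phi>: "hol2 \<phi> T"
    unfolding \<phi>_def[abs_def] using Tz(9) nd
    by (intro hol2_powr hol2_divide hol2_diff hol2_fst hol2_snd hol2_const T) auto
  define N where "N = ode_op r K"
  have N: "hol2 N ?S"
    unfolding N_def using hol2_open[OF K]
    by (intro hol2_ode_op hol2_subset[OF K] open_Int open_Times open_Compl) auto
  let ?f = "\<lambda>z w. 2 * \<i> / (z - \<i>) * \<phi> z w * K (cay z) (cay w)"
  have f: "hol2 ?f T"
    by (intro hol2_mult hol2_divide hol2_diff hol2_const hol2_fst hol2_compose[OF K cay1 cay2] T \<phi>)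
      (use Tz nd in auto)
  \<comment> \<open>This is the derivative of \<open>?f\<close> in \<open>w\<close>, as
    \<open>fg\<close> confirms. All dependence on \<open>K\<close> sits in \<open>N\<close>, so the
    second derivative can be taken directly from this form.\<close>
  let ?g = "\<lambda>z w. (1 - cay w) * \<phi> z w / (z - w) * N (cay z) (cay w)"
  have g: "hol2 ?g T"
    by (intro hol2_mult hol2_divide hol2_diff hol2_const hol2_fst hol2_snd hol2_compose[OF N cay1 cay2] cay2 T \<phi>)
      (use Tz nd in auto)
  have Ff: "(z, cnj z) \<in> T \<and> F z = ?f z (cnj z)" if "z \<in> V" for z
    using VT[OF that] F[OF that] by (simp add: \<phi>_def f_r_def)
  show "C2_on V F" by (rule hol2_C2_on[OF f V(1) Ff])
  have fg: "deriv (?f z) w = ?g z w" if "(z, w) \<in> T" for z w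
  proof -
    note zw = Tz[OF that]
    let ?u = "cay z" and ?p = "cay w"
    have nz: "z - \<i> \<noteq> 0" "z + \<i> \<noteq> 0" "w - \<i> \<noteq> 0" "w + \<i> \<noteq> 0" "w - z \<noteq> 0" "z - w \<noteq> 0"
      using zw by (auto simp: eq_neg_iff_add_eq_0)
    have "((\<lambda>w. (w - \<i>) / (w - z)) has_field_derivative
        ((1 - 0) * (w - z) - (w - \<i>) * (1 - 0)) / ((w - z) * (w - z))) (at w)"
      by (intro DERIV_divide DERIV_diff DERIV_ident DERIV_const nz)
    from has_field_derivative_powr_chain[OF this zw(9), of "r - 1"]
    have d\<phi>: "((\<lambda>w. \<phi> z w) has_field_derivative (r - 1) * (\<i> - z) / ((w - z) * (w - \<i>)) * \<phi> z w) (at w)"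
      unfolding \<phi>_def using nz by simp
    have "(K ?u has_field_derivative deriv (K ?u) ?p) (at ?p)"
      by (rule field_differentiable_derivI[OF hol2_fd2[OF K]]) (use zw in auto)
    from DERIV_chain2[OF this cay_has_derivative[OF zw(6)]]
    have dK: "((\<lambda>w. K ?u (cay w)) has_field_derivative deriv (K ?u) ?p * (2 * \<i> / (w + \<i>)\<^sup>2)) (at w)" .
    have e1: "1 - ?p = 2 * \<i> / (w + \<i>)" using nz by (simp add: cay_def field_simps)
    have e2: "(1 - ?p) / ?p = 2 * \<i> / (w - \<i>)" unfolding e1 using nz by (simp add: cay_def)
    have e3: "1 - ?p / ?u = 2 * \<i> * (z - w) / ((z - \<i>) * (w + \<i>))"
      using nz by (simp add: cay_def divide_simps) (simp add: algebra_simps)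
    have "deriv (?f z) w = 2 * \<i> / (z - \<i>) * (((r - 1) * (\<i> - z) / ((w - z) * (w - \<i>)) * \<phi> z w) * K ?u ?p
       + deriv (K ?u) ?p * (2 * \<i> / (w + \<i>)\<^sup>2) * \<phi> z w)"
      using DERIV_imp_deriv[OF DERIV_cmult[OF DERIV_mult[OF d\<phi> dK], of "2 * \<i> / (z - \<i>)"]]
      by (simp add: mult.assoc)
    also have "\<dots> = (r - 1) * \<phi> z w / (z - w) * K ?u ?p * (2 * \<i> / (w - \<i>))
       + \<phi> z w * deriv (K ?u) ?p * (2 * \<i> / (w + \<i>)) * (2 * \<i> / ((z - \<i>) * (w + \<i>)))"
    proof -
      have eA: "2 * \<i> / (z - \<i>) * ((r - 1) * (\<i> - z) / ((w - z) * (w - \<i>))) = (r - 1) / (z - w) * (2 * \<i> / (w - \<i>))"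
        using nz by (simp add: divide_simps) (simp add: algebra_simps)
      have eB: "2 * \<i> / (z - \<i>) * (2 * \<i> / (w + \<i>)\<^sup>2) = (2 * \<i> / (w + \<i>)) * (2 * \<i> / ((z - \<i>) * (w + \<i>)))"
        by (simp add: power2_eq_square)
      have gen: "a * (b * f * k + k' * c * f) = (a * b) * (f * k) + (a * c) * (f * k')" for a b c f k k' :: complex
        by (simp only: distrib_left mult_ac)
      show ?thesis by (subst gen, subst eA, subst eB) (simp add: mult_ac)
    qed
    also have "\<dots> = (r - 1) * \<phi> z w / (z - w) * K ?u ?p * ((1 - ?p) / ?p)
       + \<phi> z w * deriv (K ?u) ?p * (1 - ?p) * ((1 - ?p / ?u) / (z - w))"
    proof -
      have e3': "(1 - ?p / ?u) / (z - w) = 2 * \<i> / ((z - \<i>) * (w + \<i>))"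
        unfolding e3 using nz by simp
      show ?thesis by (simp only: e1[symmetric] e2[symmetric] e3'[symmetric])
    qed
    also have "\<dots> = ?g z w"
      by (simp only: N_def ode_op_def divide_inverse distrib_left mult_ac add_ac)
    finally show ?thesis .
  qed
  have E: "(z, cnj z) \<in> T \<and> d_zbar F z = ?g z (cnj z)" if "z \<in> V" for z
    using hol2_partials(4)[OF f V(1) Ff that] fg VT[OF that] by simp
  assume z: "z \<in> V"
  define w where "w = cnj z"
  have zT: "(z, w) \<in> T" unfolding w_def by (rule VT[OF z])
  note zw = Tz[OF zT]
  have nz: "z + \<i> \<noteq> 0" "w - \<i> \<noteq> 0" "w - z \<noteq> 0" "z - w \<noteq> 0"
    using zw by (auto simp: eq_neg_iff_add_eq_0)
  let ?u = "cay z" and ?p = "cay w"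
  define N' where "N' = deriv (\<lambda>u. N u ?p) ?u"
  have "((\<lambda>z. (w - \<i>) / (w - z)) has_field_derivative
      (0 * (w - z) - (w - \<i>) * (0 - 1)) / ((w - z) * (w - z))) (at z)"
    by (intro DERIV_divide DERIV_diff DERIV_ident DERIV_const nz)
  from has_field_derivative_powr_chain[OF this zw(9), of "r - 1"]
  have d\<phi>: "((\<lambda>z. \<phi> z w) has_field_derivative (r - 1) / (w - z) * \<phi> z w) (at z)"
    using nz by (simp add: \<phi>_def)
  have "((\<lambda>u. N u ?p) has_field_derivative N') (at ?u)"
    unfolding N'_def by (rule field_differentiable_derivI[OF hol2_fd1[OF N]]) (use zw in auto)
  from DERIV_chain2[OF this cay_has_derivative[OF zw(3)]]
  have dN: "((\<lambda>z. N (cay z) ?p) has_field_derivative N' * (2 * \<i> / (z + \<i>)\<^sup>2)) (at z)" .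
  have dD: "((\<lambda>z. \<phi> z w / (z - w)) has_field_derivative
     ((r - 1) / (w - z) * \<phi> z w * (z - w) - \<phi> z w * (1 - 0)) / ((z - w) * (z - w))) (at z)"
    by (intro DERIV_divide DERIV_diff DERIV_ident DERIV_const nz d\<phi>)
  have "d_z (d_zbar F) z = deriv (\<lambda>z. ?g z w) z"
    using hol2_partials(3)[OF g V(1) E z] by (simp add: w_def)
  also have "\<dots> = (1 - ?p) * (((r - 1) / (w - z) * \<phi> z w * (z - w) - \<phi> z w * (1 - 0)) / ((z - w) * (z - w)) * N ?u ?p
     + N' * (2 * \<i> / (z + \<i>)\<^sup>2) * (\<phi> z w / (z - w)))"
    using DERIV_imp_deriv[OF DERIV_cmult[OF DERIV_mult[OF dD dN], of "1 - ?p"]]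
    by (simp add: mult.assoc)
  \<comment> \<open>The power contributes \<open>-(r - 1)\<close> and the denominator -1. Their sum
    \<open>-r\<close> is what the first-order term of the equation cancels.\<close>
  also have "(r - 1) / (w - z) * \<phi> z w * (z - w) - \<phi> z w * (1 - 0) = - r * \<phi> z w"
    using nz by (simp add: divide_simps) (simp add: algebra_simps)
  finally have D: "d_z (d_zbar F) z = (1 - ?p) * (- r * \<phi> z w / ((z - w) * (z - w)) * N ?u ?p
     + N' * (2 * \<i> / (z + \<i>)\<^sup>2) * (\<phi> z w / (z - w)))" .
  have E': "d_zbar F z = ?g z w" using E[OF z] by (simp add: w_def)
  \<comment> \<open>On the antidiagonal this turns \<open>-4 * y ^ 2\<close> into
    \<open>(z - w) ^ 2\<close> and \<open>2 * \<i> * y\<close> into \<open>z - w\<close>, so no real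
    coordinate is left in the equation.\<close>
  have y: "2 * \<i> * complex_of_real (Im z) = z - w" by (simp add: w_def complex_eq_iff)
  have "- 4 * complex_of_real (Im z) ^ 2 = (2 * \<i> * complex_of_real (Im z)) ^ 2"
    by (simp add: power_mult_distrib)
  then have "- 4 * complex_of_real (Im z) ^ 2 * d_z (d_zbar F) z
           + 2 * \<i> * r * complex_of_real (Im z) * d_zbar F z
     = (z - w)\<^sup>2 * d_z (d_zbar F) z + r * (z - w) * d_zbar F z"
    using y by (simp add: mult_ac)
  also have "\<dots> = ((1 - ?p) * \<phi> z w * (z - w) * (2 * \<i> / (z + \<i>)\<^sup>2)) * N'"
  proof -
    have "x\<^sup>2 * (q * (- r * f / (x * x) * n + k * (f / x))) + r * x * (q * f / x * n) = q * f * x * k"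
      if "x \<noteq> 0" for x q f n k :: complex
      using that by (simp add: field_simps power2_eq_square)
    from this[OF nz(4), of "1 - ?p" "\<phi> z w" "N ?u ?p" "N' * (2 * \<i> / (z + \<i>)\<^sup>2)"]
    show ?thesis unfolding D E' by (simp only: mult_ac)
  qed
  finally have eq: "- 4 * complex_of_real (Im z) ^ 2 * d_z (d_zbar F) z
           + 2 * \<i> * r * complex_of_real (Im z) * d_zbar F z
     = ((1 - ?p) * \<phi> z w * (z - w) * (2 * \<i> / (z + \<i>)\<^sup>2)) * N'" .
  have "\<phi> z w \<noteq> 0" using nz by (simp add: \<phi>_def)
  then have "(1 - ?p) * \<phi> z w * (z - w) * (2 * \<i> / (z + \<i>)\<^sup>2) \<noteq> 0"
    using nz cay_neq_1[of w] by simp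
  then show "- 4 * complex_of_real (Im z) ^ 2 * d_z (d_zbar F) z
           + 2 * \<i> * r * complex_of_real (Im z) * d_zbar F z = 0 \<longleftrightarrow>
         deriv (\<lambda>u. ode_op r K u (cay (cnj z))) (cay z) = 0"
    unfolding eq by (simp add: N'_def N_def w_def)
qed

section \<open>Continuation from the antidiagonal to the bidisc\<close>

lemma hol2_zero_extend:
  assumes f: "hol2 f (A \<times> B)" and "connected A" "connected B" "open A" "open B"
    and A0: "open A0" "a \<in> A0" "A0 \<subseteq> A" and B0: "open B0" "b \<in> B0" "B0 \<subseteq> B"
    and zero: "\<And>x y. x \<in> A0 \<Longrightarrow> y \<in> B0 \<Longrightarrow> f x y = 0" and xy: "x \<in> A" "y \<in> B"
  shows "f x y = 0"
proof -
  have 1: "f x y = 0" if "x \<in> A" "y \<in> B0" for x y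
    by (rule analytic_continuation_open[of A0 A "\<lambda>x. f x y" "\<lambda>_. 0"])
      (use that assms in \<open>auto intro!: hol2_slice1[OF f]\<close>)
  show ?thesis
    by (rule analytic_continuation_open[of B0 B "f x" "\<lambda>_. 0"])
      (use 1 xy assms in \<open>auto intro!: hol2_slice2[OF f]\<close>)
qed

lemma sphere_radial_point:
  assumes "norm c = 1" "0 < d"
  obtains u where "norm u < 1" "u \<noteq> 0" "u \<in> ball c d" "1 / cnj u \<in> ball c d"
proof -
  \<comment> \<open>The reflection of \<open>t * c\<close> is \<open>c / t\<close>, and
    \<open>1 / t - 1\<close> is half of \<open>min d 1\<close>; the inner point is closer to
    \<open>c\<close> than the outer one.\<close>
  define t where "t = 1 / (1 + min d 1 / 2)"
  have t: "0 < t" "t < 1" "1 / t - 1 < d" "1 - t < d"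
    using assms(2) by (auto simp: t_def field_simps min_def intro!: add_pos_pos mult_pos_pos)
  let ?u = "of_real t * c"
  have "c * cnj c = 1" using assms(1) by (simp add: complex_norm_square[symmetric])
  then have "cnj c \<noteq> 0" "1 / cnj c = c" by (auto simp: divide_eq_eq)
  moreover have "1 / cnj ?u = of_real (1 / t) * (1 / cnj c)" by simp
  ultimately have inv: "1 / cnj ?u = of_real (1 / t) * c" by metis
  show thesis
  proof (rule that[of ?u])
    have "c \<noteq> 0" using assms(1) by auto
    then show "norm ?u < 1" "?u \<noteq> 0" using t assms(1) by (auto simp: norm_mult)
    have dc: "dist c (of_real s * c) = \<bar>1 - s\<bar>" for s
    proof -
      have "c - of_real s * c = of_real (1 - s) * c" by (simp add: algebra_simps)
      then show ?thesis using assms(1) by (simp only: dist_norm norm_mult norm_of_real) simp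
    qed
    show "?u \<in> ball c d" "1 / cnj ?u \<in> ball c d"
      unfolding inv mem_ball dc using t by (auto simp: abs_if)
  qed
qed

lemma upper_sym_nbhd:
  assumes "norm c = 1" "d \<le> 1" "Some z \<in> sym_nbhd c d" "Im z > 0"
  shows "z \<noteq> \<i>" "z \<noteq> -\<i>" "(cay z, cay (cnj z)) \<in> ball c d \<times> ball c d"
proof -
  have "cay z \<in> ball c d" "cay (cnj z) \<in> ball c d" using assms(3) by (auto simp: sym_nbhd_def)
  moreover have "0 \<notin> ball c d" using assms sphere_ball_nonzero by blast
  ultimately have "cay z \<noteq> 0" by metis
  then show "z \<noteq> \<i>" "z \<noteq> -\<i>" by (auto simp: cay_eq_0)
  show "(cay z, cay (cnj z)) \<in> ball c d \<times> ball c d"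
    using \<open>cay z \<in> ball c d\<close> \<open>cay (cnj z) \<in> ball c d\<close> by simp
qed

lemma open_upper_part: "p1_open U \<Longrightarrow> open (upper_part U)"
proof -
  assume "p1_open U"
  moreover have "upper_part U = {z. Some z \<in> U} \<inter> {z. Im z > 0}" by (auto simp: upper_part_def)
  ultimately show ?thesis by (simp add: p1_open_def open_Int open_halfspace_Im_gt)
qed

lemma r_harmonic_imp_ode:
  assumes c: "norm c = 1" and d: "0 < d" "d \<le> 1" and K: "hol2 K (ball c d \<times> ball c d)"
    and F: "\<And>z. z \<in> upper_part (sym_nbhd c d) \<Longrightarrow> F z = f_r r z * K (cay z) (cay (cnj z))"
    and harm: "\<And>z. z \<in> upper_part (sym_nbhd c d) \<Longrightarrow> - 4 * complex_of_real (Im z) ^ 2 * d_z (d_zbar F) z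
           + 2 * \<i> * r * complex_of_real (Im z) * d_zbar F z = 0"
    and up: "u \<in> ball c d" "p \<in> ball c d"
  shows "ode_op r K u p = (r - 1) / p * K p p"
proof -
  let ?B = "ball c d" and ?V = "upper_part (sym_nbhd c d)"
  have nz: "0 \<notin> ?B" using c d sphere_ball_nonzero by blast
  have N: "hol2 (ode_op r K) (?B \<times> ?B)" by (rule hol2_ode_op[OF K]) (use nz in auto)
  define D where "D u p = deriv (\<lambda>u. ode_op r K u p) u" for u p
  have D: "hol2 D (?B \<times> ?B)" unfolding D_def[abs_def] by (rule hol2_deriv1[OF N])
  have V: "open ?V" by (intro open_upper_part p1_open_sym_nbhd c d)
  have D0: "D (cay z) (cay (cnj z)) = 0" if "z \<in> ?V" for z
    unfolding D_def
    by (subst r_harmonic_operator(2)[OF K V _ F that, symmetric])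
      (use upper_sym_nbhd[OF c d(2)] harm that in \<open>auto simp: upper_part_def\<close>)
  \<comment> \<open>The equation is known only for \<open>Im z > 0\<close>, that is, inside the
    disc. The continuation therefore starts at an interior point whose reflection lies in the same
    ball.\<close>
  obtain u0 where u0: "norm u0 < 1" "u0 \<noteq> 0" "u0 \<in> ?B" "1 / cnj u0 \<in> ?B"
    using sphere_radial_point[OF c d(1)] by blast
  define z0 where "z0 = icay u0"
  have "u0 \<noteq> 1" using u0 by auto
  then have z0u: "cay z0 = u0" by (simp add: z0_def cay_icay)
  then have z0i: "z0 \<noteq> \<i>" "z0 \<noteq> -\<i>" using u0 cay_eq_0[of z0] by auto
  then have cz0: "cay (cnj z0) = 1 / cnj u0" using cay_cnj z0u by simp
  have z0V: "z0 \<in> ?V"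
    using u0 z0u cz0 norm_cay[OF z0i(2)] by (auto simp: upper_part_def sym_nbhd_def)
  have cn: "cnj z0 \<noteq> -\<i>" using z0i by (auto simp: complex_eq_iff)
  let ?O = "- {-\<i>}"
  have contc: "continuous_on ?O cay" by (intro holomorphic_on_imp_continuous_on cay_holomorphic) auto
  let ?T = "(cay -` ?B \<inter> ?O) \<times> (cay -` ?B \<inter> ?O)"
  have o: "open (cay -` ?B \<inter> ?O)" using contc by (simp add: continuous_on_open_vimage open_Compl)
  \<comment> \<open>In the variable \<open>z\<close> the reflected pairs are the points
    \<open>(z, cnj z)\<close>, the form required by
    \<open>hol2_zero_on_antidiagonal\<close>.\<close>
  have h: "hol2 (\<lambda>z w. D (cay z) (cay w)) ?T"
    by (rule hol2_compose[OF D hol2_of_fst hol2_of_snd])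
      (use o cay_has_derivative in \<open>auto simp: field_differentiable_def intro: open_Times\<close>)
  have "(z0, cnj z0) \<in> ?T" using u0 z0u cz0 z0i cn by simp
  obtain \<epsilon> where "\<epsilon> > 0" "ball z0 \<epsilon> \<subseteq> ?V" using V z0V open_contains_ball by blast
  then obtain e where e: "e > 0" "\<And>z w. z \<in> ball z0 e \<Longrightarrow> w \<in> ball (cnj z0) e \<Longrightarrow> D (cay z) (cay w) = 0"
    using hol2_zero_on_antidiagonal[OF h \<open>(z0, cnj z0) \<in> ?T\<close>, of \<epsilon>] D0 by (metis subsetD)
  have conti: "continuous_on (- {1}) icay" by (intro holomorphic_on_imp_continuous_on icay_holomorphic) auto
  let ?Ob = "\<lambda>b. (icay -` ball b e \<inter> (- {1})) \<inter> ?B"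
  have ob: "open (?Ob b)" for b
    using conti by (intro open_Int[OF _ open_ball]) (simp add: continuous_on_open_vimage open_Compl)
  have "1 / cnj u0 \<noteq> 1" using cz0 cay_neq_1 by metis
  have "D u p = 0" if "u \<in> ?B" "p \<in> ?B" for u p
  proof (rule hol2_zero_extend[OF D _ _ _ _ ob[of z0] _ _ ob[of "cnj z0"]])
    show "u0 \<in> ?Ob z0" using u0 e(1) \<open>u0 \<noteq> 1\<close> by (simp add: z0_def)
    show "1 / cnj u0 \<in> ?Ob (cnj z0)"
      using u0 e(1) \<open>1 / cnj u0 \<noteq> 1\<close> icay_cay[OF cn] cz0 by simp
    fix u p assume u: "u \<in> ?Ob z0" and p: "p \<in> ?Ob (cnj z0)"
    then have "D (cay (icay u)) (cay (icay p)) = 0" by (intro e(2)) auto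
    then show "D u p = 0" using u p cay_icay by simp
  qed (use that in auto)
  then have "((\<lambda>u. ode_op r K u p) has_field_derivative 0) (at u within ?B)" if "u \<in> ?B" for u
    using field_differentiable_derivI[OF hol2_fd1[OF N], of u p] that up(2)
    unfolding D_def by (metis SigmaI has_field_derivative_at_within)
  then obtain k where "\<And>u. u \<in> ?B \<Longrightarrow> ode_op r K u p = k"
    using has_field_derivative_zero_constant[OF convex_ball] by metis
  then have "ode_op r K u p = ode_op r K p p" using up by simp
  also have "\<dots> = (r - 1) / p * K p p" using up nz by (auto simp: ode_op_def)
  finally show ?thesis .
qed

section \<open>Taylor recursion at the singular point\<close>

text \<open>Each differentiation of \<open>(u - p) * deriv T p\<close> produces an additional
  \<open>- deriv T p\<close>, which lowers the constant \<open>s\<close> by one. At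
  \<open>p = u\<close> the highest derivative drops out.\<close>

lemma singular_ode_taylor:
  fixes T R :: "complex \<Rightarrow> complex"
  assumes "open A" "T holomorphic_on A" "R holomorphic_on A"
    and "\<And>p. p \<in> A \<Longrightarrow> (u - p) * deriv T p + s * T p = R p" and "p \<in> A"
  shows "(u - p) * (deriv ^^ Suc k) T p + (s - of_nat k) * (deriv ^^ k) T p = (deriv ^^ k) R p"
  using \<open>p \<in> A\<close>
proof (induction k arbitrary: p)
  case (Suc k)
  let ?T = "\<lambda>k. (deriv ^^ k) T"
  have fd: "((deriv ^^ j) f has_field_derivative (deriv ^^ Suc j) f p) (at p)" if "f holomorphic_on A" for f j
    using holomorphic_derivI[OF holomorphic_higher_deriv[OF that \<open>open A\<close>] \<open>open A\<close> Suc.prems, of j] by simp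
  have "((\<lambda>p. (u - p) * ?T (Suc k) p + (s - of_nat k) * ?T k p) has_field_derivative
     ((0 - 1) * ?T (Suc k) p + ?T (Suc (Suc k)) p * (u - p)) + (s - of_nat k) * ?T (Suc k) p) (at p)"
    by (intro DERIV_add DERIV_mult DERIV_cmult DERIV_diff DERIV_ident DERIV_const fd assms(2))
  moreover have "((\<lambda>p. (u - p) * ?T (Suc k) p + (s - of_nat k) * ?T k p) has_field_derivative
     (deriv ^^ Suc k) R p) (at p)"
    by (rule has_field_derivative_transform_within_open[OF fd[OF assms(3)] \<open>open A\<close> Suc.prems])
      (use Suc.IH in auto)
  ultimately have "((0 - 1) * ?T (Suc k) p + ?T (Suc (Suc k)) p * (u - p)) + (s - of_nat k) * ?T (Suc k) p
     = (deriv ^^ Suc k) R p"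
    by (rule DERIV_unique)
  then show ?case by (simp add: algebra_simps)
qed (use assms in auto)

section \<open>Solutions of the singular equation\<close>

lemma Re_mult_cnj_pos:
  fixes c :: complex
  assumes "norm c = 1" "d \<le> 1" "x \<in> ball c d"
  shows "Re (cnj c * x) > 0"
proof -
  have "cnj c * c = 1" using assms(1) by (simp add: complex_norm_square[symmetric] mult.commute)
  then have "cnj c * x - 1 = cnj c * (x - c)" by (simp add: algebra_simps)
  then have "norm (cnj c * x - 1) < 1"
    using assms by (simp add: norm_mult dist_norm norm_minus_commute)
  then show ?thesis using abs_Re_le_cmod[of "cnj c * x - 1"] by (simp add: abs_if split: if_splits)
qed

text \<open>A ball of radius at most 1 about a point \<open>c\<close> of the unit circle lies in the
  half-plane of points with positive component along \<open>c\<close>, and two points of such a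
  half-plane cannot have a nonpositive real quotient.\<close>

lemma ratio_not_nonpos:
  fixes c :: complex
  assumes "norm c = 1" "d \<le> 1" "u \<in> ball c d" "p \<in> ball c d"
  shows "p / u \<notin> \<real>\<^sub>\<le>\<^sub>0" "u \<noteq> 0" "p \<noteq> 0"
proof -
  have *: "Re (cnj c * u) > 0" "Re (cnj c * p) > 0" using Re_mult_cnj_pos assms by auto
  then show "u \<noteq> 0" "p \<noteq> 0" by auto
  show "p / u \<notin> \<real>\<^sub>\<le>\<^sub>0"
  proof
    assume "p / u \<in> \<real>\<^sub>\<le>\<^sub>0"
    then obtain l where l: "l \<le> 0" "p / u = of_real l" by (elim nonpos_Reals_cases) auto
    then have "p = of_real l * u" using \<open>u \<noteq> 0\<close> nonzero_divide_eq_eq by blast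
    then have "cnj c * p = of_real l * (cnj c * u)" by (simp only: mult_ac)
    moreover have "Re (of_real l * w) = l * Re w" for w by simp
    ultimately have "Re (cnj c * p) = l * Re (cnj c * u)" by metis
    also have "\<dots> \<le> 0" using l(1) * by (simp add: mult_nonpos_nonneg)
    finally show False using * by simp
  qed
qed

lemma ratio_powr_has_derivative:
  fixes p u s :: complex
  assumes "p / u \<notin> \<real>\<^sub>\<le>\<^sub>0"
  shows "((\<lambda>p. (p / u) powr s) has_field_derivative s / p * (p / u) powr s) (at p)"
proof -
  have "u \<noteq> 0" "p \<noteq> 0" using assms by auto
  have "((\<lambda>p. p / u) has_field_derivative 1 / u) (at p)" by (intro DERIV_cdivide DERIV_ident)
  from has_field_derivative_powr_chain[OF this assms, of s] show ?thesis
    using \<open>u \<noteq> 0\<close> \<open>p \<noteq> 0\<close> by simp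
qed

lemma hol2_ratio_powr:
  assumes "norm c = 1" "d \<le> 1"
  shows "hol2 (\<lambda>u p. (p / u) powr s) (ball c d \<times> ball c d)"
  using ratio_not_nonpos[OF assms]
  by (intro hol2_powr hol2_divide hol2_fst hol2_snd) (auto intro: open_Times)

text \<open>Multiplying by \<open>(p/u)\<close> to the power \<open>r - 1\<close> turns the operator into one whose
  coefficients are regular singular at \<open>p = u\<close> only.\<close>

lemma ode_op_twist:
  assumes "p / u \<notin> \<real>\<^sub>\<le>\<^sub>0" "K u field_differentiable at p"
  shows "(u - p) * deriv (\<lambda>p. (p / u) powr (r - 1) * K u p) p + (r - 1) * ((p / u) powr (r - 1) * K u p)
     = (p / u) powr (r - 1) * u * ode_op r K u p"
proof -
  have nz: "u \<noteq> 0" "p \<noteq> 0" using assms by auto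
  have "deriv (\<lambda>p. (p / u) powr (r - 1) * K u p) p
     = (r - 1) / p * (p / u) powr (r - 1) * K u p + deriv (K u) p * (p / u) powr (r - 1)"
    by (intro DERIV_imp_deriv DERIV_mult ratio_powr_has_derivative assms field_differentiable_derivI)
  moreover have "(u - p) * ((r - 1) / p * e * k + k' * e) + (r - 1) * (e * k)
      = e * u * ((1 - p / u) * k' + (r - 1) / p * k)" for e k k'
    using nz by (simp add: field_simps)
  ultimately show ?thesis unfolding ode_op_def by simp
qed

text \<open>Evaluation at \<open>p = u\<close> removes the derivative of order \<open>k + 1\<close>
  from the recursion. The right-hand side is a free \<open>R\<close>, so that the homogeneous
  equation and the one with a boundary value are both covered.\<close>

lemma ode_taylor:
  assumes c: "norm c = 1" "d \<le> 1" and K: "hol2 K (ball c d \<times> ball c d)" and u: "u \<in> ball c d"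
    and R: "R holomorphic_on ball c d"
      "\<And>p. p \<in> ball c d \<Longrightarrow> (p / u) powr (r - 1) * u * ode_op r K u p = R p"
  shows "(r - 1 - of_nat k) * (deriv ^^ k) (\<lambda>p. (p / u) powr (r - 1) * K u p) u = (deriv ^^ k) R u"
proof -
  have "hol2 (\<lambda>u p. (p / u) powr (r - 1) * K u p) (ball c d \<times> ball c d)"
    by (intro hol2_mult hol2_ratio_powr c K)
  then have "(\<lambda>p. (p / u) powr (r - 1) * K u p) holomorphic_on ball c d"
    by (rule hol2_slice2) (use u in auto)
  from singular_ode_taylor[OF open_ball this R(1) _ u, of u "r - 1" k]
  show ?thesis
    using ode_op_twist[of _ u K r] ratio_not_nonpos[OF c u] hol2_fd2[OF K] u R(2) by simp
qed

text \<open>The diagonal condition kills the coefficient of index 0, including the case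
  \<open>r = 1\<close>, where the recursion is silent about it. The recursion kills the others: for
  \<open>k = j + 1\<close> the factor is \<open>r - (j + 2)\<close>. A function on a ball with all
  derivatives zero at one point vanishes.\<close>

lemma ode_unique:
  assumes c: "norm c = 1" "d \<le> 1" and K: "hol2 K (ball c d \<times> ball c d)"
    and ode: "\<And>u p. u \<in> ball c d \<Longrightarrow> p \<in> ball c d \<Longrightarrow> ode_op r K u p = 0"
    and diag: "\<And>u. u \<in> ball c d \<Longrightarrow> K u u = 0"
    and r: "\<And>k::nat. r \<noteq> of_nat k + 2"
    and u: "u \<in> ball c d" and p: "p \<in> ball c d"
  shows "K u p = 0"
proof -
  let ?T = "\<lambda>p. (p / u) powr (r - 1) * K u p"
  have "hol2 (\<lambda>u p. (p / u) powr (r - 1) * K u p) (ball c d \<times> ball c d)"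
    by (intro hol2_mult hol2_ratio_powr c K)
  then have T: "?T holomorphic_on ball c d"
    by (rule hol2_slice2) (use u in auto)
  have "(deriv ^^ k) ?T u = 0" for k
  proof (cases k)
    case 0
    then show ?thesis using diag[OF u] by simp
  next
    case (Suc j)
    have "(r - 1 - of_nat k) * (deriv ^^ k) ?T u = (deriv ^^ k) (\<lambda>_. 0) u"
      by (rule ode_taylor[OF c K u]) (use ode u in auto)
    moreover have "r - 1 - of_nat k \<noteq> 0" using r[of j] Suc by (auto simp: algebra_simps)
    ultimately show ?thesis by simp
  qed
  from holomorphic_fun_eq_0_on_connected[OF T open_ball connected_ball this u p]
  have "?T p = 0" .
  then show ?thesis using ratio_not_nonpos[OF c u p] by auto
qed

lemma powr_nat_diff_1:
  fixes x :: complex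
  assumes "x \<noteq> 0" "n \<ge> 1"
  shows "x powr (of_nat n - 1) = x ^ (n - 1)"
proof -
  have "of_nat n - 1 = (of_nat (n - 1) :: complex)" using assms(2) by (simp add: of_nat_diff)
  then show ?thesis using assms(1) powr_nat' by metis
qed

text \<open>The coefficient \<open>h\<close> is holomorphic because it is the diagonal restriction
  of a higher derivative of a function of two variables. The one-term series represents the solution
  on a small disc about \<open>u\<close>, and analytic continuation extends the identity to the
  ball.\<close>

lemma ode_holomorphic_solution:
  assumes c: "norm c = 1" "d \<le> 1" and K: "hol2 K (ball c d \<times> ball c d)" and n: "n \<ge> 1"
    and ode: "\<And>u p. u \<in> ball c d \<Longrightarrow> p \<in> ball c d \<Longrightarrow> ode_op (of_nat n) K u p = 0"
  obtains h where "h holomorphic_on ball c d"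
    "\<And>u p. u \<in> ball c d \<Longrightarrow> p \<in> ball c d \<Longrightarrow> (p / u) ^ (n - 1) * K u p = h u * (p - u) ^ (n - 1)"
proof -
  let ?T = "\<lambda>u p. (p / u) powr (of_nat n - 1) * K u p"
  have T: "hol2 ?T (ball c d \<times> ball c d)"
    by (intro hol2_mult hol2_ratio_powr c K)
  define h where "h u = (deriv ^^ (n - 1)) (?T u) u / fact (n - 1)" for u
  show thesis
  proof (rule that)
    show "h holomorphic_on ball c d"
      unfolding h_def by (intro holomorphic_intros hol2_diagonal[OF hol2_higher_deriv2[OF T]]) auto
    fix u p assume u: "u \<in> ball c d" and p: "p \<in> ball c d"
    have Tu: "?T u holomorphic_on ball c d" by (rule hol2_slice2[OF T]) (use u in auto)
    have der: "(deriv ^^ k) (?T u) u = 0" if "k \<noteq> n - 1" for k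
    proof -
      have "(of_nat n - 1 - of_nat k) * (deriv ^^ k) (?T u) u = (deriv ^^ k) (\<lambda>_. 0) u"
        by (rule ode_taylor[OF c K u]) (use ode u in auto)
      moreover have "of_nat n - 1 - of_nat k = (of_nat (n - 1) - of_nat k :: complex)"
        using n by (simp add: of_nat_diff)
      ultimately show ?thesis using that by simp
    qed
    obtain e where e: "e > 0" "ball u e \<subseteq> ball c d" using u open_contains_ball open_ball by metis
    have "?T u p = h u * (p - u) ^ (n - 1)" if p: "p \<in> ball u e" for p
    proof -
      define t where "t k = (deriv ^^ k) (?T u) u / fact k * (p - u) ^ k" for k
      have s1: "t sums ?T u p"
        unfolding t_def by (rule holomorphic_power_series[OF holomorphic_on_subset[OF Tu e(2)] p])
      have "t k = (if k = n - 1 then t k else 0)" for k using der[of k] by (simp add: t_def)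
      from sums_cong[of t "\<lambda>k. if k = n - 1 then t k else 0", OF this] sums_single[of "n - 1" t]
      have "t sums t (n - 1)" by (rule iffD2)
      with s1 have "?T u p = t (n - 1)" by (rule sums_unique2)
      then show ?thesis unfolding t_def h_def .
    qed
    note near = this
    have "?T u p = h u * (p - u) ^ (n - 1)"
      by (rule analytic_continuation_open[of "ball u e" "ball c d" "?T u" "\<lambda>p. h u * (p - u) ^ (n - 1)"])
        (use e p Tu near in \<open>auto intro!: holomorphic_intros\<close>)
    then show "(p / u) ^ (n - 1) * K u p = h u * (p - u) ^ (n - 1)"
      using powr_nat_diff_1[OF _ n, of "p / u"] ratio_not_nonpos[OF c u p] by simp
  qed
qed

lemma polynomial_of_higher_deriv_0:
  assumes hol: "\<psi> holomorphic_on ball c d" and zero: "\<And>u. u \<in> ball c d \<Longrightarrow> (deriv ^^ Suc m) \<psi> u = 0"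
  obtains q :: "complex poly" where "degree q \<le> m" "\<And>p. p \<in> ball c d \<Longrightarrow> \<psi> p = poly q p"
proof -
  define q where "q = (\<Sum>k\<le>m. smult ((deriv ^^ k) \<psi> c / fact k) ([:-c, 1:] ^ k))"
  have z: "(deriv ^^ (Suc m + j)) \<psi> u = 0" if "u \<in> ball c d" for j u
    using that
  proof (induction j arbitrary: u)
    case (Suc j)
    have "(deriv ^^ (Suc m + Suc j)) \<psi> u = deriv ((deriv ^^ (Suc m + j)) \<psi>) u" by simp
    also have "\<dots> = deriv (\<lambda>_. 0) u"
      by (rule complex_derivative_transform_within_open[OF
            holomorphic_higher_deriv[OF hol open_ball] _ open_ball Suc.prems]) (use Suc.IH in auto)
    finally show ?case by simp
  qed (use zero in auto)
  show thesis
  proof (rule that[of q])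
    show "degree q \<le> m" unfolding q_def
    proof (intro degree_sum_le)
      fix k assume "k \<in> {..m}"
      then show "degree (smult ((deriv ^^ k) \<psi> c / fact k) ([:-c, 1:] ^ k)) \<le> m"
        using degree_smult_le[of "(deriv ^^ k) \<psi> c / fact k" "[:-c, 1:] ^ k"] degree_power_le[of "[:-c, 1:]" k]
        by simp
    qed auto
    fix p assume p: "p \<in> ball c d"
    then have "d > 0" using le_less_trans[OF zero_le_dist] unfolding mem_ball by blast
    have z': "(deriv ^^ k) \<psi> c = 0" if "k > m" for k
      using z[of c "k - Suc m"] that \<open>d > 0\<close> by simp
    have "(\<lambda>k. (deriv ^^ k) \<psi> c / fact k * (p - c) ^ k) sums \<psi> p"
      by (rule holomorphic_power_series[OF hol p])
    moreover have "(\<lambda>k. (deriv ^^ k) \<psi> c / fact k * (p - c) ^ k) sums (\<Sum>k\<le>m. (deriv ^^ k) \<psi> c / fact k * (p - c) ^ k)"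
      by (rule sums_finite) (use z' in auto)
    ultimately have "\<psi> p = (\<Sum>k\<le>m. (deriv ^^ k) \<psi> c / fact k * (p - c) ^ k)" by (rule sums_unique2)
    then show "\<psi> p = poly q p" by (simp add: q_def poly_sum poly_power)
  qed
qed

lemma ode_polynomial_boundary_value:
  assumes c: "norm c = 1" "d \<le> 1" and K: "hol2 K (ball c d \<times> ball c d)" and n: "n \<ge> 2"
    and ode: "\<And>u p. u \<in> ball c d \<Longrightarrow> p \<in> ball c d \<Longrightarrow>
      ode_op (of_nat n) K u p = (of_nat n - 1) / p * K p p"
  obtains q :: "complex poly" where "degree q \<le> n - 2"
    "\<And>p. p \<in> ball c d \<Longrightarrow> p ^ (n - 2) * K p p = poly q p"
proof -
  define \<psi> where "\<psi> p = p ^ (n - 2) * K p p" for p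
  have \<psi>: "\<psi> holomorphic_on ball c d"
    unfolding \<psi>_def by (intro holomorphic_intros hol2_diagonal[OF K]) auto
  have "(deriv ^^ Suc (n - 2)) \<psi> u = 0" if u: "u \<in> ball c d" for u
  proof -
    note nz = ratio_not_nonpos[OF c u]
    \<comment> \<open>For fixed \<open>u\<close> this collects everything independent of
      \<open>p\<close>: \<open>(p / u) ^ (n - 1) * u * (n - 1) / p\<close> equals
      \<open>?C * p ^ (n - 2)\<close>.\<close>
    let ?C = "(of_nat n - 1) / u ^ (n - 2) :: complex"
    have "(of_nat n - 1 - of_nat (n - 1)) * (deriv ^^ (n - 1)) (\<lambda>p. (p / u) powr (of_nat n - 1) * K u p) u
       = (deriv ^^ (n - 1)) (\<lambda>p. ?C * \<psi> p) u"
    proof (rule ode_taylor[OF c K u])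
      show "(\<lambda>p. ?C * \<psi> p) holomorphic_on ball c d" by (intro holomorphic_intros \<psi>)
      fix p assume p: "p \<in> ball c d"
      have "n - 1 = Suc (n - 2)" using n by simp
      then have "(p / u) powr (of_nat n - 1) = (p / u) ^ (n - 2) * (p / u)"
        using powr_nat_diff_1[of "p / u" n] nz[OF p] n by simp
      then show "(p / u) powr (of_nat n - 1) * u * ode_op (of_nat n) K u p = ?C * \<psi> p"
        unfolding ode[OF u p] \<psi>_def using nz[OF p] by (simp add: power_divide)
    qed
    then have C0: "?C * (deriv ^^ (n - 1)) \<psi> u = 0"
      unfolding higher_deriv_cmult[OF \<psi> u open_ball] using n by (simp add: of_nat_diff)
    have "of_nat n - 1 = (of_nat (n - 1) :: complex)" using n by (simp add: of_nat_diff)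
    then have "?C \<noteq> 0" using nz(2)[OF u] n by simp
    with C0 have "(deriv ^^ (n - 1)) \<psi> u = 0" by (metis mult_eq_0_iff)
    moreover have "Suc (n - 2) = n - 1" using n by simp
    ultimately show ?thesis by (simp only:)
  qed
  from polynomial_of_higher_deriv_0[OF \<psi> this] obtain q where
    "degree q \<le> n - 2" "\<And>p. p \<in> ball c d \<Longrightarrow> \<psi> p = poly q p" by blast
  then show thesis using that by (simp add: \<psi>_def)
qed

section \<open>The series solution\<close>

text \<open>The Taylor coefficient at \<open>p = u\<close> of the right-hand side of the twisted
  equation, without the factor \<open>r - 1\<close>, which is put into
  \<open>ode_coeff\<close>.\<close>

definition taylor_src :: "complex \<Rightarrow> (complex \<Rightarrow> complex) \<Rightarrow> nat \<Rightarrow> complex \<Rightarrow> complex" where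
  "taylor_src r \<phi> k u = (deriv ^^ k) (\<lambda>p. (p / u) powr (r - 2) * \<phi> p) u / fact k"

text \<open>The case \<open>k = 0\<close> is singled out only for the sake of \<open>r = 1\<close>. If \<open>r - 1 = k > 0\<close>, the
  coefficient is \<open>0\<close> by the convention on division.\<close>

definition ode_coeff :: "complex \<Rightarrow> nat \<Rightarrow> complex" where
  "ode_coeff r k = (if k = 0 then 1 else (r - 1) / (r - 1 - of_nat k))"

text \<open>The power in front undoes the twist by \<open>(p / u) powr (r - 1)\<close>. The formula
  refers to no centre or radius, so it defines a single function for all boundary points.\<close>

definition ode_sol :: "complex \<Rightarrow> (complex \<Rightarrow> complex) \<Rightarrow> complex \<Rightarrow> complex \<Rightarrow> complex" where
  "ode_sol r \<phi> u p = (p / u) powr (1 - r) * (\<Sum>k. ode_coeff r k * taylor_src r \<phi> k u * (p - u) ^ k)"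

text \<open>From \<open>k \<ge> 2 * norm (r - 1)\<close> on, the denominator is at least as large as
  the numerator; finitely many coefficients remain.\<close>

lemma ode_coeff_bounded: obtains B where "B > 0" "\<And>k. norm (ode_coeff r k) \<le> B"
proof -
  define N where "N = nat \<lceil>2 * norm (r - 1)\<rceil> + 1"
  have sum_nn: "0 \<le> (\<Sum>k<N. norm (ode_coeff r k))" by (intro sum_nonneg) auto
  show thesis
  proof (rule that[of "1 + (\<Sum>k<N. norm (ode_coeff r k))"])
    show "0 < 1 + (\<Sum>k<N. norm (ode_coeff r k))" using sum_nn by simp
    fix k
    show "norm (ode_coeff r k) \<le> 1 + (\<Sum>k<N. norm (ode_coeff r k))"
    proof (cases "k < N")
      case True
      then have "norm (ode_coeff r k) \<le> (\<Sum>k<N. norm (ode_coeff r k))"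
        by (intro member_le_sum) auto
      then show ?thesis by simp
    next
      case False
      then have k: "2 * norm (r - 1) \<le> real k" "k > 0" unfolding N_def by linarith+
      have "real k \<le> norm (r - 1 - of_nat k) + norm (r - 1)"
        using norm_triangle_ineq4[of "r - 1" "r - 1 - of_nat k"] by simp
      then have "norm (r - 1) \<le> norm (r - 1 - of_nat k)" using k by simp
      then have "norm (ode_coeff r k) \<le> 1"
        using k by (simp add: ode_coeff_def norm_divide divide_le_eq_1)
      then show ?thesis using sum_nn by simp
    qed
  qed
qed

text \<open>For \<open>u\<close> in the ball of radius \<open>e / 8\<close>, Cauchy estimates on the
  circle of radius \<open>e / 2\<close> about \<open>u\<close> bound the coefficients; these circles
  stay inside \<open>cball c (3/4 * e)\<close>. Two points of the small ball differ by less than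
  \<open>e / 4\<close>, so the series converges geometrically with ratio 1/2. The assumption
  \<open>src\<close> is the solvability condition at the index where \<open>r - 1 - k\<close>
  vanishes.\<close>

lemma ode_sol:
  assumes c: "norm c = 1" "0 < e" "e \<le> 1" and \<phi>: "\<phi> holomorphic_on ball c e"
    and src: "\<And>k u. k > 0 \<Longrightarrow> r - 1 = of_nat k \<Longrightarrow> u \<in> ball c e \<Longrightarrow> taylor_src r \<phi> k u = 0"
  shows "hol2 (ode_sol r \<phi>) (ball c (e/8) \<times> ball c (e/8))"
    and "u \<in> ball c (e/8) \<Longrightarrow> p \<in> ball c (e/8) \<Longrightarrow> ode_op r (ode_sol r \<phi>) u p = (r - 1) / p * \<phi> p"
    and "u \<in> ball c (e/8) \<Longrightarrow> ode_sol r \<phi> u u = \<phi> u"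
proof -
  let ?B = "ball c e" and ?D = "ball c (e/8)"
  have DB: "?D \<subseteq> ?B" using c by auto
  define R where "R u p = (p / u) powr (r - 2) * \<phi> p" for u p
  have R: "hol2 R (?B \<times> ?B)"
    unfolding R_def[abs_def]
    by (intro hol2_mult hol2_ratio_powr hol2_of_snd c)
      (use holomorphic_on_imp_differentiable_at[OF \<phi>] in \<open>auto intro: open_Times\<close>)
  define \<rho> where "\<rho> k u = taylor_src r \<phi> k u" for k u
  have \<rho>_eq: "\<rho> k u = (deriv ^^ k) (R u) u / fact k" for k u
    by (simp add: \<rho>_def taylor_src_def R_def[abs_def])
  have \<rho>: "\<rho> k holomorphic_on ?B" for k
    unfolding \<rho>_eq by (intro holomorphic_intros hol2_diagonal[OF hol2_higher_deriv2[OF R]]) auto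
  have sub: "cball c (3/4 * e) \<subseteq> ?B" using c by auto
  have "compact ((\<lambda>q. R (fst q) (snd q)) ` (cball c (3/4 * e) \<times> cball c (3/4 * e)))"
    by (intro compact_continuous_image compact_Times compact_cball
        continuous_on_subset[OF hol2_continuous_on[OF R]]) (use sub in auto)
  from compact_imp_bounded[OF this] obtain M where
    M: "M > 0" "\<And>q. q \<in> cball c (3/4 * e) \<times> cball c (3/4 * e) \<Longrightarrow> norm (R (fst q) (snd q)) \<le> M"
    unfolding bounded_pos by blast
  have \<rho>_bound: "norm (\<rho> k u) \<le> M / (e/2) ^ k" if u: "u \<in> ?D" for k u
  proof -
    have sub2: "cball u (e/2) \<subseteq> cball c (3/4 * e)"
    proof
      fix x assume "x \<in> cball u (e/2)"
      then show "x \<in> cball c (3/4 * e)" using u dist_triangle[of c x u] c by auto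
    qed
    have hol: "R u holomorphic_on ?B" by (rule hol2_slice2[OF R]) (use u DB in auto)
    have "norm ((deriv ^^ k) (R u) u) \<le> fact k * M / (e/2) ^ k"
    proof (rule Cauchy_inequality)
      show "R u holomorphic_on ball u (e/2)" "continuous_on (cball u (e/2)) (R u)"
        using hol sub sub2 ball_subset_cball holomorphic_on_subset holomorphic_on_imp_continuous_on
        by (meson subset_trans)+
      fix x assume "norm (u - x) = e/2"
      then have "x \<in> cball c (3/4 * e)" using sub2 by (auto simp: dist_norm)
      moreover have "u \<in> cball c (3/4 * e)" using u c by auto
      ultimately show "norm (R u x) \<le> M" using M(2)[of "(u, x)"] by simp
    qed (use c in auto)
    then show ?thesis unfolding \<rho>_eq by (simp add: norm_divide field_simps)
  qed
  obtain G where G: "G > 0" "\<And>k. norm (ode_coeff r k) \<le> G" using ode_coeff_bounded by blast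
  define a where "a k u = ode_coeff r k * \<rho> k u" for k u
  have a_bound: "norm (a k u * x ^ k) \<le> G * M * (1/2) ^ k" if "u \<in> ?D" "norm x \<le> e/4" for k u x
  proof -
    have "norm (a k u * x ^ k) \<le> (G * (M / (e/2) ^ k)) * (e/4) ^ k"
      unfolding a_def norm_mult norm_power
      by (intro mult_mono power_mono G \<rho>_bound that) (use G M c in auto)
    also have "\<dots> = G * M * ((e/4) / (e/2)) ^ k" unfolding power_divide by simp
    also have "(e/4) / (e/2) = 1/2" using c by simp
    finally show ?thesis .
  qed
  have geo: "summable (\<lambda>k. G * M * (1/2::real) ^ k)" by (intro summable_mult summable_geometric) auto
  define T where "T u p = (\<Sum>k. a k u * (p - u) ^ k)" for u p
  have du: "norm (p - u) < e/4" if "u \<in> ?D" "p \<in> ?D" for u p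
    using that dist_triangle[of p u c] by (auto simp: dist_norm norm_minus_commute)
  have "uniform_limit (?D \<times> ?D) (\<lambda>n q. \<Sum>k<n. a k (fst q) * (snd q - fst q) ^ k)
      (\<lambda>q. \<Sum>k. a k (fst q) * (snd q - fst q) ^ k) sequentially"
  proof (rule Weierstrass_m_test[OF a_bound geo])
    fix q assume "q \<in> ?D \<times> ?D"
    then show "fst q \<in> ?D" "norm (snd q - fst q) \<le> e/4"
      using du[of "fst q" "snd q"] by (simp_all only: mem_Times_iff less_imp_le)
  qed
  then have ul: "uniform_limit (?D \<times> ?D) (\<lambda>n q. \<Sum>k<n. a k (fst q) * (snd q - fst q) ^ k)
      (\<lambda>q. T (fst q) (snd q)) sequentially" by (simp add: T_def)
  have T: "hol2 T (?D \<times> ?D)"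
  proof (rule hol2_uniform_limit[OF _ always_eventually _ ul])
    have oD: "open (?D \<times> ?D)" by (intro open_Times open_ball)
    have "\<rho> k field_differentiable at u" if "u \<in> ?D" for k u
      using holomorphic_on_imp_differentiable_at[OF \<rho> open_ball] DB that by blast
    then show "\<forall>n. hol2 (\<lambda>u p. \<Sum>k<n. a k u * (p - u) ^ k) (?D \<times> ?D)"
      unfolding a_def
      by (intro allI hol2_sum hol2_mult hol2_const hol2_power hol2_diff hol2_fst hol2_snd hol2_of_fst oD) auto
  qed (auto intro: open_Times)
  have sol: "ode_sol r \<phi> = (\<lambda>u p. (p / u) powr (1 - r) * T u p)"
    by (simp add: ode_sol_def[abs_def] T_def a_def \<rho>_def)
  show hol: "hol2 (ode_sol r \<phi>) (?D \<times> ?D)"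
    unfolding sol by (intro hol2_mult hol2_ratio_powr T c(1)) (use c in auto)
  assume u: "u \<in> ?D"
  have "T u u = a 0 u" using powser_zero[of "\<lambda>k. a k u"] by (simp add: T_def)
  then show "ode_sol r \<phi> u u = \<phi> u"
    using ratio_not_nonpos[OF c(1) _ u u] c by (simp add: sol a_def \<rho>_eq ode_coeff_def R_def)
  assume p: "p \<in> ?D"
  have e8: "e / 8 \<le> 1" using c by simp
  note nz = ratio_not_nonpos[OF c(1) e8 u p]
  define x where "x = p - u"
  have x: "norm x < e/4" unfolding x_def by (rule du[OF u p])
  have summ: "summable (\<lambda>k. a k u * y ^ k)" if "norm y < e/4" for y
    by (rule summable_comparison_test'[OF geo a_bound]) (use u that in auto)
  have "((\<lambda>y. \<Sum>k. a k u * y ^ k) has_field_derivative (\<Sum>k. diffs (\<lambda>k. a k u) k * x ^ k)) (at x)"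
    by (rule termdiffs_strong'[OF summ x])
  then have "((\<lambda>y. \<Sum>k. a k u * y ^ k) has_field_derivative (\<Sum>k. diffs (\<lambda>k. a k u) k * x ^ k)) (at (p - u))"
    by (simp add: x_def)
  from DERIV_chain2[OF this DERIV_diff[OF DERIV_ident DERIV_const]]
  have dT: "(T u has_field_derivative (\<Sum>k. diffs (\<lambda>k. a k u) k * x ^ k)) (at p)"
    by (simp add: T_def[abs_def])
  let ?T' = "\<Sum>k. diffs (\<lambda>k. a k u) k * x ^ k"
  have "(\<lambda>k. of_nat k * a k u * x ^ (k - Suc 0)) sums ?T'"
    by (rule diffs_equiv[OF termdiff_converges[OF x summ]])
  from sums_mult[OF this, of x] have s1: "(\<lambda>k. x * (of_nat k * a k u * x ^ (k - Suc 0))) sums (x * ?T')" .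
  \<comment> \<open>Multiplication by \<open>x\<close> restores the power lost in differentiation;
    for \<open>k = 0\<close> both sides are 0.\<close>
  have "x * (of_nat k * a k u * x ^ (k - Suc 0)) = of_nat k * a k u * x ^ k" for k
    by (cases k) auto
  with s1 have s1: "(\<lambda>k. of_nat k * a k u * x ^ k) sums (x * ?T')" by simp
  have s2: "(\<lambda>k. a k u * x ^ k) sums T u p"
    unfolding T_def x_def[symmetric] by (rule summable_sums[OF summ[OF x]])
  have s3: "(\<lambda>k. (r - 1) * (a k u * x ^ k) - of_nat k * a k u * x ^ k) sums ((r - 1) * T u p - x * ?T')"
    by (intro sums_diff sums_mult s1 s2)
  have "(r - 1) * (a k u * x ^ k) - of_nat k * a k u * x ^ k = (r - 1) * (\<rho> k u * x ^ k)" for k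
  proof -
    \<comment> \<open>At the resonant index both sides vanish, the right one by \<open>src\<close>.
      At index 0 the coefficient 1 makes both sides \<open>(r - 1) * \<rho> 0 u\<close>, also for
      \<open>r = 1\<close>.\<close>
    have "(r - 1 - of_nat k) * a k u = (r - 1) * \<rho> k u"
    proof (cases "k > 0 \<and> r - 1 = of_nat k")
      case True
      then have "\<rho> k u = 0" unfolding \<rho>_def by (intro src) (use u DB in auto)
      then show ?thesis by (simp add: a_def)
    qed (auto simp: a_def ode_coeff_def)
    then have "(r - 1 - of_nat k) * a k u * x ^ k = (r - 1) * \<rho> k u * x ^ k" by simp
    then show ?thesis by (simp add: algebra_simps)
  qed
  with s3 have s3: "(\<lambda>k. (r - 1) * (\<rho> k u * x ^ k)) sums ((r - 1) * T u p - x * ?T')" by simp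
  have "R u holomorphic_on ball u (e/4)"
  proof (rule hol2_slice2[OF R])
    fix y assume "y \<in> ball u (e/4)"
    then show "(u, y) \<in> ?B \<times> ?B" using u c dist_triangle[of c y u] by auto
  qed
  then have "(\<lambda>k. \<rho> k u * x ^ k) sums R u p"
    unfolding \<rho>_eq x_def
    by (rule holomorphic_power_series) (use du[OF u p] in \<open>auto simp: dist_norm norm_minus_commute\<close>)
  from sums_unique2[OF s3 sums_mult[OF this, of "r - 1"]]
  have main: "(r - 1) * T u p - x * ?T' = (r - 1) * R u p" .
  have "deriv (ode_sol r \<phi> u) p = (1 - r) / p * (p / u) powr (1 - r) * T u p + ?T' * (p / u) powr (1 - r)"
    unfolding sol by (intro DERIV_imp_deriv DERIV_mult ratio_powr_has_derivative nz dT)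
  then have "ode_op r (ode_sol r \<phi>) u p = (1 - p / u) * ((1 - r) / p * (p / u) powr (1 - r) * T u p
     + ?T' * (p / u) powr (1 - r)) + (r - 1) / p * ((p / u) powr (1 - r) * T u p)"
    by (simp add: ode_op_def sol)
  also have "\<dots> = (p / u) powr (1 - r) / u * ((r - 1) * T u p - x * ?T')"
    using nz by (simp add: x_def field_simps)
  also have "\<dots> = (r - 1) / u * ((p / u) powr (1 - r) * (p / u) powr (r - 2)) * \<phi> p"
    unfolding main R_def by simp
  also have "(p / u) powr (1 - r) * (p / u) powr (r - 2) = (p / u) powr (- 1)"
    using powr_add[of "p / u" "1 - r" "r - 2"] by simp
  also have "\<dots> = u / p" using nz by (simp add: powr_minus)
  finally show "ode_op r (ode_sol r \<phi>) u p = (r - 1) / p * \<phi> p" using nz by simp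
qed

section \<open>Boundary germs\<close>

text \<open>If two half-balls meet, the larger full ball contains the centre of the other. The
  intersection of the full balls is convex and contains that centre, where the agreement set
  accumulates, so the identity theorem applies on it.\<close>

lemma holomorphic_glue:
  fixes C :: "complex set" and \<delta> :: "complex \<Rightarrow> real"
  assumes hol: "\<And>c. c \<in> C \<Longrightarrow> \<delta> c > 0 \<and> h c holomorphic_on ball c (\<delta> c)"
    and agree: "\<And>c c'. c \<in> C \<Longrightarrow> c' \<in> C \<Longrightarrow> c' \<in> ball c (\<delta> c) \<Longrightarrow>
      c' islimpt {z \<in> ball c (\<delta> c) \<inter> ball c' (\<delta> c'). h c z = h c' z}"
  obtains g where "g holomorphic_on (\<Union>c\<in>C. ball c (\<delta> c / 2))"
    "\<And>c z. c \<in> C \<Longrightarrow> z \<in> ball c (\<delta> c / 2) \<Longrightarrow> g z = h c z"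
proof -
  have ext: "h c z = h c' z" if c: "c \<in> C" "c' \<in> C" "c' \<in> ball c (\<delta> c)"
    and z: "z \<in> ball c (\<delta> c) \<inter> ball c' (\<delta> c')" for c c' z
  proof -
    let ?A = "ball c (\<delta> c) \<inter> ball c' (\<delta> c')"
    have "h c z - h c' z = 0"
    proof (rule analytic_continuation[of "\<lambda>z. h c z - h c' z" ?A _ c'])
      show "(\<lambda>z. h c z - h c' z) holomorphic_on ?A"
        using hol[OF c(1)] hol[OF c(2)] by (intro holomorphic_on_diff) (auto elim: holomorphic_on_subset)
      show "c' islimpt {z \<in> ?A. h c z = h c' z}" by (rule agree[OF c])
    qed (use c z hol in \<open>auto intro!: convex_connected convex_Int\<close>)
    then show ?thesis by simp
  qed
  have eq: "h c z = h c' z" if c: "c \<in> C" "c' \<in> C" and z: "z \<in> ball c (\<delta> c / 2)" "z \<in> ball c' (\<delta> c' / 2)" for c c' z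
  proof -
    have d: "dist c c' < \<delta> c / 2 + \<delta> c' / 2"
      using z dist_triangle[of c c' z] by (simp add: dist_commute)
    have z': "z \<in> ball c (\<delta> c) \<inter> ball c' (\<delta> c')"
      using z hol[OF c(1)] hol[OF c(2)] by auto
    show ?thesis
    proof (cases "\<delta> c' \<le> \<delta> c")
      case True
      then have "c' \<in> ball c (\<delta> c)" using d by simp
      then show ?thesis using ext c z' by blast
    next
      case False
      then have "c \<in> ball c' (\<delta> c')" using d by (simp add: dist_commute)
      then show ?thesis using ext[of c' c z] c z' by auto
    qed
  qed
  define g where "g z = h (SOME c. c \<in> C \<and> z \<in> ball c (\<delta> c / 2)) z" for z
  have g: "g z = h c z" if "c \<in> C" "z \<in> ball c (\<delta> c / 2)" for c z
  proof -
    have "(SOME c. c \<in> C \<and> z \<in> ball c (\<delta> c / 2)) \<in> C \<and>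
      z \<in> ball (SOME c. c \<in> C \<and> z \<in> ball c (\<delta> c / 2)) (\<delta> (SOME c. c \<in> C \<and> z \<in> ball c (\<delta> c / 2)) / 2)"
      by (rule someI[of _ c]) (use that in auto)
    then show ?thesis unfolding g_def using eq that by blast
  qed
  show thesis
  proof (rule that)
    show "g holomorphic_on (\<Union>c\<in>C. ball c (\<delta> c / 2))"
    proof (rule holomorphic_on_UN_open)
      fix c assume c: "c \<in> C"
      have "h c holomorphic_on ball c (\<delta> c / 2)"
        using hol[OF c] by (elim conjE holomorphic_on_subset) auto
      then show "g holomorphic_on ball c (\<delta> c / 2)"
        by (rule holomorphic_transform) (use g c in auto)
    qed auto
  qed (use g in auto)
qed

lemma f_r_nonzero: "Im z > 0 \<Longrightarrow> z \<noteq> \<i> \<Longrightarrow> f_r r z \<noteq> 0"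
  using kernel_base[of z "cnj z"] by (auto simp: f_r_def)

lemma sym_nbhd_mono: "d' \<le> d \<Longrightarrow> sym_nbhd c d' \<subseteq> sym_nbhd c d"
  by (auto simp: sym_nbhd_def)

lemma upper_part_mono: "U \<subseteq> V \<Longrightarrow> upper_part U \<subseteq> upper_part V"
  by (auto simp: upper_part_def)

text \<open>\<open>K\<close> complexifies the real-analytic continuation \<open>G\<close> of \<open>F / f_r\<close> near a boundary point.\<close>

definition complexifies ::
  "complex \<Rightarrow> complex option set \<Rightarrow> (complex \<Rightarrow> complex) \<Rightarrow> (complex option \<Rightarrow> complex) \<Rightarrow>
    complex \<Rightarrow> real \<Rightarrow> (complex \<Rightarrow> complex \<Rightarrow> complex) \<Rightarrow> bool" where
  "complexifies r U F G c d K \<longleftrightarrow> 0 < d \<and> d \<le> 1 \<and> hol2 K (ball c d \<times> ball c d) \<and>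
     (\<forall>y\<in>sym_nbhd c d. y \<in> U \<and> G y = K (cayley y) (cayley (map_option cnj y))) \<and>
     (\<forall>z\<in>upper_part (sym_nbhd c d). F z = f_r r z * K (cay z) (cay (cnj z))) \<and>
     (\<forall>u\<in>ball c d. \<forall>p\<in>ball c d. ode_op r K u p = (r - 1) / p * K p p)"

lemma complexifies_mono:
  assumes "complexifies r U F G c d K" "0 < d'" "d' \<le> d"
  shows "complexifies r U F G c d' K"
proof -
  have "ball c d' \<subseteq> ball c d" using assms by auto
  moreover have "hol2 K (ball c d' \<times> ball c d')"
    by (rule hol2_subset[of _ "ball c d \<times> ball c d"])
      (use assms calculation in \<open>auto simp: complexifies_def intro: open_Times\<close>)
  ultimately show ?thesis
    using assms sym_nbhd_mono[OF assms(3), of c] upper_part_mono[OF sym_nbhd_mono[OF assms(3), of c]]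
    unfolding complexifies_def by (meson order_trans subsetD)
qed

text \<open>Real-analyticity supplies \<open>K\<close>, the nonvanishing of \<open>f_r\<close> turns
  the quotient into a product, and harmonicity supplies the equation. The point \<open>\<i>\<close>
  is absent from the neighbourhood because its coordinate is 0. The bound \<open>e\<close> allows
  shrinking to an arc or to another ball.\<close>

lemma complexification_exists:
  assumes F: "Hb r U F" and G: "rho_cont r U F G" and x: "x \<in> U" "x \<in> p1R" and "e > 0"
  obtains d K where "d \<le> e" "complexifies r U F G (cayley x) d K"
proof -
  have U: "p1_open U" "r_harmonic_on r (upper_part U) F" using F by (auto simp: Hb_def)
  have c: "norm (cayley x) = 1" using x p1R_iff_cayley by blast
  have "p1_real_analytic_on G U" using G by (simp add: rho_cont_def)
  then obtain d0 K where K: "0 < d0" "d0 \<le> 1" "hol2 K (ball (cayley x) d0 \<times> ball (cayley x) d0)"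
    "\<And>y. y \<in> sym_nbhd (cayley x) d0 \<Longrightarrow> y \<in> U \<and> G y = K (cayley y) (cayley (map_option cnj y))"
    using p1_real_analytic_on_local[OF U(1) _ x] by metis
  have up: "z \<in> upper_part U" if "z \<in> upper_part (sym_nbhd (cayley x) d0)" for z
    using that K(4) by (auto simp: upper_part_def)
  have FK: "F z = f_r r z * K (cay z) (cay (cnj z))" if z: "z \<in> upper_part (sym_nbhd (cayley x) d0)" for z
  proof -
    have "Some z \<in> sym_nbhd (cayley x) d0" "Im z > 0" using z by (auto simp: upper_part_def)
    moreover from upper_sym_nbhd[OF c K(2) this] have "z \<noteq> \<i>" by blast
    ultimately show ?thesis
      using G up[OF z] f_r_nonzero[of z r] K(4)[of "Some z"]
      by (simp add: rho_cont_def divide_eq_eq mult.commute)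
  qed
  have ode: "ode_op r K u p = (r - 1) / p * K p p" if "u \<in> ball (cayley x) d0" "p \<in> ball (cayley x) d0" for u p
    by (rule r_harmonic_imp_ode[OF c K(1-3) FK _ that])
      (use U(2) up in \<open>auto simp: r_harmonic_on_def\<close>)
  have "complexifies r U F G (cayley x) d0 K"
    unfolding complexifies_def using K FK ode by blast
  then have "complexifies r U F G (cayley x) (min d0 e) K"
    by (rule complexifies_mono) (use K assms in auto)
  then show thesis by (intro that[of "min d0 e"]) auto
qed

lemma p1R_open_contains_arc:
  assumes "p1R_open I" "x \<in> I"
  obtains e where "0 < e" "e \<le> 1" "\<And>y. y \<in> p1R \<Longrightarrow> cayley y \<in> ball (cayley x) e \<Longrightarrow> y \<in> I"
proof -
  obtain U where U: "p1_open U" "I = U \<inter> p1R" using assms(1) by (auto simp: p1R_open_def)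
  then obtain e where "0 < e" "e \<le> 1" "\<And>y. cayley y \<in> ball (cayley x) e \<Longrightarrow> y \<in> U"
    using p1_open_contains_cayley_ball[OF U(1), of x] assms(2) by auto
  then show thesis using that U by auto
qed

lemma p1R_open_subset: "p1R_open I \<Longrightarrow> I \<subseteq> p1R"
  by (auto simp: p1R_open_def)

text \<open>The point 1 is left out because it is the coordinate of infinity, about which conditions
  on real \<open>t\<close> say nothing; the identity theorem recovers it.\<close>

lemma circle_islimpt:
  assumes "norm (c::complex) = 1" "open A" "c \<in> A"
  shows "c islimpt {s \<in> A. norm s = 1 \<and> s \<noteq> 1}"
  unfolding islimpt_def
proof (intro allI impI)
  fix T assume T: "c \<in> T" "open T"
  have "c \<in> sphere 0 1" using assms(1) by simp
  moreover have "connected (sphere (0::complex) 1)" by (rule connected_sphere) simp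
  moreover have "\<not> (\<exists>a. sphere (0::complex) 1 = {a})"
  proof
    assume "\<exists>a. sphere (0::complex) 1 = {a}"
    then obtain a where a: "sphere (0::complex) 1 = {a}" by blast
    have "1 \<in> sphere (0::complex) 1" "-1 \<in> sphere (0::complex) 1" by simp_all
    then have "(1::complex) = -1" unfolding a by simp
    then show False by simp
  qed
  ultimately have lim: "c islimpt sphere 0 1" using connected_imp_perfect by blast
  define O' where "O' = T \<inter> A \<inter> (if c = 1 then UNIV else - {1})"
  have "c \<in> O'" "open O'" using T assms by (auto simp: O'_def)
  then obtain y where "y \<in> sphere 0 1" "y \<in> O'" "y \<noteq> c" using lim unfolding islimpt_def by blast
  then show "\<exists>y\<in>{s \<in> A. norm s = 1 \<and> s \<noteq> 1}. y \<in> T \<and> y \<noteq> c"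
    by (intro bexI[of _ y]) (auto simp: O'_def split: if_splits)
qed

text \<open>Such \<open>s\<close> are the coordinates of upper half-plane points that lie, together
  with their conjugates, over \<open>A\<close>. They are the points where \<open>F\<close> can be
  compared with its local expressions.\<close>

lemma disc_islimpt:
  assumes "norm (c::complex) = 1" "open A" "c \<in> A"
  shows "c islimpt {s. norm s < 1 \<and> s \<noteq> 0 \<and> s \<in> A \<and> 1 / cnj s \<in> A}"
  unfolding islimpt_def
proof (intro allI impI)
  fix T assume T: "c \<in> T" "open T"
  then obtain d where d: "d > 0" "ball c d \<subseteq> T \<inter> A"
    using assms open_contains_ball[of "T \<inter> A"] open_Int by blast
  obtain s where s: "norm s < 1" "s \<noteq> 0" "s \<in> ball c d" "1 / cnj s \<in> ball c d"
    by (rule sphere_radial_point[OF assms(1) d(1)])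
  have "s \<noteq> c" using s assms(1) by auto
  then show "\<exists>y\<in>{s. norm s < 1 \<and> s \<noteq> 0 \<and> s \<in> A \<and> 1 / cnj s \<in> A}. y \<in> T \<and> y \<noteq> c"
    using s d by (intro bexI[of _ s]) auto
qed

lemma inv_cayley_circle:
  assumes "norm s = 1"
  shows "inv_cayley s \<in> p1R" "cayley (inv_cayley s) = s"
  using assms p1R_iff_cayley cayley_inv_cayley by auto

lemma complexifies_circle:
  assumes "complexifies r U F G c d K" "norm p = 1" "p \<in> ball c d"
  shows "G (inv_cayley p) = K p p"
proof -
  have "inv_cayley p \<in> sym_nbhd c d"
    using inv_cayley_circle[OF assms(2)] assms(3) by (simp add: sym_nbhd_def cnj_p1R)
  then show ?thesis
    using assms(1) inv_cayley_circle[OF assms(2)] by (auto simp: complexifies_def cnj_p1R)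
qed

lemma diagonal_zero:
  assumes "norm c = 1" "d > 0" "hol2 K (ball c d \<times> ball c d)"
    and "\<And>p. p \<in> ball c d \<Longrightarrow> norm p = 1 \<Longrightarrow> p \<noteq> 1 \<Longrightarrow> K p p = 0" and "p \<in> ball c d"
  shows "K p p = 0"
proof (rule analytic_continuation[of "\<lambda>p. K p p" "ball c d" "{s \<in> ball c d. norm s = 1 \<and> s \<noteq> 1}" c])
  show "(\<lambda>p. K p p) holomorphic_on ball c d" by (rule hol2_diagonal[OF assms(3)]) auto
  show "c islimpt {s \<in> ball c d. norm s = 1 \<and> s \<noteq> 1}" by (rule circle_islimpt) (use assms in auto)
qed (use assms in auto)

lemma subset_Union_sym_nbhd:
  assumes "I \<subseteq> p1R" "\<And>x. x \<in> I \<Longrightarrow> 0 < \<delta> x"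
  shows "I \<subseteq> (\<Union>x\<in>I. sym_nbhd (cayley x) (\<delta> x))"
proof
  fix x assume "x \<in> I"
  then have "x \<in> sym_nbhd (cayley x) (\<delta> x)" using assms by (intro mem_sym_nbhd) auto
  with \<open>x \<in> I\<close> show "x \<in> (\<Union>x\<in>I. sym_nbhd (cayley x) (\<delta> x))" by blast
qed

lemma p1_open_Union_sym_nbhd:
  assumes "I \<subseteq> p1R" "\<And>x. x \<in> I \<Longrightarrow> \<delta> x \<le> 1"
  shows "p1_open (\<Union>x\<in>I. sym_nbhd (cayley x) (\<delta> x))"
  using assms p1R_iff_cayley by (intro p1_open_Union p1_open_sym_nbhd) auto

section \<open>Image, injectivity and surjectivity of the boundary map\<close>

text \<open>\<open>G\<close> is merely real-analytic off the boundary, so a holomorphic extension is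
  assembled from the diagonals of the local complexifications. On arcs of the circle each diagonal
  equals \<open>G\<close>, which makes them agree.\<close>

lemma rho_Vomega:
  assumes I: "p1R_open I" "I \<subseteq> U" and F: "Hb r U F" "rho_cont r U F G"
  shows "Vomega I G"
proof -
  define C where "C = cayley ` I"
  have ex: "\<exists>d K. (\<forall>y\<in>p1R. cayley y \<in> ball c d \<longrightarrow> y \<in> I) \<and> complexifies r U F G c d K" if c: "c \<in> C" for c
  proof -
    obtain x where x: "x \<in> I" "c = cayley x" using c by (auto simp: C_def)
    obtain e where e: "0 < e" "e \<le> 1" "\<And>y. y \<in> p1R \<Longrightarrow> cayley y \<in> ball (cayley x) e \<Longrightarrow> y \<in> I"
      using p1R_open_contains_arc[OF I(1) x(1)] by blast
    have xU: "x \<in> U" "x \<in> p1R" using x I p1R_open_subset by auto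
    obtain d K where "d \<le> e" "complexifies r U F G (cayley x) d K"
      by (rule complexification_exists[OF F xU e(1)])
    then show ?thesis using e x by (intro exI[of _ d] exI[of _ K]) auto
  qed
  then obtain \<delta> K where \<delta>: "\<And>c. c \<in> C \<Longrightarrow> complexifies r U F G c (\<delta> c) (K c)" by metis
  have cn: "norm c = 1" if "c \<in> C" for c
    using that I p1R_open_subset p1R_iff_cayley by (auto simp: C_def)
  have hol: "\<delta> c > 0 \<and> (\<lambda>p. K c p p) holomorphic_on ball c (\<delta> c)" if "c \<in> C" for c
  proof
    have "hol2 (K c) (ball c (\<delta> c) \<times> ball c (\<delta> c))" using \<delta>[OF that] by (simp add: complexifies_def)
    then show "(\<lambda>p. K c p p) holomorphic_on ball c (\<delta> c)" by (rule hol2_diagonal) auto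
  qed (use \<delta>[OF that] in \<open>simp add: complexifies_def\<close>)
  obtain g where g: "g holomorphic_on (\<Union>c\<in>C. ball c (\<delta> c / 2))"
    "\<And>c z. c \<in> C \<Longrightarrow> z \<in> ball c (\<delta> c / 2) \<Longrightarrow> g z = K c z z"
  proof (rule holomorphic_glue[of C \<delta> "\<lambda>c p. K c p p"])
    fix c c' assume c: "c \<in> C" "c' \<in> C" "c' \<in> ball c (\<delta> c)"
    let ?A = "ball c (\<delta> c) \<inter> ball c' (\<delta> c')"
    have "c' islimpt {s \<in> ?A. norm s = 1 \<and> s \<noteq> 1}"
      using c cn hol by (intro circle_islimpt) auto
    then show "c' islimpt {z \<in> ?A. K c z z = K c' z z}"
      by (rule islimpt_subset)
        (use complexifies_circle[OF \<delta>[OF c(1)], symmetric] complexifies_circle[OF \<delta>[OF c(2)], symmetric] in auto)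
  qed (use hol in auto)
  let ?V = "\<Union>c\<in>C. ball c (\<delta> c / 2)"
  have V: "open ?V" by auto
  have "0 \<notin> ball c (\<delta> c / 2)" if "c \<in> C" for c
    using \<delta>[OF that] cn[OF that] by (auto simp: complexifies_def)
  then have nz: "0 \<notin> ?V" by blast
  show ?thesis unfolding Vomega_def
  proof (intro exI[of _ "{x. cayley x \<in> ?V}"] exI[of _ "\<lambda>x. g (cayley x)"] conjI ballI)
    show "p1_open {x. cayley x \<in> ?V}" by (rule p1_open_cayley_vimage[OF V nz])
    show "p1_holomorphic_on (\<lambda>x. g (cayley x)) {x. cayley x \<in> ?V}"
      by (rule p1_holomorphic_on_cayley[OF V nz g(1)])
    have half: "cayley t \<in> ball (cayley t) (\<delta> (cayley t) / 2)" if "t \<in> I" for t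
      using hol[of "cayley t"] that by (auto simp: C_def)
    show "I \<subseteq> {x. cayley x \<in> ?V}"
    proof
      fix t assume "t \<in> I"
      then show "t \<in> {x. cayley x \<in> ?V}" using half[of t] unfolding C_def by blast
    qed
    fix t assume t: "t \<in> I"
    then have tC: "cayley t \<in> C" by (simp add: C_def)
    have "g (cayley t) = K (cayley t) (cayley t) (cayley t)" by (rule g(2)[OF tC half[OF t]])
    also have "\<dots> = G (inv_cayley (cayley t))"
      by (rule complexifies_circle[OF \<delta>[OF tC], symmetric]) (use cn tC hol in auto)
    also have "inv_cayley (cayley t) = t" using cn[OF tC] by (intro inv_cayley_cayley) auto
    finally show "g (cayley t) = G t" .
  qed
qed

text \<open>Equal boundary values on an arc give equal diagonals, so the difference of the
  complexifications solves the homogeneous equation with zero diagonal. Equality on each symmetric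
  neighbourhood is then equality on their union.\<close>

lemma rho_injective:
  assumes r: "\<And>k::nat. r \<noteq> of_nat k + 2" and I: "p1R_open I"
    and 1: "I \<subseteq> U1" "Hb r U1 F1" "rho_cont r U1 F1 G1"
    and 2: "I \<subseteq> U2" "Hb r U2 F2" "rho_cont r U2 F2 G2"
    and eq: "\<And>t. t \<in> I \<Longrightarrow> G1 t = G2 t"
  shows "germ_eq I U1 F1 U2 F2"
proof -
  have ex: "\<exists>d. 0 < d \<and> d \<le> 1 \<and> sym_nbhd (cayley x) d \<subseteq> U1 \<inter> U2 \<and>
     (\<forall>z\<in>upper_part (sym_nbhd (cayley x) d). F1 z = F2 z)" if x: "x \<in> I" for x
  proof -
    let ?c = "cayley x"
    have xp: "x \<in> p1R" using x I p1R_open_subset by auto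
    then have c: "norm ?c = 1" using p1R_iff_cayley by blast
    obtain e where e: "0 < e" "e \<le> 1" "\<And>y. y \<in> p1R \<Longrightarrow> cayley y \<in> ball ?c e \<Longrightarrow> y \<in> I"
      using p1R_open_contains_arc[OF I x] by blast
    have xU: "x \<in> U1" "x \<in> U2" using 1 2 x by auto
    obtain d1 K1 where K1: "d1 \<le> e" "complexifies r U1 F1 G1 ?c d1 K1"
      by (rule complexification_exists[OF 1(2,3) xU(1) xp e(1)])
    then have "d1 > 0" by (simp add: complexifies_def)
    obtain d K2 where K2: "d \<le> d1" "complexifies r U2 F2 G2 ?c d K2"
      by (rule complexification_exists[OF 2(2,3) xU(2) xp \<open>d1 > 0\<close>])
    have d: "0 < d" "d \<le> 1" using K2 by (auto simp: complexifies_def)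
    have K1: "complexifies r U1 F1 G1 ?c d K1" by (rule complexifies_mono[OF K1(2) d(1) K2(1)])
    let ?B = "ball ?c d" and ?K = "\<lambda>u p. K1 u p - K2 u p"
    have h: "hol2 K1 (?B \<times> ?B)" "hol2 K2 (?B \<times> ?B)" using K1 K2 by (auto simp: complexifies_def)
    have K: "hol2 ?K (?B \<times> ?B)" by (intro hol2_diff h)
    have diag: "?K p p = 0" if "p \<in> ?B" for p
    proof (rule diagonal_zero[OF c d(1) K _ that])
      fix p assume p: "p \<in> ?B" "norm p = 1"
      have "inv_cayley p \<in> I"
        by (rule e(3)) (use inv_cayley_circle[OF p(2)] p K2(1) \<open>d1 \<le> e\<close> in auto)
      then show "K1 p p - K2 p p = 0"
        using eq complexifies_circle[OF K1 p(2,1)] complexifies_circle[OF K2(2) p(2,1)] by simp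
    qed
    have "ode_op r ?K u p = 0" if "u \<in> ?B" "p \<in> ?B" for u p
    proof -
      have dK: "deriv (?K u) p = deriv (K1 u) p - deriv (K2 u) p"
        by (rule deriv_diff) (use that hol2_fd2[OF h(1)] hol2_fd2[OF h(2)] in auto)
      have "ode_op r ?K u p = ode_op r K1 u p - ode_op r K2 u p"
        unfolding ode_op_def dK by (simp add: algebra_simps)
      also have "\<dots> = (r - 1) / p * ?K p p"
        using K1 K2(2) that by (simp add: complexifies_def algebra_simps)
      finally show ?thesis using diag[OF that(2)] by simp
    qed
    then have zero: "?K u p = 0" if "u \<in> ?B" "p \<in> ?B" for u p
      by (rule ode_unique[OF c d(2) K _ diag r that])
    have "F1 z = F2 z" if z: "z \<in> upper_part (sym_nbhd ?c d)" for z
    proof -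
      have "cay z \<in> ?B" "cay (cnj z) \<in> ?B" using z by (auto simp: upper_part_def sym_nbhd_def)
      then have "K1 (cay z) (cay (cnj z)) = K2 (cay z) (cay (cnj z))" using zero by fastforce
      then show ?thesis using K1 K2(2) z by (simp add: complexifies_def)
    qed
    moreover have "sym_nbhd ?c d \<subseteq> U1 \<inter> U2" using K1 K2(2) by (auto simp: complexifies_def)
    ultimately show ?thesis using d by blast
  qed
  then obtain \<delta> where \<delta>: "\<And>x. x \<in> I \<Longrightarrow> 0 < \<delta> x \<and> \<delta> x \<le> 1 \<and> sym_nbhd (cayley x) (\<delta> x) \<subseteq> U1 \<inter> U2 \<and>
     (\<forall>z\<in>upper_part (sym_nbhd (cayley x) (\<delta> x)). F1 z = F2 z)" by metis
  show ?thesis unfolding germ_eq_def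
  proof (intro exI[of _ "\<Union>x\<in>I. sym_nbhd (cayley x) (\<delta> x)"] conjI ballI)
    show "p1_open (\<Union>x\<in>I. sym_nbhd (cayley x) (\<delta> x))"
      using \<delta> by (intro p1_open_Union_sym_nbhd p1R_open_subset[OF I]) auto
    show "I \<subseteq> (\<Union>x\<in>I. sym_nbhd (cayley x) (\<delta> x))"
      using \<delta> by (intro subset_Union_sym_nbhd p1R_open_subset[OF I]) auto
    show "(\<Union>x\<in>I. sym_nbhd (cayley x) (\<delta> x)) \<subseteq> U1 \<inter> U2" using \<delta> by blast
    fix z assume "z \<in> upper_part (\<Union>x\<in>I. sym_nbhd (cayley x) (\<delta> x))"
    then show "F1 z = F2 z" using \<delta> by (auto simp: upper_part_def)
  qed
qed

text \<open>Both surjectivity statements pass through this construction. They differ in how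
  \<open>src\<close> is met: vacuously if no index is resonant, by a degree bound for polynomial
  data otherwise. One formula for \<open>F\<close> and \<open>G\<close> covers the union of all
  bidiscs.\<close>

lemma ode_sol_Hb:
  assumes I: "I \<subseteq> p1R"
    and \<epsilon>: "\<And>x. x \<in> I \<Longrightarrow> 0 < \<epsilon> x \<and> \<epsilon> x \<le> 1 \<and> \<phi> holomorphic_on ball (cayley x) (\<epsilon> x)"
    and src: "\<And>x k u. x \<in> I \<Longrightarrow> k > 0 \<Longrightarrow> r - 1 = of_nat k \<Longrightarrow> u \<in> ball (cayley x) (\<epsilon> x) \<Longrightarrow> taylor_src r \<phi> k u = 0"
  obtains U F G where "I \<subseteq> U" "Hb r U F" "rho_cont r U F G" "\<And>t. t \<in> I \<Longrightarrow> G t = \<phi> (cayley t)"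
proof -
  let ?K = "ode_sol r \<phi>" and ?B = "\<lambda>x. ball (cayley x) (\<epsilon> x / 8)"
  have c: "norm (cayley x) = 1" if "x \<in> I" for x using that I p1R_iff_cayley by blast
  have sol1: "hol2 ?K (?B x \<times> ?B x)" if "x \<in> I" for x
    using \<epsilon>[OF that] by (intro ode_sol(1)[OF c[OF that] _ _ _ src[OF that]]) auto
  have sol2: "ode_op r ?K u p = (r - 1) / p * \<phi> p" if "x \<in> I" "u \<in> ?B x" "p \<in> ?B x" for x u p
    using \<epsilon>[OF that(1)] by (intro ode_sol(2)[OF c[OF that(1)] _ _ _ src[OF that(1)] that(2,3)]) auto
  have sol3: "?K u u = \<phi> u" if "x \<in> I" "u \<in> ?B x" for x u
    using \<epsilon>[OF that(1)] by (intro ode_sol(3)[OF c[OF that(1)] _ _ _ src[OF that(1)] that(2)]) auto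
  define S where "S = (\<Union>x\<in>I. ?B x \<times> ?B x)"
  have K: "hol2 ?K S"
  proof (rule hol2_local)
    fix u p assume "(u, p) \<in> S"
    then obtain x where "x \<in> I" "(u, p) \<in> ?B x \<times> ?B x" unfolding S_def by blast
    then show "\<exists>T. (u, p) \<in> T \<and> hol2 ?K T" by (intro exI[of _ "?B x \<times> ?B x"] conjI sol1)
  qed (auto simp: S_def intro!: open_Times)
  define U where "U = (\<Union>x\<in>I. sym_nbhd (cayley x) (\<epsilon> x / 8))"
  have U: "p1_open U"
    unfolding U_def using \<epsilon> by (intro p1_open_Union_sym_nbhd I) force
  have IU: "I \<subseteq> U" unfolding U_def using \<epsilon> by (intro subset_Union_sym_nbhd I) simp
  define G where "G y = ?K (cayley y) (cayley (map_option cnj y))" for y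
  define F where "F z = f_r r z * ?K (cay z) (cay (cnj z))" for z
  have memU: "(cayley y, cayley (map_option cnj y)) \<in> S \<and> cayley y \<noteq> 0" if yU: "y \<in> U" for y
  proof -
    obtain x where x: "x \<in> I" "y \<in> sym_nbhd (cayley x) (\<epsilon> x / 8)" using yU by (auto simp: U_def)
    then have "0 \<notin> ?B x" using \<epsilon>[OF x(1)] by (intro sphere_ball_nonzero c) auto
    then show ?thesis using x unfolding sym_nbhd_def S_def by auto
  qed
  have V: "open (upper_part U)" by (rule open_upper_part[OF U])
  have Vz: "0 < Im z \<and> z \<noteq> \<i> \<and> (cay z, cay (cnj z)) \<in> S" if "z \<in> upper_part U" for z
    using that memU[of "Some z"] by (auto simp: upper_part_def cay_eq_0)
  have harm: "deriv (\<lambda>u. ode_op r ?K u (cay (cnj z))) (cay z) = 0" if zU: "z \<in> upper_part U" for z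
  proof -
    obtain x where x: "x \<in> I" "cay z \<in> ?B x" "cay (cnj z) \<in> ?B x"
      using Vz[OF zU] by (auto simp: S_def)
    have "((\<lambda>u. ode_op r ?K u (cay (cnj z))) has_field_derivative 0) (at (cay z))"
      by (rule has_field_derivative_transform_within_open[OF DERIV_const[of "(r - 1) / cay (cnj z) * \<phi> (cay (cnj z))"] open_ball x(2)])
        (use sol2[OF x(1)] x(3) in auto)
    then show ?thesis by (rule DERIV_imp_deriv)
  qed
  have "r_harmonic_on r (upper_part U) F"
    unfolding r_harmonic_on_def
    using r_harmonic_operator[OF K V Vz, of F r] harm by (simp add: F_def)
  moreover have rho: "rho_cont r U F G"
    unfolding rho_cont_def
  proof (intro conjI ballI impI)
    show "p1_real_analytic_on G U"
      unfolding G_def by (rule p1_real_analytic_on_cayley[OF K U memU])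
    fix z assume "z \<in> upper_part U"
    then show "G (Some z) = F z / f_r r z"
      using f_r_nonzero[of z r] Vz[of z] by (simp add: G_def F_def)
  qed
  ultimately have "Hb r U F" using U by (auto simp: Hb_def)
  show thesis
  proof (rule that[OF IU \<open>Hb r U F\<close> rho])
    fix t assume t: "t \<in> I"
    then show "G t = \<phi> (cayley t)" using sol3[OF t, of "cayley t"] \<epsilon>[OF t] I by (auto simp: G_def cnj_p1R)
  qed
qed

lemma rho_surjective:
  assumes r: "\<And>k::nat. r \<noteq> of_nat k + 2" and I: "p1R_open I" and \<phi>: "Vomega I \<phi>"
  obtains U F G where "I \<subseteq> U" "Hb r U F" "rho_cont r U F G" "\<And>t. t \<in> I \<Longrightarrow> G t = \<phi> t"
proof -
  obtain U g where U: "p1_open U" "I \<subseteq> U" "p1_holomorphic_on g U" "\<And>t. t \<in> I \<Longrightarrow> g t = \<phi> t"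
    using \<phi> by (auto simp: Vomega_def)
  have Ip: "I \<subseteq> p1R" by (rule p1R_open_subset[OF I])
  let ?g = "\<lambda>s. g (inv_cayley s)"
  have "\<exists>d. 0 < d \<and> d \<le> 1 \<and> ?g holomorphic_on ball (cayley x) d" if x: "x \<in> I" for x
  proof -
    obtain d h where d: "0 < d" "d \<le> 1" "h holomorphic_on ball (cayley x) d"
      "\<And>y. cayley y \<in> ball (cayley x) d \<Longrightarrow> y \<in> U \<and> g y = h (cayley y)"
      using p1_holomorphic_on_local[OF U(1,3)] x U(2) Ip by blast
    have "?g holomorphic_on ball (cayley x) d"
      by (rule holomorphic_transform[OF d(3)]) (use d(4)[of "inv_cayley _"] cayley_inv_cayley in auto)
    then show ?thesis using d by blast
  qed
  then obtain \<epsilon> where \<epsilon>: "\<And>x. x \<in> I \<Longrightarrow> 0 < \<epsilon> x \<and> \<epsilon> x \<le> 1 \<and> ?g holomorphic_on ball (cayley x) (\<epsilon> x)" by metis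
  \<comment> \<open>Here the exclusion of the integers from 2 on enters: no index is
    resonant.\<close>
  have rk: "r - 1 \<noteq> of_nat k" if "k > 0" for k
    using r[of "k - 1"] that by (auto simp: of_nat_diff algebra_simps)
  obtain V F G where V: "I \<subseteq> V" "Hb r V F" "rho_cont r V F G" "\<And>t. t \<in> I \<Longrightarrow> G t = ?g (cayley t)"
    by (rule ode_sol_Hb[OF Ip \<epsilon>]) (use rk in auto)
  show thesis
  proof (rule that[OF V(1-3)])
    fix t assume t: "t \<in> I"
    then have "norm (cayley t) = 1" using Ip p1R_iff_cayley by blast
    then have "inv_cayley (cayley t) = t" by (intro inv_cayley_cayley) auto
    then show "G t = \<phi> t" using V(4)[OF t] U(4)[OF t] by simp
  qed
qed

section \<open>Integral weights\<close>

text \<open>In Cayley coordinates \<open>f_r\<close> has the shape (1 - u)/u * (p (1 - u)/(p -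
  u))^(r-1), which exhibits its singularity along \<open>u = p\<close>.\<close>

lemma kernel_cay:
  assumes "Im z > 0" "z \<noteq> \<i>"
  shows "(cnj z - \<i>) / (cnj z - z) = cay (cnj z) * (1 - cay z) / (cay (cnj z) - cay z)"
    "2 * \<i> / (z - \<i>) = (1 - cay z) / cay z" "cay (cnj z) \<noteq> cay z" "cay z \<noteq> 0" "cay (cnj z) \<noteq> 0"
proof -
  define w where "w = cnj z"
  have nz: "z - \<i> \<noteq> 0" "z + \<i> \<noteq> 0" "w - \<i> \<noteq> 0" "w + \<i> \<noteq> 0" "w - z \<noteq> 0"
    using assms by (auto simp: w_def complex_eq_iff)
  have 1: "1 - cay z = 2 * \<i> / (z + \<i>)" using nz by (simp add: cay_def field_simps)
  have 2: "cay w - cay z = 2 * \<i> * (w - z) / ((z + \<i>) * (w + \<i>))"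
    using nz by (simp add: cay_def divide_simps) (simp add: algebra_simps)
  have "cay w - cay z \<noteq> 0" unfolding 2 using nz by simp
  then show "cay (cnj z) \<noteq> cay z" by (simp add: w_def)
  show "(cnj z - \<i>) / (cnj z - z) = cay (cnj z) * (1 - cay z) / (cay (cnj z) - cay z)"
    unfolding w_def[symmetric] 1 2 using nz by (simp add: cay_def)
  show "2 * \<i> / (z - \<i>) = (1 - cay z) / cay z" unfolding 1 using nz by (simp add: cay_def)
  show "cay z \<noteq> 0" "cay (cnj z) \<noteq> 0" using nz unfolding w_def cay_def by simp_all
qed

lemma f_r_nat:
  assumes "Im z > 0" "n \<ge> 1"
  shows "f_r (of_nat n) z = 2 * \<i> / (z - \<i>) * ((cnj z - \<i>) / (cnj z - z)) ^ (n - 1)"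
  unfolding f_r_def using assms kernel_base[of z "cnj z"] by (subst powr_nat_diff_1) auto

lemma C2_on_subset: "C2_on V F \<Longrightarrow> open W \<Longrightarrow> W \<subseteq> V \<Longrightarrow> C2_on W F"
  unfolding C2_on_def partials_cont_def by (auto elim: continuous_on_subset)

lemma Hb_subset:
  assumes "Hb r U F" "rho_cont r U F G" "p1_open V" "V \<subseteq> U"
  shows "Hb r V F" "rho_cont r V F G"
proof -
  have sub: "upper_part V \<subseteq> upper_part U" by (rule upper_part_mono[OF assms(4)])
  show rho: "rho_cont r V F G"
    using assms(2,4) sub by (auto simp: rho_cont_def p1_real_analytic_on_def)
  have "r_harmonic_on r (upper_part V) F"
    using assms(1) sub C2_on_subset[OF _ open_upper_part[OF assms(3)] sub]
    by (auto simp: Hb_def r_harmonic_on_def)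
  then show "Hb r V F" using rho assms(3) by (auto simp: Hb_def)
qed

lemma p1_holomorphic_on_subset:
  "p1_holomorphic_on g U \<Longrightarrow> V \<subseteq> U \<Longrightarrow> p1_holomorphic_on g V"
  unfolding p1_holomorphic_on_def by (auto elim: holomorphic_on_subset)

text \<open>The source \<open>(n - 1) / p * K p p\<close> vanishes by its factor for
  \<open>n = 1\<close> and by the boundary condition otherwise. The homogeneous solution contains
  \<open>(p - u) ^ (n - 1)\<close>, which cancels the pole of \<open>f_r\<close> on the diagonal and
  leaves a function of \<open>u\<close> alone.\<close>

lemma holomorphic_germ:
  assumes n: "n \<ge> 1" and I: "p1R_open I" "I \<subseteq> U" and F: "Hb (of_nat n) U F" "rho_cont (of_nat n) U F G"
    and zero: "n = 1 \<or> (\<forall>t::real. Some (complex_of_real t) \<in> I \<longrightarrow> G (Some (complex_of_real t)) = 0)"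
  shows "\<exists>U' F'. I \<subseteq> U' \<and> Hhol (of_nat n) U' F' \<and> germ_eq I U F U' F'"
proof -
  define C where "C = cayley ` I"
  have Ip: "I \<subseteq> p1R" by (rule p1R_open_subset[OF I(1)])
  have cn: "norm c = 1" if "c \<in> C" for c
    using that Ip p1R_iff_cayley by (auto simp: C_def)
  have ex: "\<exists>d H. 0 < d \<and> d \<le> 1 \<and> H holomorphic_on ball c d \<and> sym_nbhd c d \<subseteq> U \<and>
      (\<forall>z\<in>upper_part (sym_nbhd c d). F z = H (cay z))" if cC: "c \<in> C" for c
  proof -
    obtain x where x: "x \<in> I" "c = cayley x" using cC by (auto simp: C_def)
    obtain e where e: "0 < e" "e \<le> 1" "\<And>y. y \<in> p1R \<Longrightarrow> cayley y \<in> ball (cayley x) e \<Longrightarrow> y \<in> I"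
      using p1R_open_contains_arc[OF I(1) x(1)] by blast
    have xU: "x \<in> U" "x \<in> p1R" using x I Ip by auto
    obtain d K where dK: "d \<le> e" "complexifies (of_nat n) U F G c d K"
      unfolding x(2) by (rule complexification_exists[OF F xU e(1)])
    have d: "0 < d" "d \<le> 1" and K: "hol2 K (ball c d \<times> ball c d)" using dK by (auto simp: complexifies_def)
    note c = cn[OF cC]
    have diag: "(of_nat n - 1) * K p p = 0" if p: "p \<in> ball c d" for p
    proof (cases "n = 1")
      case False
      have "K p p = 0"
      proof (rule diagonal_zero[OF c d(1) K _ p])
        fix p assume p: "p \<in> ball c d" "norm p = 1" "p \<noteq> 1"
        have "inv_cayley p \<in> I"
          by (rule e(3)) (use inv_cayley_circle[OF p(2)] p dK(1) x in auto)
        moreover have "inv_cayley p \<noteq> None" using p(3) by (simp add: inv_cayley_def)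
        then obtain t :: real where "inv_cayley p = Some (of_real t)"
          using p1R_cases[OF inv_cayley_circle(1)[OF p(2)]] by auto
        ultimately show "K p p = 0"
          using zero False complexifies_circle[OF dK(2) p(2,1)] by simp
      qed
      then show ?thesis by simp
    qed simp
    have "ode_op (of_nat n) K u p = 0" if "u \<in> ball c d" "p \<in> ball c d" for u p
      using dK(2) that diag[OF that(2)] by (simp add: complexifies_def)
    then obtain h where h: "h holomorphic_on ball c d"
      "\<And>u p. u \<in> ball c d \<Longrightarrow> p \<in> ball c d \<Longrightarrow> (p / u) ^ (n - 1) * K u p = h u * (p - u) ^ (n - 1)"
      using ode_holomorphic_solution[OF c d(2) K n] by blast
    \<comment> \<open>The power of \<open>u\<close> comes from writing \<open>p\<close> as
      \<open>u * (p / u)\<close> in the numerator of \<open>f_r\<close>; this frees the factor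
      \<open>(p / u) ^ (n - 1)\<close> that belongs to \<open>h\<close>.\<close>
    define H where "H u = (1 - u) / u * (u * (1 - u)) ^ (n - 1) * h u" for u
    have nz: "0 \<notin> ball c d" by (rule sphere_ball_nonzero[OF c d(2)])
    have "H holomorphic_on ball c d"
      unfolding H_def by (intro holomorphic_intros h(1)) (use nz in auto)
    moreover have "F z = H (cay z)" if z: "z \<in> upper_part (sym_nbhd c d)" for z
    proof -
      have z': "Some z \<in> sym_nbhd c d" "Im z > 0" using z by (auto simp: upper_part_def)
      note zz = upper_sym_nbhd[OF c d(2) z']
      let ?u = "cay z" and ?p = "cay (cnj z)"
      note kc = kernel_cay[OF z'(2) zz(1)]
      have "F z = f_r (of_nat n) z * K ?u ?p" using dK(2) z by (simp add: complexifies_def)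
      also have "f_r (of_nat n) z = (1 - ?u) / ?u * (?p * (1 - ?u) / (?p - ?u)) ^ (n - 1)"
        unfolding f_r_nat[OF z'(2) n] kc(1,2) ..
      also have "(?p * (1 - ?u) / (?p - ?u)) ^ (n - 1)
         = (?u * (1 - ?u)) ^ (n - 1) * (?p / ?u) ^ (n - 1) / (?p - ?u) ^ (n - 1)"
      proof -
        have "?p * (1 - ?u) = (?u * (1 - ?u)) * (?p / ?u)" using kc by simp
        then show ?thesis by (simp only: power_divide power_mult_distrib)
      qed
      also have "(1 - ?u) / ?u * ((?u * (1 - ?u)) ^ (n - 1) * (?p / ?u) ^ (n - 1) / (?p - ?u) ^ (n - 1)) * K ?u ?p
         = (1 - ?u) / ?u * (?u * (1 - ?u)) ^ (n - 1) * ((?p / ?u) ^ (n - 1) * K ?u ?p) / (?p - ?u) ^ (n - 1)"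
        by (simp only: times_divide_eq_left times_divide_eq_right mult_ac)
      also have "(?p / ?u) ^ (n - 1) * K ?u ?p = h ?u * (?p - ?u) ^ (n - 1)"
        by (rule h(2)) (use zz in auto)
      finally show ?thesis using kc(3) by (simp add: H_def)
    qed
    moreover have "sym_nbhd c d \<subseteq> U" using dK(2) by (auto simp: complexifies_def)
    ultimately show ?thesis using d by blast
  qed
  then obtain \<delta> H where \<delta>: "\<And>c. c \<in> C \<Longrightarrow> 0 < \<delta> c \<and> \<delta> c \<le> 1 \<and> H c holomorphic_on ball c (\<delta> c) \<and>
      sym_nbhd c (\<delta> c) \<subseteq> U \<and> (\<forall>z\<in>upper_part (sym_nbhd c (\<delta> c)). F z = H c (cay z))" by metis
  have FH: "F (icay s) = H c s"
    if c: "c \<in> C" and s: "norm s < 1" "s \<noteq> 0" "s \<in> ball c (\<delta> c)" "1 / cnj s \<in> ball c (\<delta> c)" for c s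
  proof -
    have s1: "s \<noteq> 1" using s by auto
    then have cs: "cay (icay s) = s" by (rule cay_icay)
    then have i: "icay s \<noteq> \<i>" "icay s \<noteq> -\<i>" using s(2) cay_eq_0[of "icay s"] by auto
    have "Im (icay s) > 0" using norm_cay(1)[OF i(2)] cs s(1) by simp
    moreover have "cay (cnj (icay s)) = 1 / cnj s" using cay_cnj[OF i] cs by simp
    ultimately have "icay s \<in> upper_part (sym_nbhd c (\<delta> c))"
      using s cs by (simp add: upper_part_def sym_nbhd_def)
    then show ?thesis using \<delta>[OF c] cs by simp
  qed
  obtain g where g: "g holomorphic_on (\<Union>c\<in>C. ball c (\<delta> c / 2))"
    "\<And>c z. c \<in> C \<Longrightarrow> z \<in> ball c (\<delta> c / 2) \<Longrightarrow> g z = H c z"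
  proof (rule holomorphic_glue[of C \<delta> H])
    fix c c' assume c: "c \<in> C" "c' \<in> C" "c' \<in> ball c (\<delta> c)"
    let ?A = "ball c (\<delta> c) \<inter> ball c' (\<delta> c')"
    \<comment> \<open>The local functions are compared inside the disc, where both represent
      \<open>F\<close>.\<close>
    have "c' islimpt {s. norm s < 1 \<and> s \<noteq> 0 \<and> s \<in> ?A \<and> 1 / cnj s \<in> ?A}"
      using c cn \<delta> by (intro disc_islimpt) auto
    then show "c' islimpt {z \<in> ?A. H c z = H c' z}"
    proof (rule islimpt_subset)
      show "{s. norm s < 1 \<and> s \<noteq> 0 \<and> s \<in> ?A \<and> 1 / cnj s \<in> ?A} \<subseteq> {z \<in> ?A. H c z = H c' z}"
      proof
        fix s assume s: "s \<in> {s. norm s < 1 \<and> s \<noteq> 0 \<and> s \<in> ?A \<and> 1 / cnj s \<in> ?A}"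
        then have "H c s = F (icay s)" "H c' s = F (icay s)"
          using FH[OF c(1), of s] FH[OF c(2), of s] by auto
        then show "s \<in> {z \<in> ?A. H c z = H c' z}" using s by simp
      qed
    qed
  qed (use \<delta> in auto)
  let ?V = "\<Union>c\<in>C. ball c (\<delta> c / 2)"
  have V: "open ?V" by auto
  have "0 \<notin> ball c (\<delta> c / 2)" if "c \<in> C" for c
    using \<delta>[OF that] cn[OF that] by auto
  then have nz: "0 \<notin> ?V" by blast
  \<comment> \<open>Half radii, because \<open>g\<close> equals \<open>H c\<close> on the halved
    balls.\<close>
  define U' where "U' = (\<Union>x\<in>I. sym_nbhd (cayley x) (\<delta> (cayley x) / 2))"
  have \<delta>I: "0 < \<delta> (cayley x) / 2 \<and> \<delta> (cayley x) / 2 \<le> 1" if "x \<in> I" for x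
    using \<delta>[of "cayley x"] that by (auto simp: C_def)
  have U'o: "p1_open U'" unfolding U'_def using \<delta>I by (intro p1_open_Union_sym_nbhd Ip) blast
  have IU': "I \<subseteq> U'" unfolding U'_def using \<delta>I by (intro subset_Union_sym_nbhd Ip) blast
  have U'c: "\<exists>c\<in>C. y \<in> sym_nbhd c (\<delta> c / 2) \<and> y \<in> sym_nbhd c (\<delta> c)" if y: "y \<in> U'" for y
  proof -
    obtain x where x: "x \<in> I" "y \<in> sym_nbhd (cayley x) (\<delta> (cayley x) / 2)" using y by (auto simp: U'_def)
    then have "cayley x \<in> C" by (simp add: C_def)
    moreover have "\<delta> (cayley x) / 2 \<le> \<delta> (cayley x)" using \<delta>I[OF x(1)] by simp
    ultimately show ?thesis using x sym_nbhd_mono by blast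
  qed
  have U'U: "U' \<subseteq> U" using U'c \<delta> by blast
  have U'V: "U' \<subseteq> {x. cayley x \<in> ?V}" using U'c by (force simp: sym_nbhd_def)
  have gF: "g (cay z) = F z" if z: "z \<in> upper_part U'" for z
  proof -
    obtain c where c: "c \<in> C" "Some z \<in> sym_nbhd c (\<delta> c / 2)" "Some z \<in> sym_nbhd c (\<delta> c)"
      using U'c z by (auto simp: upper_part_def)
    have "g (cay z) = H c (cay z)" by (rule g(2)[OF c(1)]) (use c(2) in \<open>simp add: sym_nbhd_def\<close>)
    then show ?thesis using \<delta>[OF c(1)] c(3) z by (simp add: upper_part_def)
  qed
  have hb: "Hb (of_nat n) U' F" by (rule Hb_subset(1)[OF F U'o U'U])
  have hg: "p1_holomorphic_on (\<lambda>x. g (cayley x)) U'"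
    by (rule p1_holomorphic_on_subset[OF p1_holomorphic_on_cayley[OF V nz g(1)] U'V])
  have "(\<lambda>z. g (cayley (Some z))) holomorphic_on upper_part U'"
    using hg unfolding p1_holomorphic_on_def by (elim conjE holomorphic_on_subset) (auto simp: upper_part_def)
  then have "F holomorphic_on upper_part U'"
    by (rule holomorphic_transform) (use gF in simp)
  then have "Hhol (of_nat n) U' F" unfolding Hhol_def using hb hg gF by (intro conjI exI[of _ "\<lambda>x. g (cayley x)"]) auto
  moreover have "germ_eq I U F U' F"
    unfolding germ_eq_def using U'o IU' U'U by (intro exI[of _ U']) auto
  ultimately show ?thesis using IU' by blast
qed

text \<open>Division by \<open>f_r\<close> brings in \<open>(cnj z - z) ^ (n - 1)\<close>, which
  tends to 0 at a real point because \<open>n \<ge> 2\<close>, while the holomorphic extension of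
  \<open>F'\<close> stays bounded there. The limit is taken vertically from above.\<close>

lemma Hhol_boundary_zero:
  assumes n: "n \<ge> 2" and F: "Hb (of_nat n) U F" "rho_cont (of_nat n) U F G"
    and hol: "Hhol (of_nat n) U' F'" and germ: "germ_eq I U F U' F'" and t: "Some (complex_of_real t) \<in> I"
  shows "G (Some (complex_of_real t)) = 0"
proof -
  obtain W where W: "p1_open W" "I \<subseteq> W" "W \<subseteq> U \<inter> U'" "\<And>z. z \<in> upper_part W \<Longrightarrow> F z = F' z"
    using germ by (auto simp: germ_eq_def)
  obtain g where g: "p1_holomorphic_on g U'" "\<And>z. z \<in> upper_part U' \<Longrightarrow> g (Some z) = F' z"
    using hol by (auto simp: Hhol_def)
  let ?T = "complex_of_real t"
  have tW: "Some ?T \<in> W" using t W by auto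
  have oU': "open {z. Some z \<in> U'}" using hol by (simp add: Hhol_def Hb_def p1_open_def)
  have "real_analytic_at (\<lambda>w. G (Some w)) ?T"
    using F(2) tW W(3) by (auto simp: rho_cont_def p1_real_analytic_on_def)
  then have contG: "isCont (\<lambda>w. G (Some w)) ?T" by (rule real_analytic_at_continuous)
  have "(\<lambda>w. g (Some w)) holomorphic_on {z. Some z \<in> U'}" using g by (simp add: p1_holomorphic_on_def)
  then have contg: "isCont (\<lambda>w. g (Some w)) ?T"
    using holomorphic_on_imp_continuous_on oU' tW W(3) continuous_on_eq_continuous_at by fastforce
  have ti: "?T \<noteq> \<i>" by (simp add: complex_eq_iff)
  \<comment> \<open>The quotient by \<open>f_r\<close> with the holomorphic extension in the
    numerator, rearranged so that it is continuous at the real point itself.\<close>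
  let ?m = "\<lambda>z. g (Some z) * (z - \<i>) / (2 * \<i>) * ((cnj z - z) / (cnj z - \<i>)) ^ (n - 1)"
  have contm: "isCont ?m ?T"
    by (intro continuous_intros contg) (use ti in auto)
  let ?l = "\<lambda>\<eta>. ?T + \<i> * complex_of_real \<eta>"
  have l: "(?l \<longlongrightarrow> ?T) (at_right 0)" by (auto intro!: tendsto_eq_intros)
  have lim1: "((\<lambda>\<eta>. G (Some (?l \<eta>))) \<longlongrightarrow> G (Some ?T)) (at_right 0)"
    by (rule isCont_tendsto_compose[OF contG l])
  have lim2: "((\<lambda>\<eta>. ?m (?l \<eta>)) \<longlongrightarrow> ?m ?T) (at_right 0)"
    by (rule isCont_tendsto_compose[OF contm l])
  have "open ({z. Some z \<in> W} - {\<i>})" using W(1) by (auto simp: p1_open_def)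
  then have "\<forall>\<^sub>F \<eta> in at_right 0. ?l \<eta> \<in> {z. Some z \<in> W} - {\<i>}"
    using topological_tendstoD[OF l] tW ti by blast
  moreover have "\<forall>\<^sub>F \<eta>::real in at_right 0. \<eta> > 0" by (rule eventually_at_right_less)
  ultimately have "\<forall>\<^sub>F \<eta> in at_right 0. G (Some (?l \<eta>)) = ?m (?l \<eta>)"
  proof eventually_elim
    case (elim \<eta>)
    define z where "z = ?l \<eta>"
    have z: "Some z \<in> W" "z \<noteq> \<i>" "Im z > 0" using elim by (auto simp: z_def)
    then have up: "z \<in> upper_part W" "z \<in> upper_part U" "z \<in> upper_part U'"
      using W(3) by (auto simp: upper_part_def)
    have "G (Some z) = F z / f_r (of_nat n) z" using F(2) up z by (simp add: rho_cont_def)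
    also have "\<dots> = g (Some z) / (2 * \<i> / (z - \<i>) * ((cnj z - \<i>) / (cnj z - z)) ^ (n - 1))"
      using W(4)[OF up(1)] g(2)[OF up(3)] f_r_nat[OF z(3), of n] n by simp
    also have "\<dots> = ?m z" using z by (simp add: power_divide field_simps)
    finally show ?case by (simp add: z_def)
  qed
  then have "((\<lambda>\<eta>. ?m (?l \<eta>)) \<longlongrightarrow> G (Some ?T)) (at_right 0)"
    using lim1 by (rule Lim_transform_eventually[rotated])
  with lim2 have "G (Some ?T) = ?m ?T" by (intro tendsto_unique[OF trivial_limit_at_right_real])
  also have "\<dots> = 0" using n by simp
  finally show ?thesis .
qed

section \<open>Polynomial boundary values on the line and on the circle\<close>

text \<open>This is the action of Moebius maps on polynomials of degree at most \<open>m\<close>: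
  the power of the denominator turns each monomial of degree \<open>k\<close> into \<open>k\<close>
  linear numerators and \<open>m - k\<close> linear denominators.\<close>

lemma poly_moebius:
  fixes q :: "complex poly"
  assumes "degree q \<le> m"
  obtains P where "degree P \<le> m" "\<And>t. c * t + d \<noteq> 0 \<Longrightarrow> (c * t + d) ^ m * poly q ((a * t + b) / (c * t + d)) = poly P t"
proof -
  define P where "P = (\<Sum>k\<le>m. smult (coeff q k) ([:b, a:] ^ k * [:d, c:] ^ (m - k)))"
  show thesis
  proof (rule that[of P])
    show "degree P \<le> m" unfolding P_def
    proof (intro degree_sum_le)
      fix k assume "k \<in> {..m}"
      have lin: "degree ([:x, y:] ^ j) \<le> j" for x y :: complex and j
        using degree_power_le[of "[:x, y:]" j] by (simp split: if_splits)
      have "degree ([:b, a:] ^ k * [:d, c:] ^ (m - k)) \<le> k + (m - k)"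
        using degree_mult_le lin order_trans add_mono by meson
      then show "degree (smult (coeff q k) ([:b, a:] ^ k * [:d, c:] ^ (m - k))) \<le> m"
        using degree_smult_le order_trans \<open>k \<in> {..m}\<close> by fastforce
    qed auto
    fix t assume t: "c * t + d \<noteq> 0"
    let ?x = "(a * t + b) / (c * t + d)"
    have "poly q ?x = (\<Sum>k\<le>m. coeff q k * ?x ^ k)"
      unfolding poly_altdef by (rule sum.mono_neutral_left) (use assms in \<open>auto intro: coeff_eq_0\<close>)
    then have "(c * t + d) ^ m * poly q ?x = (\<Sum>k\<le>m. (c * t + d) ^ m * (coeff q k * ?x ^ k))"
      by (simp add: sum_distrib_left)
    also have "\<dots> = (\<Sum>k\<le>m. coeff q k * ((a * t + b) ^ k * (c * t + d) ^ (m - k)))"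
    proof (rule sum.cong)
      fix k assume "k \<in> {..m}"
      then have "(c * t + d) ^ m = (c * t + d) ^ k * (c * t + d) ^ (m - k)"
        by (simp flip: power_add)
      then show "(c * t + d) ^ m * (coeff q k * ?x ^ k) = coeff q k * ((a * t + b) ^ k * (c * t + d) ^ (m - k))"
        using t by (simp add: power_divide)
    qed simp
    also have "\<dots> = poly P t" by (simp add: P_def poly_sum add.commute mult.commute)
    finally show "(c * t + d) ^ m * poly q ?x = poly P t" .
  qed
qed

text \<open>On the circle the polynomial is \<open>p ^ (n - 2) * K p p\<close>. Since
  \<open>\<i> - t\<close> is \<open>(- t - \<i>) * cay t\<close>, the factor in \<open>res\<close>
  supplies this power of \<open>p\<close> and also the power of the denominator that makes a
  polynomial in \<open>cay t\<close> one in \<open>t\<close>.\<close>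

lemma res_locally_polynomial:
  assumes n: "n \<ge> 2" and I: "p1R_open I" "I \<subseteq> U" and F: "Hb (of_nat n) U F" "rho_cont (of_nat n) U F G"
    and x: "x \<in> I"
  shows "\<exists>J. p1R_open J \<and> x \<in> J \<and> J \<subseteq> I \<and> (\<exists>P::complex poly. degree P \<le> n - 2 \<and>
     (\<forall>t::real. Some (complex_of_real t) \<in> J \<longrightarrow>
       (\<i> - complex_of_real t) ^ (n - 2) * G (Some (complex_of_real t)) = poly P (complex_of_real t)))"
proof -
  let ?c = "cayley x"
  have xp: "x \<in> p1R" using x p1R_open_subset[OF I(1)] by auto
  then have c: "norm ?c = 1" using p1R_iff_cayley by blast
  obtain e where e: "0 < e" "e \<le> 1" "\<And>y. y \<in> p1R \<Longrightarrow> cayley y \<in> ball ?c e \<Longrightarrow> y \<in> I"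
    using p1R_open_contains_arc[OF I(1) x] by blast
  have xU: "x \<in> U" using x I by auto
  obtain d K where dK: "d \<le> e" "complexifies (of_nat n) U F G ?c d K"
    by (rule complexification_exists[OF F xU xp e(1)])
  have d: "0 < d" "d \<le> 1" and K: "hol2 K (ball ?c d \<times> ball ?c d)"
    and G: "\<And>y. y \<in> sym_nbhd ?c d \<Longrightarrow> G y = K (cayley y) (cayley (map_option cnj y))"
    using dK(2) by (auto simp: complexifies_def)
  obtain q :: "complex poly" where q: "degree q \<le> n - 2" "\<And>p. p \<in> ball ?c d \<Longrightarrow> p ^ (n - 2) * K p p = poly q p"
    by (rule ode_polynomial_boundary_value[OF c d(2) K n]) (use dK(2) in \<open>auto simp: complexifies_def\<close>)
  \<comment> \<open>\<open>cay t\<close> is written with both signs reversed so that its denominator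
    is the factor \<open>- t - \<i>\<close> occurring in \<open>\<i> - t\<close>.\<close>
  obtain P where P: "degree P \<le> n - 2" "\<And>t. - 1 * t + (- \<i>) \<noteq> 0 \<Longrightarrow>
      (- 1 * t + (- \<i>)) ^ (n - 2) * poly q ((- 1 * t + \<i>) / (- 1 * t + (- \<i>))) = poly P t"
    by (rule poly_moebius[OF q(1), where a = "- 1" and b = \<i> and c = "- 1" and d = "- \<i>"]) (rule that)
  show ?thesis
  proof (intro exI[of _ "sym_nbhd ?c d \<inter> p1R"] conjI exI[of _ P] allI impI)
    show "p1R_open (sym_nbhd ?c d \<inter> p1R)"
      unfolding p1R_open_def using p1_open_sym_nbhd[OF c d(2)] by blast
    show "x \<in> sym_nbhd ?c d \<inter> p1R" using mem_sym_nbhd[OF xp d(1)] xp by blast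
    show "sym_nbhd ?c d \<inter> p1R \<subseteq> I" using e(3) dK(1) by (auto simp: sym_nbhd_def)
    show "degree P \<le> n - 2" by (rule P(1))
    fix t :: real assume t: "Some (complex_of_real t) \<in> sym_nbhd ?c d \<inter> p1R"
    let ?t = "complex_of_real t"
    let ?p = "cay ?t"
    have nz: "?t + \<i> \<noteq> 0" "?t - \<i> \<noteq> 0" by (auto simp: complex_eq_iff)
    have pB: "?p \<in> ball ?c d" using t by (simp add: sym_nbhd_def)
    have "G (Some ?t) = K ?p ?p" using G[of "Some ?t"] t by simp
    moreover have "\<i> - ?t = (- ?t - \<i>) * ?p" using nz by (simp add: cay_def field_simps)
    ultimately have "(\<i> - ?t) ^ (n - 2) * G (Some ?t) = (- ?t - \<i>) ^ (n - 2) * (?p ^ (n - 2) * K ?p ?p)"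
      by (simp add: power_mult_distrib)
    also have "\<dots> = (- ?t - \<i>) ^ (n - 2) * poly q ?p" by (simp only: q(2)[OF pB])
    also have "?p = (- 1 * ?t + \<i>) / (- 1 * ?t + (- \<i>))"
    proof -
      have "- 1 * ?t + \<i> = - (?t - \<i>)" "- 1 * ?t + (- \<i>) = - (?t + \<i>)" by simp_all
      then show ?thesis by (simp only: cay_def minus_divide_divide)
    qed
    also have "(- ?t - \<i>) ^ (n - 2) * poly q ((- 1 * ?t + \<i>) / (- 1 * ?t + (- \<i>))) = poly P ?t"
    proof -
      have "- ?t - \<i> \<noteq> 0" by (simp add: complex_eq_iff)
      then show ?thesis using P(2)[of ?t] by simp
    qed
    finally show "(\<i> - ?t) ^ (n - 2) * G (Some ?t) = poly P ?t" .
  qed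
qed

lemma higher_deriv_poly_0:
  fixes q :: "complex poly"
  assumes "degree q < k"
  shows "(deriv ^^ k) (poly q) z = 0"
proof -
  have "(deriv ^^ k) (poly q) = poly ((pderiv ^^ k) q)" for k
    by (induction k) (auto intro!: ext DERIV_imp_deriv poly_DERIV)
  moreover have "(pderiv ^^ k) q = 0" using assms
  proof (induction k arbitrary: q)
    case (Suc k)
    show ?case
    proof (cases "degree q = 0")
      case True
      then have "pderiv q = 0" by (simp add: pderiv_eq_0_iff)
      moreover have "(pderiv ^^ k) (0 :: complex poly) = 0" by (induction k) auto
      ultimately show ?thesis by (simp only: funpow_Suc_right o_apply)
    next
      case False
      then have "degree (pderiv q) < k" using Suc.prems by (simp add: degree_pderiv)
      from Suc.IH[OF this] show ?thesis by (simp only: funpow_Suc_right o_apply)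
    qed
  qed simp
  ultimately show ?thesis by simp
qed

text \<open>With \<open>s = cay t\<close> one has
  \<open>\<i> - t = - 2 * \<i> * s / (1 - s)\<close>. The powers of \<open>1 - s\<close> pass into
  \<open>q\<close> and the rest into the denominator of \<open>\<phi>\<close>. The source is then a
  constant multiple of \<open>q\<close>, whose degree is below the resonant index, so the equation
  is solvable near the whole of \<open>p1R\<close>.\<close>

lemma res_surjective:
  assumes n: "n \<ge> 2" and P: "degree (P :: complex poly) \<le> n - 2"
  obtains U F G where "p1R \<subseteq> U" "Hb (of_nat n) U F" "rho_cont (of_nat n) U F G"
    "\<And>t::real. (\<i> - complex_of_real t) ^ (n - 2) * G (Some (complex_of_real t)) = poly P (complex_of_real t)"
proof -
  obtain q where q: "degree q \<le> n - 2" "\<And>s. - 1 * s + 1 \<noteq> 0 \<Longrightarrow>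
      (- 1 * s + 1) ^ (n - 2) * poly P ((\<i> * s + \<i>) / (- 1 * s + 1)) = poly q s"
    by (rule poly_moebius[OF P, where a = \<i> and b = \<i> and c = "- 1" and d = 1]) (rule that)
  define \<phi> where "\<phi> s = poly q s / (- 2 * \<i> * s) ^ (n - 2)" for s
  have c: "norm (cayley x) = 1" if "x \<in> p1R" for x using that p1R_iff_cayley by blast
  have nz: "0 \<notin> ball (cayley x) 1" if "x \<in> p1R" for x by (rule sphere_ball_nonzero) (use c that in auto)
  have \<phi>: "\<phi> holomorphic_on ball (cayley x) 1" if "x \<in> p1R" for x
    unfolding \<phi>_def[abs_def] by (intro holomorphic_intros) (use nz[OF that] in auto)
  have src: "taylor_src (of_nat n) \<phi> k u = 0"
    if k: "of_nat n - 1 = (of_nat k :: complex)" and x: "x \<in> p1R" and u: "u \<in> ball (cayley x) 1" for k u x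
  proof -
    have "of_nat n = (of_nat (Suc k) :: complex)" using k by (simp add: algebra_simps)
    \<comment> \<open>The resonant index is \<open>n - 1\<close>, one above the largest possible
      degree of \<open>q\<close>.\<close>
    then have nk: "n = Suc k" by (simp only: of_nat_eq_iff)
    let ?B = "ball (cayley x) 1"
    have u0: "u \<noteq> 0" using u nz[OF x] by auto
    let ?C = "1 / (- 2 * \<i> * u) ^ (n - 2)"
    have eq: "(p / u) powr (of_nat n - 2) * \<phi> p = ?C * poly q p" if p: "p \<in> ?B" for p
    proof -
      have p0: "p \<noteq> 0" using p nz[OF x] by auto
      have "of_nat n - 2 = (of_nat (n - 2) :: complex)" using n by (simp add: of_nat_diff)
      then have "(p / u) powr (of_nat n - 2) = (p / u) ^ (n - 2)"
        using p0 u0 by (simp add: powr_nat)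
      moreover have "- 2 * \<i> * p = (p / u) * (- 2 * \<i> * u)" using u0 by simp
      then have "(- 2 * \<i> * p) ^ (n - 2) = (p / u) ^ (n - 2) * (- 2 * \<i> * u) ^ (n - 2)"
        by (simp only: power_mult_distrib)
      ultimately show ?thesis using p0 u0 by (simp add: \<phi>_def)
    qed
    have "(deriv ^^ k) (\<lambda>p. (p / u) powr (of_nat n - 2) * \<phi> p) u = (deriv ^^ k) (\<lambda>p. ?C * poly q p) u"
    proof (rule higher_deriv_transform_within_open[OF _ _ open_ball u])
      show 1: "(\<lambda>p. ?C * poly q p) holomorphic_on ?B" by (intro holomorphic_intros)
      show "(\<lambda>p. (p / u) powr (of_nat n - 2) * \<phi> p) holomorphic_on ?B"
        by (rule holomorphic_transform[OF 1]) (use eq in auto)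
    qed (rule eq)
    also have "\<dots> = ?C * (deriv ^^ k) (poly q) u"
      by (rule higher_deriv_cmult[OF _ u open_ball]) (intro holomorphic_intros)
    also have "\<dots> = 0" using higher_deriv_poly_0[of q k u] q(1) nk n by simp
    finally show ?thesis by (simp add: taylor_src_def)
  qed
  obtain U F G where U: "p1R \<subseteq> U" "Hb (of_nat n) U F" "rho_cont (of_nat n) U F G" "\<And>t. t \<in> p1R \<Longrightarrow> G t = \<phi> (cayley t)"
    by (rule ode_sol_Hb[of p1R "\<lambda>_. 1" \<phi> "of_nat n"]) (use \<phi> src in auto)
  show thesis
  proof (rule that[OF U(1-3)])
    fix t :: real
    let ?t = "complex_of_real t"
    let ?s = "cay ?t"
    have nz: "?t + \<i> \<noteq> 0" "?t - \<i> \<noteq> 0" by (auto simp: complex_eq_iff)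
    have s: "1 - ?s = 2 * \<i> / (?t + \<i>)" using nz by (simp add: cay_def field_simps)
    have s1: "1 - ?s \<noteq> 0" "?s \<noteq> 0" using nz unfolding s by (auto simp: cay_def)
    have "?t \<noteq> -\<i>" using nz by (auto simp: eq_neg_iff_add_eq_0)
    then have ts: "\<i> * (1 + ?s) / (1 - ?s) = ?t" using icay_cay by (simp add: icay_def)
    have "\<i> - ?t = - 2 * \<i> * ?s / (1 - ?s)"
      unfolding s using nz by (simp add: cay_def field_simps)
    then have "(\<i> - ?t) ^ (n - 2) = (- 2 * \<i> * ?s) ^ (n - 2) / (1 - ?s) ^ (n - 2)"
      by (simp only: power_divide)
    moreover have "G (Some ?t) = poly q ?s / (- 2 * \<i> * ?s) ^ (n - 2)"
      using U(4)[of "Some ?t"] by (simp add: \<phi>_def p1R_def)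
    moreover have "(- 2 * \<i> * ?s) ^ (n - 2) \<noteq> 0" using s1 by simp
    moreover have "x = a / v \<Longrightarrow> g = b / a \<Longrightarrow> a \<noteq> 0 \<Longrightarrow> x * g = b / v" for x a v g b :: complex by simp
    ultimately have "(\<i> - ?t) ^ (n - 2) * G (Some ?t) = poly q ?s / (1 - ?s) ^ (n - 2)" by blast
    also have "poly q ?s = (1 - ?s) ^ (n - 2) * poly P ?t"
      using q(2)[of ?s] s1 ts by (simp add: algebra_simps)
    finally show "(\<i> - ?t) ^ (n - 2) * G (Some ?t) = poly P ?t" using s1 by simp
  qed
qed

theorem theorem6p14:
  shows
  \<comment> \<open>(i) rho_r is an isomorphism of sheaves W^omega_r \<rightarrow> V^omega_{2-r}\<close>
  "(\<forall>r::complex. r \<notin> {of_int n | n. 2 \<le> n} \<longrightarrow> (\<forall>I. p1R_open I \<longrightarrow>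
      (\<forall>U F G. I \<subseteq> U \<and> Hb r U F \<and> rho_cont r U F G \<longrightarrow> Vomega I G) \<and>
      (\<forall>U1 F1 G1 U2 F2 G2. I \<subseteq> U1 \<and> Hb r U1 F1 \<and> rho_cont r U1 F1 G1 \<and>
          I \<subseteq> U2 \<and> Hb r U2 F2 \<and> rho_cont r U2 F2 G2 \<and> (\<forall>t\<in>I. G1 t = G2 t)
          \<longrightarrow> germ_eq I U1 F1 U2 F2) \<and>
      (\<forall>\<phi>. Vomega I \<phi> \<longrightarrow> (\<exists>U F G. I \<subseteq> U \<and> Hb r U F \<and> rho_cont r U F G \<and>
          (\<forall>t\<in>I. G t = \<phi> t)))))
   \<and>
  \<comment> \<open>(ii)(a) W^{omega,hol}_1 = W^omega_1\<close>
   (\<forall>I U F. p1R_open I \<and> I \<subseteq> U \<and> Hb 1 U F \<longrightarrow>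
      (\<exists>U' F'. I \<subseteq> U' \<and> Hhol 1 U' F' \<and> germ_eq I U F U' F'))
   \<and>
  \<comment> \<open>(ii)(b) exactness of 0 \<rightarrow> W^{omega,hol}_r \<rightarrow> W^omega_r \<rightarrow> D^pol_{2-r} \<rightarrow> 0 for r \<ge> 2\<close>
   (\<forall>r::nat. 2 \<le> r \<longrightarrow>
      \<comment> \<open>res_r takes values in the constant sheaf D^pol_{2-r}\<close>
      (\<forall>I U F G. p1R_open I \<and> I \<subseteq> U \<and> Hb (of_nat r) U F \<and> rho_cont (of_nat r) U F G \<longrightarrow>
         (\<forall>x\<in>I. \<exists>J. p1R_open J \<and> x \<in> J \<and> J \<subseteq> I \<and>
            (\<exists>P::complex poly. degree P \<le> r - 2 \<and>
               (\<forall>t::real. Some (complex_of_real t) \<in> J \<longrightarrow>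
                  (\<i> - complex_of_real t) ^ (r - 2) * G (Some (complex_of_real t))
                    = poly P (complex_of_real t))))) \<and>
      \<comment> \<open>exactness in the middle: kernel of res_r = W^{omega,hol}_r\<close>
      (\<forall>I U F G. p1R_open I \<and> I \<subseteq> U \<and> Hb (of_nat r) U F \<and> rho_cont (of_nat r) U F G \<longrightarrow>
         ((\<forall>t::real. Some (complex_of_real t) \<in> I \<longrightarrow>
             (\<i> - complex_of_real t) ^ (r - 2) * G (Some (complex_of_real t)) = 0)
          \<longleftrightarrow> (\<exists>U' F'. I \<subseteq> U' \<and> Hhol (of_nat r) U' F' \<and> germ_eq I U F U' F'))) \<and>
      \<comment> \<open>surjectivity of res_r on stalks\<close>
      (\<forall>x\<in>p1R. \<forall>P::complex poly. degree P \<le> r - 2 \<longrightarrow>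
         (\<exists>J U F G. p1R_open J \<and> x \<in> J \<and> J \<subseteq> U \<and> Hb (of_nat r) U F \<and> rho_cont (of_nat r) U F G \<and>
            (\<forall>t::real. Some (complex_of_real t) \<in> J \<longrightarrow>
               (\<i> - complex_of_real t) ^ (r - 2) * G (Some (complex_of_real t))
                 = poly P (complex_of_real t)))))"
proof (intro conjI allI impI ballI; (elim conjE)?)
  have r: "r \<noteq> of_nat k + 2" if "r \<notin> {of_int n | n. 2 \<le> n}" for r :: complex and k :: nat
  proof
    assume "r = of_nat k + 2"
    then have "r = of_int (int k + 2)" by simp
    moreover have "2 \<le> int k + 2" by simp
    ultimately show False using that by blast
  qed
  {
    fix r :: complex and I \<phi>
    assume *: "r \<notin> {of_int n | n. 2 \<le> n}" "p1R_open I" "Vomega I \<phi>"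
    obtain U F G where "I \<subseteq> U" "Hb r U F" "rho_cont r U F G" "\<And>t. t \<in> I \<Longrightarrow> G t = \<phi> t"
      using rho_surjective[OF r[OF *(1)] *(2,3)] by blast
    then show "\<exists>U F G. I \<subseteq> U \<and> Hb r U F \<and> rho_cont r U F G \<and> (\<forall>t\<in>I. G t = \<phi> t)" by blast
  next
    fix r :: complex and I U1 F1 G1 U2 F2 G2
    assume *: "r \<notin> {of_int n | n. 2 \<le> n}" "p1R_open I" "I \<subseteq> U1" "Hb r U1 F1" "rho_cont r U1 F1 G1"
      "I \<subseteq> U2" "Hb r U2 F2" "rho_cont r U2 F2 G2" "\<forall>t\<in>I. G1 t = G2 t"
    show "germ_eq I U1 F1 U2 F2"
      by (rule rho_injective[OF r[OF *(1)] *(2-8)]) (use *(9) in blast)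
  }
next
  fix I U F assume *: "p1R_open I" "I \<subseteq> U" "Hb 1 U F"
  then obtain G where "rho_cont 1 U F G" by (auto simp: Hb_def)
  then show "\<exists>U' F'. I \<subseteq> U' \<and> Hhol 1 U' F' \<and> germ_eq I U F U' F'"
    using holomorphic_germ[of 1 I U F G] * by simp
next
  fix r :: nat and I U F G
  assume r: "2 \<le> r" and *: "p1R_open I" "I \<subseteq> U" "Hb (of_nat r) U F" "rho_cont (of_nat r) U F G"
  show "(\<forall>t::real. Some (complex_of_real t) \<in> I \<longrightarrow>
           (\<i> - complex_of_real t) ^ (r - 2) * G (Some (complex_of_real t)) = 0)
        \<longleftrightarrow> (\<exists>U' F'. I \<subseteq> U' \<and> Hhol (of_nat r) U' F' \<and> germ_eq I U F U' F')"
  proof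
    assume zero: "\<forall>t::real. Some (complex_of_real t) \<in> I \<longrightarrow>
           (\<i> - complex_of_real t) ^ (r - 2) * G (Some (complex_of_real t)) = 0"
    \<comment> \<open>The twisting factor has no real zero, so \<open>res\<close> and the
      restriction have the same kernel.\<close>
    have "\<i> - complex_of_real t \<noteq> 0" for t by (simp add: complex_eq_iff)
    then have "\<forall>t::real. Some (complex_of_real t) \<in> I \<longrightarrow> G (Some (complex_of_real t)) = 0"
      using zero by (metis mult_eq_0_iff power_not_zero)
    then show "\<exists>U' F'. I \<subseteq> U' \<and> Hhol (of_nat r) U' F' \<and> germ_eq I U F U' F'"
      using r by (intro holomorphic_germ[OF _ *]) auto
  next
    assume "\<exists>U' F'. I \<subseteq> U' \<and> Hhol (of_nat r) U' F' \<and> germ_eq I U F U' F'"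
    then show "\<forall>t::real. Some (complex_of_real t) \<in> I \<longrightarrow>
           (\<i> - complex_of_real t) ^ (r - 2) * G (Some (complex_of_real t)) = 0"
      using Hhol_boundary_zero[OF r *(3,4)] by auto
  qed
next
  fix r :: nat and x and P :: "complex poly"
  assume r: "2 \<le> r" and x: "x \<in> p1R" and P: "degree P \<le> r - 2"
  \<comment> \<open>The solution exists near all of \<open>p1R\<close>, so one \<open>J\<close>
    serves every stalk.\<close>
  have "p1R_open p1R"
    unfolding p1R_open_def by (intro exI[of _ UNIV]) (auto simp: p1_open_def)
  then show "\<exists>J U F G. p1R_open J \<and> x \<in> J \<and> J \<subseteq> U \<and> Hb (of_nat r) U F \<and> rho_cont (of_nat r) U F G \<and>
          (\<forall>t::real. Some (complex_of_real t) \<in> J \<longrightarrow>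
             (\<i> - complex_of_real t) ^ (r - 2) * G (Some (complex_of_real t))
               = poly P (complex_of_real t))"
    using res_surjective[OF r P] x by metis
qed (rule rho_Vomega res_locally_polynomial; assumption)+

end
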